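(* Let $\rho \in C_0(\mathbb{R}^n) \cap L^2(\mathbb{R}^n)$, $\rho \not\equiv 0$, be symmetric and positive semi-definite. On a closed domain (closed set) $\Omega \subset \mathbb{R}^n$, let $\mathcal{D} \in \mathbb{L}(\mathcal{M}(\Omega); C_0(\Omega))$ be defined by $\mathcal{D}\mu = \rho * \mu$ for $\mu \in \mathcal{M}(\Omega)$. Then: (i) $\mathcal{D}$ is self-adjoint and positive semi-definite. (ii) $\mathcal{D}$ is (strictly) positive definite on the discrete measures $\mathcal{Z}(\Omega)$, i.e. $\langle \mathcal{D}\mu | \mu\rangle > 0$ for all $0 \ne \mu \in \mathcal{Z}(\Omega)$. Assume further that $\Omega$ is compact, and that there exists $\rho^{1/2} \in L^2(\mathbb{R}^n) \cap C_0(\mathbb{R}^n)$ such that $\rho = \rho^{1/2} * \rho^{1/2}$. Let $\{\mu^k\}_{k\in\mathbb{N}} \subset \mathcal{M}(\Omega)$ and $\mu \in \mathcal{M}(\Omega)$. Then: (iii) If $\mu^k \rightharpoonup \mu$ weakly-$*$ in $\mathcal{M}(\Omega)$, then $\|\mu^k - \mu\|_{\mathcal{D}} \to 0$. (iv) If $V_{\rho^{1/2}}(\Omega)$ is fundamental for $C_0(\Omega)$, then $\|\mu^k-\mu\|_{\mathcal{D}} \to 0$ with $\{\mu^k\}_{k \in \mathbb{N}}$ bounded in $\mathcal{M}(\Omega)$ implies $\mu^k \rightharpoonup \mu$ weakly-$*$ in $\mathcal{M}(\Omega)$.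
   Context: All functions and measures are real-valued. $\mathcal{M}(\Omega)$ is the space of finite Radon measures on $\Omega$ with the Radon (total variation) norm. $C_0(\Omega)$ is the closure, in the supremum norm, of the space $C_c(\Omega)$ of continuous compactly supported functions on $\Omega$; it is the designated predual of $\mathcal{M}(\Omega)$ and weak-$*$ convergence is with respect to it. $\mathbb{L}(X;Y)$ denotes bounded linear operators. $\langle \phi | \mu \rangle = \int_\Omega \phi \, d\mu$ is the dual product. $\mathcal{Z}(\Omega) \subset \mathcal{M}(\Omega)$ is the set of discrete measures $\sum_{k=1}^m \alpha_k \delta_{x_k}$ with $m\in\mathbb{N}$, $\alpha_k \in \mathbb{R}$, $x_k \in \Omega$. $[\rho*\mu](x) = \int_\Omega \rho(x-y)\,d\mu(y)$. The function $\rho$ is symmetric if $\rho(-x)=\rho(x)$ for all $x$, and positive semi-definite if its Fourier transform satisfies $\mathcal{F}[\rho] \ge 0$, where $[\mathcal{F}u](\xi) = \int_{\mathbb{R}^n} u(x)e^{-2\pi \mathrm{i}\langle x,\xi\rangle}\,dx$, extended to $L^2(\mathbb{R}^n)$ by continuity. An operator $\mathcal{D} \in \mathbb{L}(\mathcal{M}(\Omega); C_0(\Omega))$ is self-adjoint if $\langle \mathcal{D}\mu|\nu\rangle = \langle \mathcal{D}\nu | \mu\rangle$ for all $\mu,\nu\in\mathcal{M}(\Omega)$, and positive semi-definite if $\langle \mathcal{D}\mu|\mu\rangle \ge 0$ for all $\mu\in\mathcal{M}(\Omega)$. The associated semi-norm is $\|\mu\|_{\mathcal{D}} = \sqrt{\langle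 \mathcal{D}\mu|\mu\rangle}$. For a function $\phi$ on $\mathbb{R}^n$, $V_\phi(\Omega) = \{x \mapsto \phi(x-y) \mid y \in \Omega\}$ (as functions on $\Omega$). A subset $V$ of a normed space $X$ is fundamental if its linear span is dense in $X$. *)

theory Defs
  imports "HOL-Analysis.Analysis"
begin

text \<open>
  Functions on a set \<open>\<Omega>\<close> are represented by functions on the whole space; only their values
  on \<open>\<Omega>\<close> are ever used. The sup-norm on \<open>\<Omega>\<close> is expressed by uniform bounds and
  uniform limits on \<open>\<Omega>\<close>.
\<close>

definition Cc :: "'a::euclidean_space set \<Rightarrow> ('a \<Rightarrow> real) set" where
  "Cc \<Omega> = {f. continuous_on \<Omega> f \<and>
     (\<exists>K. compact K \<and> K \<subseteq> \<Omega> \<and> (\<forall>x\<in>\<Omega> - K. f x = 0))}"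

definition C0 :: "'a::euclidean_space set \<Rightarrow> ('a \<Rightarrow> real) set" where
  "C0 \<Omega> = {f. \<exists>g. (\<forall>k::nat. g k \<in> Cc \<Omega>) \<and> uniform_limit \<Omega> g f sequentially}"

definition L2 :: "('a::euclidean_space \<Rightarrow> 'b::real_normed_vector) set" where
  "L2 = {f. f \<in> borel_measurable lborel \<and> integrable lborel (\<lambda>x. (norm (f x))\<^sup>2)}"

definition fourier :: "('a::euclidean_space \<Rightarrow> complex) \<Rightarrow> 'a \<Rightarrow> complex" where
  "fourier u \<xi> = (LINT x|lborel. u x * exp (- 2 * of_real pi * \<i> * of_real (x \<bullet> \<xi>)))"

definition L2_tendsto :: "(nat \<Rightarrow> 'a::euclidean_space \<Rightarrow> complex) \<Rightarrow> ('a \<Rightarrow> complex) \<Rightarrow> bool" where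
  "L2_tendsto w u \<longleftrightarrow>
     ((\<lambda>k. \<integral>\<^sup>+x. ennreal ((norm (w k x - u x))\<^sup>2) \<partial>lborel) \<longlongrightarrow> 0) sequentially"

text \<open>
  The extension of the Fourier transform by continuity from \<open>L\<^sup>1 \<inter> L\<^sup>2\<close> to
  \<open>L\<^sup>2\<close>, as a relation: \<open>v\<close> represents the transform of \<open>u\<close>. By Plancherel's theorem,
  \<open>v\<close> exists for every \<open>u\<close> in \<open>L\<^sup>2\<close>, is unique up to null sets, and does not
  depend on the approximating sequence.
\<close>

definition has_L2_fourier ::
    "('a::euclidean_space \<Rightarrow> complex) \<Rightarrow> ('a \<Rightarrow> complex) \<Rightarrow> bool" where
  "has_L2_fourier u v \<longleftrightarrow> u \<in> L2 \<and> v \<in> L2 \<and>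
     (\<exists>w. (\<forall>k. integrable lborel (w k) \<and> w k \<in> L2) \<and>
          L2_tendsto w u \<and> L2_tendsto (\<lambda>k. fourier (w k)) v)"

definition fun_symmetric :: "('a::euclidean_space \<Rightarrow> real) \<Rightarrow> bool" where
  "fun_symmetric \<rho> \<longleftrightarrow> (\<forall>x. \<rho> (- x) = \<rho> x)"

definition fun_pos_semidef :: "('a::euclidean_space \<Rightarrow> real) \<Rightarrow> bool" where
  "fun_pos_semidef \<rho> \<longleftrightarrow>
     (\<exists>v. has_L2_fourier (\<lambda>x. complex_of_real (\<rho> x)) v \<and>
          (AE \<xi> in lborel. v \<xi> \<in> \<real>\<^sub>\<ge>\<^sub>0))"

definition fun_conv ::
    "('a::euclidean_space \<Rightarrow> real) \<Rightarrow> ('a \<Rightarrow> real) \<Rightarrow> 'a \<Rightarrow> real" where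
  "fun_conv f g x = (LINT y|lborel. f (x - y) * g y)"

text \<open>
  A finite signed measure on \<open>\<Omega>\<close> is a real-valued set function on the Borel subsets of
  \<open>\<Omega>\<close>. It is set to 0 on all other sets, so that equality, sums and scalar multiples of
  measures are those of functions.
\<close>

abbreviation borel_sets_on :: "'a::euclidean_space set \<Rightarrow> 'a set set" where
  "borel_sets_on \<Omega> \<equiv> sets (restrict_space borel \<Omega>)"

definition countably_additive_real ::
    "'a::euclidean_space set \<Rightarrow> ('a set \<Rightarrow> real) \<Rightarrow> bool" where
  "countably_additive_real \<Omega> \<mu> \<longleftrightarrow>
     (\<forall>A::nat \<Rightarrow> 'a set. range A \<subseteq> borel_sets_on \<Omega> \<and> disjoint_family A \<longrightarrow>
        (\<lambda>i. \<mu> (A i)) sums \<mu> (\<Union>i. A i))"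

definition variation :: "'a::euclidean_space set \<Rightarrow> ('a set \<Rightarrow> real) \<Rightarrow> 'a set \<Rightarrow> real" where
  "variation \<Omega> \<mu> A =
     (SUP P\<in>{P. finite P \<and> P \<subseteq> borel_sets_on \<Omega> \<and> disjoint P \<and> \<Union>P = A}. \<Sum>B\<in>P. \<bar>\<mu> B\<bar>)"

definition radon_measures :: "'a::euclidean_space set \<Rightarrow> ('a set \<Rightarrow> real) set" where
  "radon_measures \<Omega> = {\<mu>.
     countably_additive_real \<Omega> \<mu> \<and>
     (\<forall>A. A \<notin> borel_sets_on \<Omega> \<longrightarrow> \<mu> A = 0) \<and>
     (\<forall>A\<in>borel_sets_on \<Omega>. \<forall>e>0. \<exists>K. compact K \<and> K \<subseteq> A \<and> variation \<Omega> \<mu> (A - K) < e)}"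

definition radon_norm :: "'a::euclidean_space set \<Rightarrow> ('a set \<Rightarrow> real) \<Rightarrow> real" where
  "radon_norm \<Omega> \<mu> = variation \<Omega> \<mu> \<Omega>"

text \<open>Jordan decomposition: the positive measures \<open>(\<bar>\<mu>\<bar> + \<mu>) / 2\<close> and \<open>(\<bar>\<mu>\<bar> - \<mu>) / 2\<close>.\<close>

definition pos_part_measure :: "'a::euclidean_space set \<Rightarrow> ('a set \<Rightarrow> real) \<Rightarrow> 'a measure" where
  "pos_part_measure \<Omega> \<mu> =
     measure_of \<Omega> (borel_sets_on \<Omega>) (\<lambda>A. ennreal ((variation \<Omega> \<mu> A + \<mu> A) / 2))"

definition neg_part_measure :: "'a::euclidean_space set \<Rightarrow> ('a set \<Rightarrow> real) \<Rightarrow> 'a measure" where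
  "neg_part_measure \<Omega> \<mu> =
     measure_of \<Omega> (borel_sets_on \<Omega>) (\<lambda>A. ennreal ((variation \<Omega> \<mu> A - \<mu> A) / 2))"

definition dual_pairing ::
    "'a::euclidean_space set \<Rightarrow> ('a \<Rightarrow> real) \<Rightarrow> ('a set \<Rightarrow> real) \<Rightarrow> real" where
  "dual_pairing \<Omega> \<phi> \<mu> =
     (LINT x|pos_part_measure \<Omega> \<mu>. \<phi> x) - (LINT x|neg_part_measure \<Omega> \<mu>. \<phi> x)"

definition dirac_measure :: "'a::euclidean_space set \<Rightarrow> 'a \<Rightarrow> 'a set \<Rightarrow> real" where
  "dirac_measure \<Omega> x A = (if A \<in> borel_sets_on \<Omega> \<and> x \<in> A then 1 else 0)"

definition discrete_measures :: "'a::euclidean_space set \<Rightarrow> ('a set \<Rightarrow> real) set" where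
  "discrete_measures \<Omega> =
     {\<mu>. \<exists>(m::nat) (\<alpha>::nat \<Rightarrow> real) x. (\<forall>k<m. x k \<in> \<Omega>) \<and>
          \<mu> = (\<lambda>A. \<Sum>k<m. \<alpha> k * dirac_measure \<Omega> (x k) A)}"

definition weak_star_tendsto ::
    "'a::euclidean_space set \<Rightarrow> (nat \<Rightarrow> 'a set \<Rightarrow> real) \<Rightarrow> ('a set \<Rightarrow> real) \<Rightarrow> bool" where
  "weak_star_tendsto \<Omega> \<mu>s \<mu> \<longleftrightarrow>
     (\<forall>\<phi>\<in>C0 \<Omega>. (\<lambda>k. dual_pairing \<Omega> \<phi> (\<mu>s k)) \<longlonglongrightarrow> dual_pairing \<Omega> \<phi> \<mu>)"

definition conv_measure ::
    "'a::euclidean_space set \<Rightarrow> ('a \<Rightarrow> real) \<Rightarrow> ('a set \<Rightarrow> real) \<Rightarrow> 'a \<Rightarrow> real" where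
  "conv_measure \<Omega> \<rho> \<mu> x = dual_pairing \<Omega> (\<lambda>y. \<rho> (x - y)) \<mu>"

definition bounded_operator ::
    "'a::euclidean_space set \<Rightarrow> (('a set \<Rightarrow> real) \<Rightarrow> 'a \<Rightarrow> real) \<Rightarrow> bool" where
  "bounded_operator \<Omega> D \<longleftrightarrow>
     (\<forall>\<mu>\<in>radon_measures \<Omega>. D \<mu> \<in> C0 \<Omega>) \<and>
     (\<forall>\<mu>\<in>radon_measures \<Omega>. \<forall>\<nu>\<in>radon_measures \<Omega>. \<forall>x\<in>\<Omega>.
        D (\<lambda>A. \<mu> A + \<nu> A) x = D \<mu> x + D \<nu> x) \<and>
     (\<forall>\<mu>\<in>radon_measures \<Omega>. \<forall>c::real. \<forall>x\<in>\<Omega>. D (\<lambda>A. c * \<mu> A) x = c * D \<mu> x) \<and>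
     (\<exists>C. \<forall>\<mu>\<in>radon_measures \<Omega>. \<forall>x\<in>\<Omega>. \<bar>D \<mu> x\<bar> \<le> C * radon_norm \<Omega> \<mu>)"

definition self_adjoint ::
    "'a::euclidean_space set \<Rightarrow> (('a set \<Rightarrow> real) \<Rightarrow> 'a \<Rightarrow> real) \<Rightarrow> bool" where
  "self_adjoint \<Omega> D \<longleftrightarrow>
     (\<forall>\<mu>\<in>radon_measures \<Omega>. \<forall>\<nu>\<in>radon_measures \<Omega>.
        dual_pairing \<Omega> (D \<mu>) \<nu> = dual_pairing \<Omega> (D \<nu>) \<mu>)"

definition op_pos_semidef ::
    "'a::euclidean_space set \<Rightarrow> (('a set \<Rightarrow> real) \<Rightarrow> 'a \<Rightarrow> real) \<Rightarrow> bool" where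
  "op_pos_semidef \<Omega> D \<longleftrightarrow> (\<forall>\<mu>\<in>radon_measures \<Omega>. dual_pairing \<Omega> (D \<mu>) \<mu> \<ge> 0)"

definition op_seminorm ::
    "'a::euclidean_space set \<Rightarrow> (('a set \<Rightarrow> real) \<Rightarrow> 'a \<Rightarrow> real) \<Rightarrow> ('a set \<Rightarrow> real) \<Rightarrow> real" where
  "op_seminorm \<Omega> D \<mu> = sqrt (dual_pairing \<Omega> (D \<mu>) \<mu>)"

definition translates :: "('a::euclidean_space \<Rightarrow> real) \<Rightarrow> 'a set \<Rightarrow> ('a \<Rightarrow> real) set" where
  "translates \<phi> \<Omega> = {\<lambda>x. \<phi> (x - y) | y. y \<in> \<Omega>}"

definition fun_span :: "('a \<Rightarrow> real) set \<Rightarrow> ('a \<Rightarrow> real) set" where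
  "fun_span V = {\<lambda>x. \<Sum>v\<in>F. c v * v x | F c. finite F \<and> F \<subseteq> V}"

definition fundamental_C0 :: "'a::euclidean_space set \<Rightarrow> ('a \<Rightarrow> real) set \<Rightarrow> bool" where
  "fundamental_C0 \<Omega> V \<longleftrightarrow> V \<subseteq> C0 \<Omega> \<and>
     (\<forall>f\<in>C0 \<Omega>. \<exists>g. (\<forall>k::nat. g k \<in> fun_span V) \<and> uniform_limit \<Omega> g f sequentially)"

end

(*
  The proof of positivity is Fourier-analytic. Regularising with Gaussians and letting their width tend
  to 0 shows that the L^2 transform v of rho is integrable (it is nonnegative and rho is bounded), so
  that rho is its inverse transform pointwise. Fubini's theorem then gives
  <D mu | mu> = integral of v |m|^2, where m is the characteristic function of mu; this is (i).
  For a discrete measure m is a trigonometric polynomial, whose zeros form a null set; this is (ii).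

  For (iii), weak-* convergent sequences are bounded by Baire's theorem, and translates of the uniformly
  continuous function rho over a compact set are equicontinuous, so rho * (mu^k - mu) tends to 0 uniformly.

  For (iv), a real square root of rho is necessarily symmetric, because the square of its transform is v >= 0.
  Hence <D nu | nu> is the squared L^2 norm of rho^(1/2) * nu. For bounded nu = mu^k - mu these convolutions
  are equicontinuous, so convergence to 0 in L^2 is pointwise convergence, that is, convergence on translates
  of rho^(1/2).
*)

theory Submission
  imports Defs "HOL-Probability.Probability" "HOL-Complex_Analysis.Complex_Analysis"
begin

section \<open>Polar decomposition of signed measures\<close>


text \<open>Two definitions shape the proof. The pairing is given through the Jordan parts of a
  signed set function, and these do not depend linearly on the measure. Every measure is therefore
  written as a sign \<open>\<sigma>\<close> times its variation, which makes Fubini's theorem and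
  dominated convergence available; linearity in the measure comes from a uniqueness statement for
  functionals on bounded Borel functions. The L^2 transform is only a relation through approximating
  sequences. What is extracted from it is an identity between Gaussian averages of
  \<open>\<rho>\<close> and Gaussian-damped inverse transforms of \<open>v\<close>: both sides are
  pairings with fixed L^2 functions, hence stable under the approximation. Gaussians serve because
  they are their own transforms, so that the regularised inversion formula is one exchange of
  integrals. Symmetry of the square root is the place where this does not suffice: the root need not
  be integrable, and the square of its transform has to be built as an L^1 limit.\<close>

lemma borel_sets_on_subset: "A \<in> borel_sets_on \<Omega> \<Longrightarrow> A \<subseteq> \<Omega>"
  using sets.sets_into_space[of A "restrict_space borel \<Omega>"] by (simp add: space_restrict_space)

section \<open>Hahn decomposition of a countably additive real set function\<close>

context
  fixes \<Omega> :: "'a::euclidean_space set" and \<mu> :: "'a set \<Rightarrow> real"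
  assumes ca: "countably_additive_real \<Omega> \<mu>"
begin

lemma ca_sums:
  "range A \<subseteq> borel_sets_on \<Omega> \<Longrightarrow> disjoint_family A \<Longrightarrow> (\<lambda>i. \<mu> (A i)) sums \<mu> (\<Union>i. A i)"
  using ca unfolding countably_additive_real_def by blast

text \<open>The constant family \<open>{}\<close> is disjoint, so a constant real series converges,
  which forces its terms to be 0.\<close>

lemma ca_empty: "\<mu> {} = 0"
proof -
  have "(\<lambda>i::nat. \<mu> {}) sums \<mu> {}"
    using ca_sums[of "\<lambda>i. {}"] by (simp add: disjoint_family_on_def)
  then show ?thesis
    using summable_const_iff sums_summable by blast
qed

lemma ca_Un:
  assumes "A \<in> borel_sets_on \<Omega>" "B \<in> borel_sets_on \<Omega>" "A \<inter> B = {}"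
  shows "\<mu> (A \<union> B) = \<mu> A + \<mu> B"
proof -
  have "(\<lambda>i. \<mu> (binaryset A B i)) sums \<mu> (\<Union>i. binaryset A B i)"
  proof (rule ca_sums)
    show "range (binaryset A B) \<subseteq> borel_sets_on \<Omega>"
      using assms by (auto simp: range_binaryset_eq)
    show "disjoint_family (binaryset A B)"
      using assms by (auto simp: disjoint_family_on_def binaryset_def)
  qed
  moreover have "(\<lambda>i. \<mu> (binaryset A B i)) sums (\<mu> A + \<mu> B)"
    by (rule binaryset_sums) (rule ca_empty)
  ultimately show ?thesis
    by (simp add: sums_unique2 UN_binaryset_eq)
qed

lemma ca_Diff:
  assumes "A \<in> borel_sets_on \<Omega>" "B \<in> borel_sets_on \<Omega>" "B \<subseteq> A"
  shows "\<mu> (A - B) = \<mu> A - \<mu> B"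
  using ca_Un[of B "A - B"] assms by (simp add: Un_absorb1)

lemma ca_split:
  assumes "A \<in> borel_sets_on \<Omega>" "B \<in> borel_sets_on \<Omega>"
  shows "\<mu> A = \<mu> (A \<inter> B) + \<mu> (A - B)"
  using ca_Un[of "A \<inter> B" "A - B"] assms by (simp add: Int_Diff_Un Int_Diff_disjoint)

text \<open>The rings \<open>A i - A (Suc i)\<close> are disjoint with union \<open>A 0\<close>
  minus the intersection, and their measures telescope. All values are real, so
  \<open>\<mu> (A 0)\<close> can be cancelled at the end.\<close>

lemma ca_decseq:
  assumes A: "\<And>n::nat. A n \<in> borel_sets_on \<Omega>" and dec: "decseq A"
  shows "(\<lambda>n. \<mu> (A n)) \<longlonglongrightarrow> \<mu> (\<Inter>n. A n)"
proof -
  have [simp]: "(\<Inter>n. A n) \<in> borel_sets_on \<Omega>"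
    using A by (intro sets.countable_INT) auto
  have sub: "A (Suc n) \<subseteq> A n" for n
    using dec by (simp add: decseq_Suc_iff)
  have "(\<lambda>i. \<mu> (A i - A (Suc i))) sums \<mu> (\<Union>i. A i - A (Suc i))"
  proof (rule ca_sums)
    show "range (\<lambda>i. A i - A (Suc i)) \<subseteq> borel_sets_on \<Omega>" using A by auto
    have "(A i - A (Suc i)) \<inter> (A j - A (Suc j)) = {}" if "i < j" for i j
      using dec that by (auto simp: decseq_def dest: Suc_leI)
    then show "disjoint_family (\<lambda>i. A i - A (Suc i))"
      unfolding disjoint_family_on_def by (metis Int_commute linorder_neqE_nat)
  qed
  moreover have "(\<Union>i. A i - A (Suc i)) = A 0 - (\<Inter>n. A n)"
  proof (intro equalityI subsetI)
    fix x assume "x \<in> (\<Union>i. A i - A (Suc i))"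
    then show "x \<in> A 0 - (\<Inter>n. A n)" using dec by (auto simp: decseq_def)
  next
    fix x assume x: "x \<in> A 0 - (\<Inter>n. A n)"
    show "x \<in> (\<Union>i. A i - A (Suc i))"
    proof (rule ccontr)
      assume n: "x \<notin> (\<Union>i. A i - A (Suc i))"
      have "x \<in> A n" for n using x n by (induction n) auto
      then show False using x by blast
    qed
  qed
  moreover have "(\<Sum>i<n. \<mu> (A i - A (Suc i))) = \<mu> (A 0) - \<mu> (A n)" for n
    by (induction n) (auto simp: ca_Diff A sub)
  ultimately have "(\<lambda>n. \<mu> (A 0) - \<mu> (A n)) \<longlonglongrightarrow> \<mu> (A 0) - \<mu> (\<Inter>n. A n)"
    using ca_Diff[of "A 0" "\<Inter>n. A n"] A by (auto simp: sums_def INF_lower)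
  from tendsto_diff[OF tendsto_const[of "\<mu> (A 0)"] this] show ?thesis by simp
qed

text \<open>If no such subset existed, every candidate would contain a set of measure below
  \<open>- e\<close>. Removing such sets one after another raises the measure by at least
  \<open>e\<close> each time, although the measures of a decreasing sequence converge.\<close>

lemma ca_subset_ge_minus:
  assumes A: "A \<in> borel_sets_on \<Omega>" and e: "e > 0"
  shows "\<exists>A'\<in>borel_sets_on \<Omega>. A' \<subseteq> A \<and> \<mu> A \<le> \<mu> A' \<and>
     (\<forall>B\<in>borel_sets_on \<Omega>. B \<subseteq> A' \<longrightarrow> - e \<le> \<mu> B)"
proof (rule ccontr)
  assume "\<not> ?thesis"
  then have "\<forall>A'. \<exists>B. A' \<in> borel_sets_on \<Omega> \<and> A' \<subseteq> A \<and> \<mu> A \<le> \<mu> A' \<longrightarrow>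
    B \<in> borel_sets_on \<Omega> \<and> B \<subseteq> A' \<and> \<mu> B < - e"
    by (meson not_le)
  then obtain b where b: "\<And>A'. A' \<in> borel_sets_on \<Omega> \<Longrightarrow> A' \<subseteq> A \<Longrightarrow> \<mu> A \<le> \<mu> A' \<Longrightarrow>
    b A' \<in> borel_sets_on \<Omega> \<and> b A' \<subseteq> A' \<and> \<mu> (b A') < - e"
    by metis
  define D where "D = rec_nat A (\<lambda>_ A'. A' - b A')"
  have D0: "D 0 = A" and DS: "D (Suc n) = D n - b (D n)" for n
    by (simp_all add: D_def)
  have inv: "D n \<in> borel_sets_on \<Omega> \<and> D n \<subseteq> A \<and> \<mu> A + real n * e \<le> \<mu> (D n)" for n
  proof (induction n)
    case (Suc n)
    have "0 \<le> real n * e" using e by simp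
    then have "\<mu> A \<le> \<mu> (D n)" using Suc by linarith
    with b[of "D n"] Suc have b': "b (D n) \<in> borel_sets_on \<Omega>" "b (D n) \<subseteq> D n" "\<mu> (b (D n)) < - e"
      by auto
    then have "\<mu> (D (Suc n)) = \<mu> (D n) - \<mu> (b (D n))" using Suc by (simp add: DS ca_Diff)
    moreover have "real (Suc n) * e = real n * e + e" by (simp add: algebra_simps)
    ultimately have "\<mu> A + real (Suc n) * e \<le> \<mu> (D (Suc n))" using Suc b'(3) by linarith
    moreover have "D (Suc n) \<in> borel_sets_on \<Omega>" "D (Suc n) \<subseteq> A" using Suc b' by (auto simp: DS)
    ultimately show ?case by blast
  qed (simp add: D0 A)
  have "decseq D" by (simp add: decseq_Suc_iff DS)
  then have "convergent (\<lambda>n. \<mu> (D n))"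
    using ca_decseq[of D] inv by (auto simp: convergent_def)
  then have "bdd_above (range (\<lambda>n. \<mu> (D n)))"
    by (meson convergent_imp_Bseq Bseq_bdd_above)
  then obtain K where K: "\<And>n. \<mu> (D n) \<le> K" by (auto simp: bdd_above_def)
  obtain n :: nat where "K - \<mu> A < real n * e" using e reals_Archimedean3 by blast
  with inv[of n] K[of n] show False by linarith
qed

text \<open>Shrinking with tolerance \<open>1 / (n + 1)\<close> at stage \<open>n\<close> never
  lowers the measure. A subset of the intersection lies in every stage, so its measure is at least
  \<open>- 1 / (n + 1)\<close> for all \<open>n\<close>.\<close>

lemma ca_positive_subset:
  assumes A: "A \<in> borel_sets_on \<Omega>"
  shows "\<exists>A'\<in>borel_sets_on \<Omega>. A' \<subseteq> A \<and> \<mu> A \<le> \<mu> A' \<and>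
     (\<forall>B\<in>borel_sets_on \<Omega>. B \<subseteq> A' \<longrightarrow> 0 \<le> \<mu> B)"
proof -
  define R where "R n A A' \<longleftrightarrow> A' \<in> borel_sets_on \<Omega> \<and> A' \<subseteq> A \<and> \<mu> A \<le> \<mu> A' \<and>
     (\<forall>B\<in>borel_sets_on \<Omega>. B \<subseteq> A' \<longrightarrow> - inverse (real (Suc n)) \<le> \<mu> B)" for n A A'
  have "\<exists>A'. A \<in> borel_sets_on \<Omega> \<longrightarrow> R n A A'" for A n
    using ca_subset_ge_minus[of A "inverse (real (Suc n))"] unfolding R_def by auto
  then obtain g where g': "\<And>A n. A \<in> borel_sets_on \<Omega> \<Longrightarrow> R n A (g A n)"
    by metis
  have g: "g A n \<in> borel_sets_on \<Omega> \<and> g A n \<subseteq> A \<and>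
     \<mu> A \<le> \<mu> (g A n) \<and> (\<forall>B\<in>borel_sets_on \<Omega>. B \<subseteq> g A n \<longrightarrow> - inverse (real (Suc n)) \<le> \<mu> B)"
    if "A \<in> borel_sets_on \<Omega>" for A n
    using g'[OF that] unfolding R_def .
  define D where "D = rec_nat A (\<lambda>n A'. g A' n)"
  have D0: "D 0 = A" and DS: "D (Suc n) = g (D n) n" for n
    by (simp_all add: D_def)
  have inv: "D n \<in> borel_sets_on \<Omega> \<and> D n \<subseteq> A \<and> \<mu> A \<le> \<mu> (D n)" for n
  proof (induction n)
    case (Suc n)
    then show ?case using g[of "D n" n] by (auto simp: DS)
  qed (simp add: D0 A)
  have dec: "decseq D" using g inv by (simp add: decseq_Suc_iff DS)
  show ?thesis
  proof (intro bexI conjI ballI impI)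
    show "(\<Inter>n. D n) \<in> borel_sets_on \<Omega>"
      using inv by (intro sets.countable_INT) auto
    show "(\<Inter>n. D n) \<subseteq> A" using D0 by blast
    show "\<mu> A \<le> \<mu> (\<Inter>n. D n)"
      by (rule LIMSEQ_le_const[OF ca_decseq]) (use inv dec in auto)
    fix B assume B: "B \<in> borel_sets_on \<Omega>" "B \<subseteq> (\<Inter>n. D n)"
    have "- inverse (real (Suc n)) \<le> \<mu> B" for n
      using g[of "D n" n] inv[of n] B by (metis DS INT_lower UNIV_I order_trans)
    moreover have "(\<lambda>n. - inverse (real (Suc n))) \<longlonglongrightarrow> - 0"
      by (intro tendsto_minus LIMSEQ_inverse_real_of_nat)
    ultimately show "0 \<le> \<mu> B" by (intro LIMSEQ_le_const2[of "\<lambda>n. - inverse (real (Suc n))" 0]) auto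
  qed
qed

text \<open>A set inside the union is cut along the disjointed family into countably many pieces,
  each inside one positive set.\<close>

lemma ca_positive_UN:
  assumes P: "\<And>n::nat. P n \<in> borel_sets_on \<Omega>"
    and pos: "\<And>n B. B \<in> borel_sets_on \<Omega> \<Longrightarrow> B \<subseteq> P n \<Longrightarrow> 0 \<le> \<mu> B"
    and B: "B \<in> borel_sets_on \<Omega>" "B \<subseteq> (\<Union>n. P n)"
  shows "0 \<le> \<mu> B"
proof -
  have d: "disjointed P n \<in> borel_sets_on \<Omega>" for n
    using sets.range_disjointed_sets[of P "restrict_space borel \<Omega>"] P by blast
  have "(\<lambda>n. \<mu> (B \<inter> disjointed P n)) sums \<mu> (\<Union>n. B \<inter> disjointed P n)"
  proof (rule ca_sums)
    show "range (\<lambda>n. B \<inter> disjointed P n) \<subseteq> borel_sets_on \<Omega>"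
      using B d by auto
    show "disjoint_family (\<lambda>n. B \<inter> disjointed P n)"
      using disjoint_family_disjointed[of P] by (auto simp: disjoint_family_on_def)
  qed
  moreover have "(\<Union>n. B \<inter> disjointed P n) = B"
    using B UN_disjointed_eq[of P] by blast
  moreover have "0 \<le> \<mu> (B \<inter> disjointed P n)" for n
    using B d disjointed_subset[of P n] by (intro pos[of _ n]) auto
  ultimately show ?thesis
    using sums_le[OF _ sums_zero, of "\<lambda>n. \<mu> (B \<inter> disjointed P n)"] by simp
qed

text \<open>\<open>H\<close> is a union of positive sets whose measures approach the supremum over
  all positive sets; being positive itself, it attains this supremum.\<close>

lemma hahn_decomposition:
  obtains H where "H \<in> borel_sets_on \<Omega>"
    "\<And>B. B \<in> borel_sets_on \<Omega> \<Longrightarrow> B \<subseteq> H \<Longrightarrow> 0 \<le> \<mu> B"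
    "\<And>B. B \<in> borel_sets_on \<Omega> \<Longrightarrow> B \<inter> H = {} \<Longrightarrow> \<mu> B \<le> 0"
proof -
  define pos where "pos = {P \<in> borel_sets_on \<Omega>. \<forall>B\<in>borel_sets_on \<Omega>. B \<subseteq> P \<longrightarrow> 0 \<le> \<mu> B}"
  have UN: "(\<Union>n. P n) \<in> pos \<and> (\<forall>n. \<mu> (P n) \<le> \<mu> (\<Union>n. P n))" if "\<And>n::nat. P n \<in> pos" for P
  proof -
    have 1: "(\<Union>n. P n) \<in> pos"
      using that ca_positive_UN[of P] unfolding pos_def by auto
    have "\<mu> ((\<Union>n. P n) - P n) \<ge> 0" for n
      using 1 that[of n] unfolding pos_def by (auto intro!: sets.Diff)
    moreover have "\<mu> ((\<Union>n. P n) - P n) = \<mu> (\<Union>n. P n) - \<mu> (P n)" for n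
      using 1 that[of n] unfolding pos_def by (intro ca_Diff) auto
    ultimately show ?thesis using 1 by auto
  qed
  have ne: "{} \<in> pos" by (simp add: pos_def ca_empty)
  \<comment> \<open>Otherwise the union of positive sets \<open>P n\<close> with
    \<open>\<mu> (P n) > n\<close> would have a real measure above every \<open>n\<close>.\<close>
  have bdd: "bdd_above (\<mu> ` pos)"
  proof (rule ccontr)
    assume "\<not> ?thesis"
    then have "\<forall>n::nat. \<exists>P\<in>pos. real n < \<mu> P"
      unfolding bdd_above_def by (auto simp: not_le)
    then obtain P where P: "\<And>n::nat. P n \<in> pos" "\<And>n. real n < \<mu> (P n)" by metis
    obtain n :: nat where "\<mu> (\<Union>n. P n) < real n" using reals_Archimedean2 by blast
    with UN[of P] P show False by (meson less_le_trans not_less_iff_gr_or_eq)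
  qed
  define s where "s = (SUP P\<in>pos. \<mu> P)"
  have "\<exists>P\<in>pos. s - inverse (real (Suc n)) < \<mu> P" for n
    using less_cSUP_iff[OF _ bdd, of "s - inverse (real (Suc n))"] ne unfolding s_def by fastforce
  then obtain P where P: "\<And>n::nat. P n \<in> pos" "\<And>n. s - inverse (real (Suc n)) < \<mu> (P n)" by metis
  define H where "H = (\<Union>n. P n)"
  have H: "H \<in> pos" "\<And>n. \<mu> (P n) \<le> \<mu> H" using UN[of P] P by (auto simp: H_def)
  have "(\<lambda>n. s - inverse (real (Suc n))) \<longlonglongrightarrow> s - 0"
    by (intro tendsto_diff tendsto_const LIMSEQ_inverse_real_of_nat)
  then have sH: "s \<le> \<mu> H"
    using less_imp_le[OF less_le_trans[OF P(2) H(2)]] by (intro LIMSEQ_le_const2[of _ s]) auto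
  show ?thesis
  proof
    show HS: "H \<in> borel_sets_on \<Omega>" using H by (simp add: pos_def)
    show "\<And>B. B \<in> borel_sets_on \<Omega> \<Longrightarrow> B \<subseteq> H \<Longrightarrow> 0 \<le> \<mu> B" using H by (simp add: pos_def)
    fix B assume B: "B \<in> borel_sets_on \<Omega>" "B \<inter> H = {}"
    show "\<mu> B \<le> 0"
    proof (rule ccontr)
      assume "\<not> \<mu> B \<le> 0"
      \<comment> \<open>A set of positive measure off \<open>H\<close> contains a positive set
        \<open>B'\<close> of no smaller measure, and \<open>H \<union> B'\<close> would exceed the
        supremum.\<close>
      obtain B' where B': "B' \<in> borel_sets_on \<Omega>" "B' \<subseteq> B" "\<mu> B \<le> \<mu> B'"
        "\<And>C. C \<in> borel_sets_on \<Omega> \<Longrightarrow> C \<subseteq> B' \<Longrightarrow> 0 \<le> \<mu> C"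
        using ca_positive_subset[OF B(1)] by auto
      have "0 \<le> \<mu> C" if C: "C \<in> borel_sets_on \<Omega>" "C \<subseteq> H \<union> B'" for C
      proof -
        have "\<mu> C = \<mu> (C \<inter> H) + \<mu> (C - H)" by (rule ca_split) fact+
        moreover have "0 \<le> \<mu> (C \<inter> H)" using H C by (auto simp: pos_def)
        moreover have "0 \<le> \<mu> (C - H)" using C HS by (intro B'(4)) auto
        ultimately show ?thesis by simp
      qed
      then have "H \<union> B' \<in> pos" using HS B' by (simp add: pos_def)
      then have "\<mu> (H \<union> B') \<le> s" unfolding s_def using bdd by (rule cSUP_upper)
      moreover have "\<mu> (H \<union> B') = \<mu> H + \<mu> B'" using HS B' B by (intro ca_Un) auto
      ultimately show False using sH B'(3) \<open>\<not> \<mu> B \<le> 0\<close> by linarith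
    qed
  qed
qed

lemma ca_Union_finite:
  assumes "finite P" "P \<subseteq> borel_sets_on \<Omega>" "disjoint P"
  shows "\<mu> (\<Union>P) = (\<Sum>B\<in>P. \<mu> B)"
  using assms
proof (induction P rule: finite_induct)
  case (insert B P)
  have P: "P \<subseteq> borel_sets_on \<Omega>" "disjoint P" "B \<in> borel_sets_on \<Omega>"
    using insert.prems by (auto simp: pairwise_insert)
  have "\<Union>P \<in> borel_sets_on \<Omega>" using P(1) insert.hyps(1) by (intro sets.finite_Union)
  moreover have "B \<inter> \<Union>P = {}"
    using insert.prems(2) insert.hyps(2) by (auto simp: pairwise_insert disjnt_def)
  ultimately have "\<mu> (B \<union> \<Union>P) = \<mu> B + \<mu> (\<Union>P)"
    by (intro ca_Un P(3))
  then show ?case using insert.IH[OF P(1,2)] insert.hyps by simp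
qed (simp add: ca_empty)

lemma ca_restrict:
  assumes H: "H \<in> borel_sets_on \<Omega>"
  shows "countably_additive_real \<Omega> (\<lambda>A. \<mu> (A \<inter> H))"
  unfolding countably_additive_real_def
proof (intro allI impI)
  fix A :: "nat \<Rightarrow> 'a set" assume A: "range A \<subseteq> borel_sets_on \<Omega> \<and> disjoint_family A"
  have "(\<lambda>i. \<mu> (A i \<inter> H)) sums \<mu> (\<Union>i. A i \<inter> H)"
    using A H by (intro ca_sums) (auto simp: disjoint_family_on_def)
  then show "(\<lambda>i. \<mu> (A i \<inter> H)) sums \<mu> ((\<Union>i. A i) \<inter> H)"
    by simp
qed

end

lemma ca_lincomb:
  assumes "countably_additive_real \<Omega> \<mu>" "countably_additive_real \<Omega> \<nu>"
  shows "countably_additive_real \<Omega> (\<lambda>A. a * \<mu> A + b * \<nu> A)"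
  using assms unfolding countably_additive_real_def by (auto intro!: sums_add sums_mult)

text \<open>\<open>f\<close> is kept apart from \<open>\<mu>\<close>: the measures to be built are
  defined by expressions in the variation, while countable additivity is known for expressions in a
  Hahn set that agree with them on Borel sets.\<close>

lemma ca_measure_of:
  assumes ca: "countably_additive_real \<Omega> \<mu>"
    and nn: "\<And>A. A \<in> borel_sets_on \<Omega> \<Longrightarrow> 0 \<le> \<mu> A"
    and f: "\<And>A. A \<in> borel_sets_on \<Omega> \<Longrightarrow> f A = ennreal (\<mu> A)"
  shows "sets (measure_of \<Omega> (borel_sets_on \<Omega>) f) = borel_sets_on \<Omega>"
    and "space (measure_of \<Omega> (borel_sets_on \<Omega>) f) = \<Omega>"
    and "A \<in> borel_sets_on \<Omega> \<Longrightarrow> emeasure (measure_of \<Omega> (borel_sets_on \<Omega>) f) A = ennreal (\<mu> A)"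
proof -
  have S: "sigma_algebra \<Omega> (borel_sets_on \<Omega>)"
    using sets.sigma_algebra_axioms[of "restrict_space borel \<Omega>"] by (simp add: space_restrict_space)
  have sub: "borel_sets_on \<Omega> \<subseteq> Pow \<Omega>" using borel_sets_on_subset by blast
  show sets: "sets (measure_of \<Omega> (borel_sets_on \<Omega>) f) = borel_sets_on \<Omega>"
    using S by (simp add: sub sigma_algebra.sigma_sets_eq)
  show "space (measure_of \<Omega> (borel_sets_on \<Omega>) f) = \<Omega>" by (simp add: sub space_measure_of)
  assume A: "A \<in> borel_sets_on \<Omega>"
  have "emeasure (measure_of \<Omega> (borel_sets_on \<Omega>) f) A = f A"
  proof (rule emeasure_measure_of[OF refl sub])
    show "positive (sets (measure_of \<Omega> (borel_sets_on \<Omega>) f)) f"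
      using f[of "{}"] ca_empty[OF ca] by (simp add: positive_def)
    show "countably_additive (sets (measure_of \<Omega> (borel_sets_on \<Omega>) f)) f"
      unfolding sets
    proof (rule countably_additiveI)
      fix A :: "nat \<Rightarrow> _" assume A: "range A \<subseteq> borel_sets_on \<Omega>" "disjoint_family A"
      have "(\<lambda>i. ennreal (\<mu> (A i))) sums ennreal (\<mu> (\<Union>i. A i))"
        using ca_sums[OF ca A] nn A(1) by (subst sums_ennreal) (auto intro!: nn sets.countable_UN)
      moreover have "(\<lambda>i. ennreal (\<mu> (A i))) = (\<lambda>i. f (A i))" using f A(1) by auto
      moreover have "(\<Union>i. A i) \<in> borel_sets_on \<Omega>" using A(1) by (intro sets.countable_UN) auto
      ultimately show "(\<Sum>i. f (A i)) = f (\<Union>i. A i)"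
        using f sums_unique by metis
    qed
  qed (simp add: sets A)
  then show "emeasure (measure_of \<Omega> (borel_sets_on \<Omega>) f) A = ennreal (\<mu> A)" using f A by simp
qed


section \<open>Variation, Jordan parts and the polar form\<close>

text \<open>The partition into \<open>A \<inter> H\<close> and \<open>A - H\<close> attains the
  supremum. For the upper bound, \<open>\<bar>\<mu> B\<bar>\<close> is dominated by
  \<open>2 * \<mu> (B \<inter> H) - \<mu> B\<close>, which is additive in \<open>B\<close> and hence
  sums over any partition of \<open>A\<close> to the claimed value.\<close>

lemma variation_hahn:
  assumes ca: "countably_additive_real \<Omega> \<mu>"
    and H: "H \<in> borel_sets_on \<Omega>"
    and pos: "\<And>B. B \<in> borel_sets_on \<Omega> \<Longrightarrow> B \<subseteq> H \<Longrightarrow> 0 \<le> \<mu> B"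
    and neg: "\<And>B. B \<in> borel_sets_on \<Omega> \<Longrightarrow> B \<inter> H = {} \<Longrightarrow> \<mu> B \<le> 0"
    and A: "A \<in> borel_sets_on \<Omega>"
  shows "variation \<Omega> \<mu> A = \<mu> (A \<inter> H) - \<mu> (A - H)"
  unfolding variation_def
proof (rule cSup_eq_maximum)
  let ?P = "{A \<inter> H, A - H}"
  have "(\<Sum>B\<in>?P. \<bar>\<mu> B\<bar>) = \<mu> (A \<inter> H) - \<mu> (A - H)"
  \<comment> \<open>If the two pieces coincide, both are empty, and \<open>?P\<close> has a single
    element instead of two.\<close>
  proof (cases "A \<inter> H = A - H")
    case True
    then have e: "A \<inter> H = {}" "A - H = {}" by auto
    show ?thesis unfolding e by (simp add: ca_empty[OF ca])
  next
    case False
    then have "(\<Sum>B\<in>?P. \<bar>\<mu> B\<bar>) = \<bar>\<mu> (A \<inter> H)\<bar> + \<bar>\<mu> (A - H)\<bar>" by simp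
    moreover have "0 \<le> \<mu> (A \<inter> H)" "\<mu> (A - H) \<le> 0"
      using A H by (intro pos neg; auto)+
    ultimately show ?thesis by simp
  qed
  moreover have "?P \<in> {P. finite P \<and> P \<subseteq> borel_sets_on \<Omega> \<and> disjoint P \<and> \<Union> P = A}"
    using A H by (auto simp: pairwise_insert disjnt_def)
  ultimately show "\<mu> (A \<inter> H) - \<mu> (A - H) \<in>
      (\<lambda>P. \<Sum>B\<in>P. \<bar>\<mu> B\<bar>) ` {P. finite P \<and> P \<subseteq> borel_sets_on \<Omega> \<and> disjoint P \<and> \<Union> P = A}"
    by (metis (no_types, lifting) image_eqI)
next
  fix y assume "y \<in> (\<lambda>P. \<Sum>B\<in>P. \<bar>\<mu> B\<bar>) ` {P. finite P \<and> P \<subseteq> borel_sets_on \<Omega> \<and> disjoint P \<and> \<Union> P = A}"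
  then obtain P where P: "finite P" "P \<subseteq> borel_sets_on \<Omega>" "disjoint P" "\<Union> P = A"
    and y: "y = (\<Sum>B\<in>P. \<bar>\<mu> B\<bar>)" by auto
  have caH: "countably_additive_real \<Omega> (\<lambda>A. \<mu> (A \<inter> H))"
    by (rule ca_restrict[OF ca H])
  have ca2: "countably_additive_real \<Omega> (\<lambda>A. 2 * \<mu> (A \<inter> H) + (-1) * \<mu> A)"
    by (rule ca_lincomb[OF caH ca])
  have split: "\<mu> B = \<mu> (B \<inter> H) + \<mu> (B - H)" if "B \<in> borel_sets_on \<Omega>" for B
    by (rule ca_split[OF ca that H])
  have "y \<le> (\<Sum>B\<in>P. 2 * \<mu> (B \<inter> H) + (-1) * \<mu> B)"
    unfolding y
  proof (rule sum_mono)
    fix B assume "B \<in> P"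
    then have B: "B \<in> borel_sets_on \<Omega>" using P by auto
    have "0 \<le> \<mu> (B \<inter> H)" "\<mu> (B - H) \<le> 0"
      using B H by (intro pos neg; auto)+
    then show "\<bar>\<mu> B\<bar> \<le> 2 * \<mu> (B \<inter> H) + (-1) * \<mu> B"
      using split[OF B] by linarith
  qed
  also have "\<dots> = 2 * \<mu> (A \<inter> H) + (-1) * \<mu> A"
    using ca_Union_finite[OF ca2 P(1-3)] P(4) by simp
  also have "\<dots> = \<mu> (A \<inter> H) - \<mu> (A - H)"
    using split[OF A] by simp
  finally show "y \<le> \<mu> (A \<inter> H) - \<mu> (A - H)" .
qed

text \<open>\<open>V\<close> is the total variation measure of \<open>\<mu>\<close> and
  \<open>\<sigma>\<close> its sign. One finite positive measure replaces the two Jordan parts, so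
  that Fubini's theorem and dominated convergence apply as they stand. The sign has modulus 1 at
  every point, which spares almost-everywhere arguments.\<close>

definition polar_of :: "'a::euclidean_space set \<Rightarrow> ('a set \<Rightarrow> real) \<Rightarrow> 'a measure \<Rightarrow> ('a \<Rightarrow> real) \<Rightarrow> bool"
  where "polar_of \<Omega> \<mu> V \<sigma> \<longleftrightarrow> finite_measure V \<and> sets V = borel_sets_on \<Omega> \<and>
    \<sigma> \<in> borel_measurable V \<and> (\<forall>x. \<bar>\<sigma> x\<bar> = 1) \<and>
    (\<forall>A\<in>borel_sets_on \<Omega>. measure V A = variation \<Omega> \<mu> A \<and> \<mu> A = (LINT x|V. indicator A x * \<sigma> x)) \<and>
    (\<forall>\<phi>. integrable V \<phi> \<longrightarrow> dual_pairing \<Omega> \<phi> \<mu> = (LINT x|V. \<phi> x * \<sigma> x))"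

text \<open>Let \<open>\<sigma>\<close> be 1 on a Hahn set and -1 off it; the Jordan parts are then
  the restrictions of \<open>V\<close> to the Hahn set and to its complement.\<close>

lemma polar_decomposition:
  assumes ca: "countably_additive_real \<Omega> \<mu>"
  obtains V \<sigma> where "polar_of \<Omega> \<mu> V \<sigma>"
proof -
  obtain H where H: "H \<in> borel_sets_on \<Omega>"
    and pos: "\<And>B. B \<in> borel_sets_on \<Omega> \<Longrightarrow> B \<subseteq> H \<Longrightarrow> 0 \<le> \<mu> B"
    and neg: "\<And>B. B \<in> borel_sets_on \<Omega> \<Longrightarrow> B \<inter> H = {} \<Longrightarrow> \<mu> B \<le> 0"
    using hahn_decomposition[OF ca] by metis
  have var: "variation \<Omega> \<mu> A = \<mu> (A \<inter> H) - \<mu> (A - H)" if "A \<in> borel_sets_on \<Omega>" for A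
    by (rule variation_hahn[OF ca H _ _ that]) (fact pos neg)+
  have split: "\<mu> B = \<mu> (B \<inter> H) + \<mu> (B - H)" if "B \<in> borel_sets_on \<Omega>" for B
    by (rule ca_split[OF ca that H])
  have posI: "0 \<le> \<mu> (A \<inter> H)" and negI: "\<mu> (A - H) \<le> 0" if "A \<in> borel_sets_on \<Omega>" for A
    using that H by (intro pos neg; auto)+
  have caH: "countably_additive_real \<Omega> (\<lambda>A. \<mu> (A \<inter> H))"
    by (rule ca_restrict[OF ca H])
  \<comment> \<open>On Borel sets these are the negative part and the variation, written as
    combinations whose countable additivity is evident.\<close>
  have caN: "countably_additive_real \<Omega> (\<lambda>A. 1 * \<mu> (A \<inter> H) + (-1) * \<mu> A)"
    and caV: "countably_additive_real \<Omega> (\<lambda>A. 2 * \<mu> (A \<inter> H) + (-1) * \<mu> A)"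
    by (rule ca_lincomb[OF caH ca])+
  have V0: "0 \<le> 2 * \<mu> (A \<inter> H) + (-1) * \<mu> A"
    and fV: "ennreal (variation \<Omega> \<mu> A) = ennreal (2 * \<mu> (A \<inter> H) + (-1) * \<mu> A)"
    if "A \<in> borel_sets_on \<Omega>" for A
    using posI[OF that] negI[OF that] split[OF that] var[OF that] by auto
  define V where "V = measure_of \<Omega> (borel_sets_on \<Omega>) (\<lambda>A. ennreal (variation \<Omega> \<mu> A))"
  have V: "sets V = borel_sets_on \<Omega>" "space V = \<Omega>"
      "\<And>A. A \<in> borel_sets_on \<Omega> \<Longrightarrow> emeasure V A = ennreal (2 * \<mu> (A \<inter> H) + (-1) * \<mu> A)"
    unfolding V_def
    by (rule ca_measure_of[OF caV]; use V0 fV in blast)+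
  let ?P = "pos_part_measure \<Omega> \<mu>" and ?N = "neg_part_measure \<Omega> \<mu>"
  have fP: "ennreal ((variation \<Omega> \<mu> A + \<mu> A) / 2) = ennreal (\<mu> (A \<inter> H))"
    and fN: "ennreal ((variation \<Omega> \<mu> A - \<mu> A) / 2) = ennreal (1 * \<mu> (A \<inter> H) + (-1) * \<mu> A)"
    if "A \<in> borel_sets_on \<Omega>" for A
    using var[OF that] split[OF that] by (auto simp: field_simps intro!: arg_cong[where f=ennreal])
  have N0: "0 \<le> 1 * \<mu> (A \<inter> H) + (-1) * \<mu> A" if "A \<in> borel_sets_on \<Omega>" for A
    using negI[OF that] split[OF that] by simp
  have P: "sets ?P = borel_sets_on \<Omega>" "space ?P = \<Omega>"
      "\<And>A. A \<in> borel_sets_on \<Omega> \<Longrightarrow> emeasure ?P A = ennreal (\<mu> (A \<inter> H))"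
    unfolding pos_part_measure_def
    by (rule ca_measure_of[OF caH]; use fP posI in blast)+
  have N: "sets ?N = borel_sets_on \<Omega>" "space ?N = \<Omega>"
      "\<And>A. A \<in> borel_sets_on \<Omega> \<Longrightarrow> emeasure ?N A = ennreal (1 * \<mu> (A \<inter> H) + (-1) * \<mu> A)"
    unfolding neg_part_measure_def
    by (rule ca_measure_of[OF caN]; use fN N0 in blast)+
  have HV[measurable]: "H \<in> sets V" using H V by simp
  have PV: "?P = density V (indicator H)"
  proof (rule measure_eqI)
    fix A assume "A \<in> sets ?P"
    then have A: "A \<in> borel_sets_on \<Omega>" "A \<in> sets V" using P V by auto
    then have "emeasure (density V (indicator H)) A = emeasure V (A \<inter> H)"
      by (simp add: emeasure_density nn_integral_indicator flip: indicator_inter_arith)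
        (simp add: Int_commute)
    also have "\<dots> = ennreal (\<mu> (A \<inter> H))" using A H by (simp add: V)
    finally show "emeasure ?P A = emeasure (density V (indicator H)) A" using A P by simp
  qed (simp add: P V)
  have NV: "?N = density V (indicator (\<Omega> - H))"
  proof (rule measure_eqI)
    fix A assume "A \<in> sets ?N"
    then have A: "A \<in> borel_sets_on \<Omega>" "A \<in> sets V" using N V by auto
    have "\<Omega> \<in> sets V" using sets.top[of V] V by simp
    then have "emeasure (density V (indicator (\<Omega> - H))) A = emeasure V (A - H)"
      using A borel_sets_on_subset[OF A(1)]
      by (subst emeasure_density) (auto simp: nn_integral_indicator simp flip: indicator_inter_arith
        intro!: arg_cong[where f="emeasure V"])
    also have "\<dots> = ennreal (- \<mu> (A - H))"
    proof -
      have e: "(A - H) \<inter> H = {}" by auto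
      show ?thesis using A H by (simp add: V e ca_empty[OF ca])
    qed
    also have "\<dots> = ennreal (1 * \<mu> (A \<inter> H) + (-1) * \<mu> A)" using split[OF A(1)] by simp
    finally show "emeasure ?N A = emeasure (density V (indicator (\<Omega> - H))) A" using A N by simp
  qed (simp add: N V)
  define \<sigma> :: "'a \<Rightarrow> real" where "\<sigma> x = (if x \<in> H then 1 else - 1)" for x
  have \<sigma>[measurable]: "\<sigma> \<in> borel_measurable V"
    unfolding \<sigma>_def[abs_def] by measurable
  have fin: "finite_measure V"
    by (rule finite_measureI) (use V sets.top[of V] in auto)
  have pair: "dual_pairing \<Omega> \<phi> \<mu> = (LINT x|V. \<phi> x * \<sigma> x)" if \<phi>: "integrable V \<phi>" for \<phi>
  proof -
    have [measurable]: "\<phi> \<in> borel_measurable V" using \<phi> by auto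
    have [measurable]: "\<Omega> \<in> sets V" using sets.top[of V] V by simp
    have "dual_pairing \<Omega> \<phi> \<mu> = (LINT x|V. indicator H x *\<^sub>R \<phi> x) - (LINT x|V. indicator (\<Omega> - H) x *\<^sub>R \<phi> x)"
      unfolding dual_pairing_def PV NV
      by (subst (1 2) integral_density[symmetric]) (auto simp: ennreal_indicator)
    also have "\<dots> = (LINT x|V. indicator H x *\<^sub>R \<phi> x - indicator (\<Omega> - H) x *\<^sub>R \<phi> x)"
      by (rule Bochner_Integration.integral_diff[symmetric]; intro integrable_mult_indicator \<phi>) auto
    also have "\<dots> = (LINT x|V. \<phi> x * \<sigma> x)"
      by (rule Bochner_Integration.integral_cong) (auto simp: V \<sigma>_def)
    finally show ?thesis .
  qed
  have meas: "measure V A = variation \<Omega> \<mu> A" if A: "A \<in> borel_sets_on \<Omega>" for A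
    using V(3)[OF A] var[OF A] split[OF A] posI[OF A] negI[OF A] by (simp add: measure_def)
  have ind: "\<mu> A = (LINT x|V. indicator A x * \<sigma> x)" if A: "A \<in> borel_sets_on \<Omega>" for A
  proof -
    interpret finite_measure V by (rule fin)
    have [measurable]: "A \<in> sets V" using A V by simp
    have "(LINT x|V. indicator A x * \<sigma> x) = (LINT x|V. 2 * indicator (A \<inter> H) x - indicator A x)"
      by (rule Bochner_Integration.integral_cong) (auto simp: \<sigma>_def indicator_def)
    also have "\<dots> = 2 * measure V (A \<inter> H) - measure V A"
      by (subst Bochner_Integration.integral_diff)
        (auto intro!: integrable_real_indicator simp: less_top[symmetric])
    also have "\<dots> = \<mu> A"
      using A H split[OF A] by (simp add: meas var Int_Diff Int_absorb2 ca_empty[OF ca])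
    finally show ?thesis ..
  qed
  have "polar_of \<Omega> \<mu> V \<sigma>"
    unfolding polar_of_def using fin V \<sigma> pair meas ind by (auto simp: \<sigma>_def)
  then show ?thesis by (rule that)
qed


section \<open>The pairing as a functional on bounded Borel functions\<close>

text \<open>A common class of test functions: it contains the indicators, which determine a measure,
  the members of \<open>C0 \<Omega>\<close> and the translates of bounded continuous kernels, and
  its members are integrable against every finite Borel measure on \<open>\<Omega>\<close>.\<close>

definition bdd_meas :: "'a::euclidean_space set \<Rightarrow> ('a \<Rightarrow> real) \<Rightarrow> bool" where
  "bdd_meas \<Omega> \<phi> \<longleftrightarrow> \<phi> \<in> borel_measurable (restrict_space borel \<Omega>) \<and> (\<exists>C. \<forall>x\<in>\<Omega>. \<bar>\<phi> x\<bar> \<le> C)"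

lemma bdd_measI:
  "\<phi> \<in> borel_measurable (restrict_space borel \<Omega>) \<Longrightarrow> (\<And>x. x \<in> \<Omega> \<Longrightarrow> \<bar>\<phi> x\<bar> \<le> C) \<Longrightarrow> bdd_meas \<Omega> \<phi>"
  by (auto simp: bdd_meas_def)

lemma bdd_meas_add: "bdd_meas \<Omega> \<phi> \<Longrightarrow> bdd_meas \<Omega> \<psi> \<Longrightarrow> bdd_meas \<Omega> (\<lambda>x. \<phi> x + \<psi> x)"
proof -
  assume "bdd_meas \<Omega> \<phi>" "bdd_meas \<Omega> \<psi>"
  then obtain C D where "\<forall>x\<in>\<Omega>. \<bar>\<phi> x\<bar> \<le> C" "\<forall>x\<in>\<Omega>. \<bar>\<psi> x\<bar> \<le> D"
    and [measurable]: "\<phi> \<in> borel_measurable (restrict_space borel \<Omega>)" "\<psi> \<in> borel_measurable (restrict_space borel \<Omega>)"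
    by (auto simp: bdd_meas_def)
  then show ?thesis by (intro bdd_measI[of _ _ "C + D"]) (measurable, force)
qed

lemma bdd_meas_mult: "bdd_meas \<Omega> \<phi> \<Longrightarrow> bdd_meas \<Omega> (\<lambda>x. c * \<phi> x)"
proof -
  assume "bdd_meas \<Omega> \<phi>"
  then obtain C where "\<forall>x\<in>\<Omega>. \<bar>\<phi> x\<bar> \<le> C"
    and [measurable]: "\<phi> \<in> borel_measurable (restrict_space borel \<Omega>)"
    by (auto simp: bdd_meas_def)
  then show ?thesis
    by (intro bdd_measI[of _ _ "\<bar>c\<bar> * C"]) (measurable, auto simp: abs_mult intro!: mult_left_mono)
qed

lemma polar_of_integrable:
  assumes "polar_of \<Omega> \<mu> V \<sigma>" "bdd_meas \<Omega> \<phi>"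
  shows "integrable V \<phi>" "integrable V (\<lambda>x. \<phi> x * \<sigma> x)"
proof -
  interpret finite_measure V using assms by (simp add: polar_of_def)
  have sets: "sets V = borel_sets_on \<Omega>" and [measurable]: "\<sigma> \<in> borel_measurable V"
    and \<sigma>: "\<And>x. \<bar>\<sigma> x\<bar> = 1"
    using assms by (auto simp: polar_of_def)
  then have sp: "space V = \<Omega>" by (metis sets_eq_imp_space_eq space_restrict_space2 space_borel
    Int_UNIV_right space_restrict_space)
  obtain C where C: "\<And>x. x \<in> \<Omega> \<Longrightarrow> \<bar>\<phi> x\<bar> \<le> C" using assms by (auto simp: bdd_meas_def)
  have [measurable]: "\<phi> \<in> borel_measurable V"
    using assms(2) unfolding bdd_meas_def by (metis measurable_cong_sets sets)
  show "integrable V \<phi>" by (rule integrable_const_bound[of _ C]) (auto simp: sp C)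
  show "integrable V (\<lambda>x. \<phi> x * \<sigma> x)"
    by (rule integrable_const_bound[of _ C]) (auto simp: sp C abs_mult \<sigma>)
qed

lemma polar_of_space: "polar_of \<Omega> \<mu> V \<sigma> \<Longrightarrow> space V = \<Omega>"
  using sets_eq_imp_space_eq[of V "restrict_space borel \<Omega>"] by (simp add: polar_of_def space_restrict_space)

lemma bdd_meas_indicator: "A \<in> borel_sets_on \<Omega> \<Longrightarrow> bdd_meas \<Omega> (indicator A)"
  by (intro bdd_measI[of _ _ 1]) (auto simp: indicator_def)

lemma dual_pairing_indicator:
  assumes "countably_additive_real \<Omega> \<mu>" "A \<in> borel_sets_on \<Omega>"
  shows "dual_pairing \<Omega> (indicator A) \<mu> = \<mu> A"
proof -
  obtain V \<sigma> where V: "polar_of \<Omega> \<mu> V \<sigma>" by (rule polar_decomposition[OF assms(1)])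
  have i: "integrable V (indicator A :: 'a \<Rightarrow> real)"
    by (rule polar_of_integrable(1)[OF V bdd_meas_indicator[OF assms(2)]])
  have "dual_pairing \<Omega> (indicator A) \<mu> = (LINT x|V. indicator A x * \<sigma> x)"
    using V i unfolding polar_of_def by blast
  also have "\<dots> = \<mu> A" using V assms(2) unfolding polar_of_def by metis
  finally show ?thesis .
qed

lemma dual_pairing_add:
  assumes "countably_additive_real \<Omega> \<mu>" "bdd_meas \<Omega> \<phi>" "bdd_meas \<Omega> \<psi>"
  shows "dual_pairing \<Omega> (\<lambda>x. \<phi> x + \<psi> x) \<mu> = dual_pairing \<Omega> \<phi> \<mu> + dual_pairing \<Omega> \<psi> \<mu>"
proof -
  obtain V \<sigma> where V: "polar_of \<Omega> \<mu> V \<sigma>" by (rule polar_decomposition[OF assms(1)])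
  note i = polar_of_integrable[OF V]
  have "dual_pairing \<Omega> \<phi> \<mu> = (LINT x|V. \<phi> x * \<sigma> x)" if "bdd_meas \<Omega> \<phi>" for \<phi>
    using V i[OF that] by (simp add: polar_of_def)
  then show ?thesis
    using i[OF assms(2)] i[OF assms(3)] bdd_meas_add[OF assms(2,3)] assms by (simp add: distrib_right)
qed

lemma dual_pairing_mult:
  assumes "countably_additive_real \<Omega> \<mu>" "bdd_meas \<Omega> \<phi>"
  shows "dual_pairing \<Omega> (\<lambda>x. c * \<phi> x) \<mu> = c * dual_pairing \<Omega> \<phi> \<mu>"
proof -
  obtain V \<sigma> where V: "polar_of \<Omega> \<mu> V \<sigma>" by (rule polar_decomposition[OF assms(1)])
  note i = polar_of_integrable[OF V]
  have "dual_pairing \<Omega> \<phi> \<mu> = (LINT x|V. \<phi> x * \<sigma> x)" if "bdd_meas \<Omega> \<phi>" for \<phi>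
    using V i[OF that] by (simp add: polar_of_def)
  then show ?thesis
    using bdd_meas_mult[OF assms(2)] assms by (simp add: mult.assoc)
qed

lemma dual_pairing_abs_le:
  assumes "countably_additive_real \<Omega> \<mu>" "bdd_meas \<Omega> \<phi>" "\<And>x. x \<in> \<Omega> \<Longrightarrow> \<bar>\<phi> x\<bar> \<le> C"
  shows "\<bar>dual_pairing \<Omega> \<phi> \<mu>\<bar> \<le> C * radon_norm \<Omega> \<mu>"
proof -
  obtain V \<sigma> where V: "polar_of \<Omega> \<mu> V \<sigma>" by (rule polar_decomposition[OF assms(1)])
  note i = polar_of_integrable[OF V assms(2)]
  interpret finite_measure V using V by (simp add: polar_of_def)
  have "\<Omega> \<in> borel_sets_on \<Omega>"
    using sets.top[of "restrict_space borel \<Omega>"] by (simp add: space_restrict_space)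
  then have m: "measure V \<Omega> = radon_norm \<Omega> \<mu>" using V by (simp add: polar_of_def radon_norm_def)
  have "\<bar>dual_pairing \<Omega> \<phi> \<mu>\<bar> = \<bar>LINT x|V. \<phi> x * \<sigma> x\<bar>"
    using V i by (simp add: polar_of_def)
  also have "\<dots> \<le> (LINT x|V. \<bar>\<phi> x * \<sigma> x\<bar>)" by (rule integral_abs_bound)
  also have "\<dots> \<le> (LINT x|V. C)"
    using V i assms(3) by (intro integral_mono) (auto simp: polar_of_space polar_of_def abs_mult)
  also have "\<dots> = C * radon_norm \<Omega> \<mu>" using V m by (simp add: polar_of_space)
  finally show ?thesis .
qed

lemma dual_pairing_dominated_convergence:
  assumes "countably_additive_real \<Omega> \<mu>" "\<And>i. bdd_meas \<Omega> (U i)" "bdd_meas \<Omega> u"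
    and "\<And>i x. x \<in> \<Omega> \<Longrightarrow> \<bar>U i x\<bar> \<le> C" "\<And>x. x \<in> \<Omega> \<Longrightarrow> (\<lambda>i. U i x) \<longlonglongrightarrow> u x"
  shows "(\<lambda>i. dual_pairing \<Omega> (U i) \<mu>) \<longlonglongrightarrow> dual_pairing \<Omega> u \<mu>"
proof -
  obtain V \<sigma> where V: "polar_of \<Omega> \<mu> V \<sigma>" by (rule polar_decomposition[OF assms(1)])
  note i = polar_of_integrable[OF V]
  interpret finite_measure V using V by (simp add: polar_of_def)
  have eq: "dual_pairing \<Omega> \<phi> \<mu> = (LINT x|V. \<phi> x * \<sigma> x)" if "bdd_meas \<Omega> \<phi>" for \<phi>
    using V i[OF that] by (simp add: polar_of_def)
  have "(\<lambda>i. LINT x|V. U i x * \<sigma> x) \<longlonglongrightarrow> (LINT x|V. u x * \<sigma> x)"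
  proof (rule integral_dominated_convergence[where w="\<lambda>_. C"])
    show "AE x in V. (\<lambda>i. U i x * \<sigma> x) \<longlonglongrightarrow> u x * \<sigma> x"
      using assms(5) V by (auto intro!: tendsto_mult simp: polar_of_space)
    show "AE x in V. norm (U i x * \<sigma> x) \<le> C" for i
      using assms(4) V by (auto simp: polar_of_space polar_of_def abs_mult)
  qed (use i assms in auto)
  then show ?thesis using eq assms by simp
qed

text \<open>Only values on \<open>\<Omega>\<close> matter in the convergence hypothesis, so it also makes \<open>L\<close>
  insensitive to changes outside \<open>\<Omega>\<close>.\<close>

lemma bdd_meas_functional_zero:
  fixes L :: "('a::euclidean_space \<Rightarrow> real) \<Rightarrow> real"
  assumes ind: "\<And>A. A \<in> borel_sets_on \<Omega> \<Longrightarrow> L (indicator A) = 0"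
    and add: "\<And>\<phi> \<psi>. bdd_meas \<Omega> \<phi> \<Longrightarrow> bdd_meas \<Omega> \<psi> \<Longrightarrow> L (\<lambda>x. \<phi> x + \<psi> x) = L \<phi> + L \<psi>"
    and mult: "\<And>\<phi> c. bdd_meas \<Omega> \<phi> \<Longrightarrow> L (\<lambda>x. c * \<phi> x) = c * L \<phi>"
    and lim: "\<And>U u C. (\<And>i. bdd_meas \<Omega> (U i)) \<Longrightarrow> bdd_meas \<Omega> u \<Longrightarrow>
      (\<And>i x. x \<in> \<Omega> \<Longrightarrow> \<bar>U i x\<bar> \<le> C) \<Longrightarrow> (\<And>x. x \<in> \<Omega> \<Longrightarrow> (\<lambda>i. U i x) \<longlonglongrightarrow> u x) \<Longrightarrow>
      (\<lambda>i::nat. L (U i)) \<longlonglongrightarrow> L u"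
    and \<phi>: "bdd_meas \<Omega> \<phi>"
  shows "L \<phi> = 0"
proof -
  have nonneg: "L u = 0" if "bdd_meas \<Omega> u" "\<And>x. 0 \<le> u x" for u
  proof -
    have "u \<in> borel_measurable (restrict_space borel \<Omega>)" using that by (simp add: bdd_meas_def)
    \<comment> \<open>Boundedness sits inside the induction formula because the induction over
      measurable functions also runs through unbounded ones.\<close>
    then have "bdd_meas \<Omega> u \<longrightarrow> L u = 0" using that(2)
    proof (induction u rule: borel_measurable_induct_real)
      case (set A)
      then show ?case using ind by simp
    next
      case (mult u c)
      show ?case
      \<comment> \<open>For \<open>c = 0\<close> the boundedness of \<open>c * u\<close> says
        nothing about \<open>u\<close>.\<close>
      proof (intro impI, cases "c = 0")
        case True
        have "bdd_meas \<Omega> (\<lambda>x. 0)" by (rule bdd_measI[of _ _ 0]) auto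
        from assms(3)[OF this, of 0] show "L (\<lambda>x. c * u x) = 0" using True by simp
      next
        case False
        assume "bdd_meas \<Omega> (\<lambda>x. c * u x)"
        from bdd_meas_mult[OF this, of "1 / c"] False have "bdd_meas \<Omega> u" by simp
        then show "L (\<lambda>x. c * u x) = 0" using mult assms(3) by simp
      qed
    next
      case (add u v)
      show ?case
      proof
        assume b: "bdd_meas \<Omega> (\<lambda>x. v x + u x)"
        then obtain C where "\<And>x. x \<in> \<Omega> \<Longrightarrow> \<bar>v x + u x\<bar> \<le> C" by (auto simp: bdd_meas_def)
        then have "\<bar>u x\<bar> \<le> C" "\<bar>v x\<bar> \<le> C" if "x \<in> \<Omega>" for x
          using that add.hyps(2)[of x] add.hyps(4)[of x] by fastforce+
        then have "bdd_meas \<Omega> u" "bdd_meas \<Omega> v"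
          using add.hyps(1,3) by (auto intro: bdd_measI)
        then show "L (\<lambda>x. v x + u x) = 0" using add assms(2) by simp
      qed
    next
      case (seq U)
      show ?case
      proof
        assume b: "bdd_meas \<Omega> u"
        then obtain C where C: "\<And>x. x \<in> \<Omega> \<Longrightarrow> \<bar>u x\<bar> \<le> C" by (auto simp: bdd_meas_def)
        have conv: "(\<lambda>i. U i x) \<longlonglongrightarrow> u x" if "x \<in> \<Omega>" for x
          using seq.hyps(4) that by (simp add: space_restrict_space)
        have le: "\<bar>U i x\<bar> \<le> C" if x: "x \<in> \<Omega>" for i x
        proof -
          have "U i x \<le> u x"
            using seq.hyps(3) by (intro incseq_le[OF _ conv[OF x]]) (auto simp: incseq_def le_fun_def)
          then show ?thesis using seq.hyps(2)[of i x] C[OF x] by simp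
        qed
        then have bU: "bdd_meas \<Omega> (U i)" for i using seq.hyps(1) by (intro bdd_measI)
        have "(\<lambda>i. L (U i)) \<longlonglongrightarrow> L u" by (rule lim[OF bU b le conv])
        moreover have "L (U i) = 0" for i using seq.IH bU by simp
        ultimately show "L u = 0" by (simp add: LIMSEQ_const_iff)
      qed
    qed
    then show ?thesis using that by simp
  qed
  obtain C where C: "\<And>x. x \<in> \<Omega> \<Longrightarrow> \<bar>\<phi> x\<bar> \<le> C" using \<phi> by (auto simp: bdd_meas_def)
  have [measurable]: "\<phi> \<in> borel_measurable (restrict_space borel \<Omega>)" using \<phi> by (simp add: bdd_meas_def)
  have b: "bdd_meas \<Omega> (\<lambda>x. max 0 (\<phi> x))" "bdd_meas \<Omega> (\<lambda>x. max 0 (- \<phi> x))"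
    by (rule bdd_measI[of _ _ C]; use C in \<open>force simp: max_def\<close>)+
  have "L (\<lambda>x. max 0 (\<phi> x) + (-1) * max 0 (- \<phi> x)) = 0"
    using add[OF b(1) bdd_meas_mult[OF b(2), of "-1"]] mult[OF b(2), of "-1"] nonneg[OF b(1)] nonneg[OF b(2)]
    by simp
  moreover have "(\<lambda>x. max 0 (\<phi> x) + (-1) * max 0 (- \<phi> x)) = \<phi>" by (auto simp: max_def)
  ultimately show ?thesis by simp
qed

text \<open>The difference of the two functionals vanishes on indicators, hence on all bounded Borel
  functions. This evaluates a pairing without a formula for the variation of the measure.\<close>

lemma dual_pairing_eqI:
  fixes F :: "('a::euclidean_space \<Rightarrow> real) \<Rightarrow> real"
  assumes ca: "countably_additive_real \<Omega> \<mu>"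
    and ind: "\<And>A. A \<in> borel_sets_on \<Omega> \<Longrightarrow> F (indicator A) = \<mu> A"
    and add: "\<And>\<phi> \<psi>. bdd_meas \<Omega> \<phi> \<Longrightarrow> bdd_meas \<Omega> \<psi> \<Longrightarrow> F (\<lambda>x. \<phi> x + \<psi> x) = F \<phi> + F \<psi>"
    and mult: "\<And>\<phi> c. bdd_meas \<Omega> \<phi> \<Longrightarrow> F (\<lambda>x. c * \<phi> x) = c * F \<phi>"
    and lim: "\<And>U u C. (\<And>i. bdd_meas \<Omega> (U i)) \<Longrightarrow> bdd_meas \<Omega> u \<Longrightarrow>
      (\<And>i x. x \<in> \<Omega> \<Longrightarrow> \<bar>U i x\<bar> \<le> C) \<Longrightarrow> (\<And>x. x \<in> \<Omega> \<Longrightarrow> (\<lambda>i. U i x) \<longlonglongrightarrow> u x) \<Longrightarrow>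
      (\<lambda>i::nat. F (U i)) \<longlonglongrightarrow> F u"
    and \<phi>: "bdd_meas \<Omega> \<phi>"
  shows "dual_pairing \<Omega> \<phi> \<mu> = F \<phi>"
proof -
  have "dual_pairing \<Omega> \<phi> \<mu> - F \<phi> = 0"
  proof (rule bdd_meas_functional_zero[where L="\<lambda>\<phi>. dual_pairing \<Omega> \<phi> \<mu> - F \<phi>", OF _ _ _ _ \<phi>])
    fix U u C assume a: "\<And>i. bdd_meas \<Omega> (U i)" "bdd_meas \<Omega> u"
      "\<And>i x. x \<in> \<Omega> \<Longrightarrow> \<bar>U i x\<bar> \<le> C" "\<And>x. x \<in> \<Omega> \<Longrightarrow> (\<lambda>i::nat. U i x) \<longlonglongrightarrow> u x"
    show "(\<lambda>i. dual_pairing \<Omega> (U i) \<mu> - F (U i)) \<longlonglongrightarrow> dual_pairing \<Omega> u \<mu> - F u"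
      by (intro tendsto_diff dual_pairing_dominated_convergence[OF ca a] lim[OF a])
  qed (simp_all add: dual_pairing_indicator dual_pairing_add dual_pairing_mult ca ind add mult algebra_simps)
  then show ?thesis by simp
qed

text \<open>Variation is not additive in the measure, so the Jordan parts of a combination are not
  the combinations of the parts. The right-hand side is instead recognised by its values on
  indicators.\<close>

lemma dual_pairing_lincomb:
  assumes ca: "countably_additive_real \<Omega> \<mu>" "countably_additive_real \<Omega> \<nu>" and \<phi>: "bdd_meas \<Omega> \<phi>"
  shows "dual_pairing \<Omega> \<phi> (\<lambda>A. a * \<mu> A + b * \<nu> A) = a * dual_pairing \<Omega> \<phi> \<mu> + b * dual_pairing \<Omega> \<phi> \<nu>"
proof (rule dual_pairing_eqI[OF ca_lincomb[OF ca] _ _ _ _ \<phi>])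
  fix U u C assume a: "\<And>i. bdd_meas \<Omega> (U i)" "bdd_meas \<Omega> u"
    "\<And>i x. x \<in> \<Omega> \<Longrightarrow> \<bar>U i x\<bar> \<le> C" "\<And>x. x \<in> \<Omega> \<Longrightarrow> (\<lambda>i::nat. U i x) \<longlonglongrightarrow> u x"
  show "(\<lambda>i. a * dual_pairing \<Omega> (U i) \<mu> + b * dual_pairing \<Omega> (U i) \<nu>)
     \<longlonglongrightarrow> a * dual_pairing \<Omega> u \<mu> + b * dual_pairing \<Omega> u \<nu>"
    by (intro tendsto_add tendsto_mult tendsto_const
        dual_pairing_dominated_convergence[OF ca(1) a] dual_pairing_dominated_convergence[OF ca(2) a])
qed (simp_all add: dual_pairing_indicator dual_pairing_add dual_pairing_mult ca algebra_simps)

lemma sums_dirac_measure: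
  assumes "range A \<subseteq> borel_sets_on \<Omega>" "disjoint_family A"
  shows "(\<lambda>i. dirac_measure \<Omega> x (A i)) sums dirac_measure \<Omega> x (\<Union>i. A i)"
proof (cases "\<exists>i. x \<in> A i")
  case True
  then obtain i where i: "x \<in> A i" by blast
  have "x \<notin> A j" if "j \<noteq> i" for j using assms(2) i that by (auto simp: disjoint_family_on_def)
  then have "(\<lambda>j. dirac_measure \<Omega> x (A j)) = (\<lambda>j. if j = i then 1 else 0)"
    using assms(1) i by (auto simp: dirac_measure_def fun_eq_iff)
  moreover have "dirac_measure \<Omega> x (\<Union>i. A i) = 1"
    using assms(1) i by (auto simp: dirac_measure_def intro!: sets.countable_UN)
  ultimately show ?thesis using sums_single[of i "\<lambda>_. 1::real"] by simp
qed (simp add: dirac_measure_def)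

lemma ca_discrete:
  "countably_additive_real \<Omega> (\<lambda>A. \<Sum>k\<in>K. \<alpha> k * dirac_measure \<Omega> (x k) A)"
  unfolding countably_additive_real_def
  by (intro allI impI sums_sum sums_mult sums_dirac_measure) auto

text \<open>Points may repeat and coefficients may cancel, so the variation of the sum has no simple
  formula; the pairing is again identified through indicators.\<close>

lemma dual_pairing_discrete:
  fixes \<phi> :: "'a::euclidean_space \<Rightarrow> real"
  assumes x: "\<And>k. k \<in> K \<Longrightarrow> x k \<in> \<Omega>" and \<phi>: "bdd_meas \<Omega> \<phi>"
  shows "dual_pairing \<Omega> \<phi> (\<lambda>A. \<Sum>k\<in>K. \<alpha> k * dirac_measure \<Omega> (x k) A) = (\<Sum>k\<in>K. \<alpha> k * \<phi> (x k))"
proof (rule dual_pairing_eqI[OF ca_discrete _ _ _ _ \<phi>])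
  fix U :: "nat \<Rightarrow> 'a \<Rightarrow> real" and u C
  assume a: "\<And>x. x \<in> \<Omega> \<Longrightarrow> (\<lambda>i. U i x) \<longlonglongrightarrow> u x"
  then show "(\<lambda>i. \<Sum>k\<in>K. \<alpha> k * U i (x k)) \<longlonglongrightarrow> (\<Sum>k\<in>K. \<alpha> k * u (x k))"
    using x by (intro tendsto_sum tendsto_mult tendsto_const) auto
qed (auto simp: dirac_measure_def indicator_def distrib_left sum.distrib sum_distrib_left mult_ac intro!: sum.cong)

section \<open>Gaussian regularisation and Fourier inversion\<close>


lemma (in pair_sigma_finite) integrable_prod_mult:
  fixes f :: "'a \<Rightarrow> complex" and g :: "'b \<Rightarrow> complex"
  assumes f: "integrable M1 f" and g: "integrable M2 g"
  shows "integrable (M1 \<Otimes>\<^sub>M M2) (\<lambda>(x, y). f x * g y)"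
proof -
  have [measurable]: "f \<in> borel_measurable M1" "g \<in> borel_measurable M2" using f g by auto
  show ?thesis
  proof (rule Fubini_integrable)
    show "integrable M1 (\<lambda>x. LINT y|M2. norm (case (x, y) of (x, y) \<Rightarrow> f x * g y))"
      using f g by (simp add: norm_mult)
    show "AE x in M1. integrable M2 (\<lambda>y. case (x, y) of (x, y) \<Rightarrow> f x * g y)"
      using g by simp
  qed measurable
qed

lemma lborel_integrable_affine:
  fixes f :: "'a::euclidean_space \<Rightarrow> 'b::{banach, second_countable_topology}"
  assumes f: "integrable lborel f" and c: "c \<noteq> 0"
  shows "integrable lborel (\<lambda>x. f (t + c *\<^sub>R x))"
proof -
  have [measurable]: "f \<in> borel_measurable borel" using f by auto
  have "integrable (density (distr lborel borel (\<lambda>x. t + c *\<^sub>R x)) (\<lambda>_. ennreal (\<bar>c\<bar> ^ DIM('a)))) f"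
    using f by (subst (asm) lborel_affine[OF c, of t]) (simp add: ennreal_power)
  then have "integrable (distr lborel borel (\<lambda>x. t + c *\<^sub>R x)) (\<lambda>x. (\<bar>c\<bar> ^ DIM('a)) *\<^sub>R f x)"
    by (subst (asm) integrable_density) auto
  then have "integrable lborel (\<lambda>x. (\<bar>c\<bar> ^ DIM('a)) *\<^sub>R f (t + c *\<^sub>R x))"
    by (subst (asm) integrable_distr_eq) auto
  from integrable_scaleR_right[OF this, of "inverse (\<bar>c\<bar> ^ DIM('a))"] show ?thesis using c by simp
qed

text \<open>Negative \<open>c\<close> is allowed, so reflections are included. Measurability
  suffices: for nonintegrable \<open>f\<close> both sides have the default value 0.\<close>

lemma lborel_integral_affine:
  fixes f :: "'a::euclidean_space \<Rightarrow> 'b::{banach, second_countable_topology}"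
  assumes f: "f \<in> borel_measurable borel" and c: "c \<noteq> 0"
  shows "(LINT x|lborel. f x) = (\<bar>c\<bar> ^ DIM('a)) *\<^sub>R (LINT x|lborel. f (t + c *\<^sub>R x))"
proof -
  note [measurable] = f
  have "(LINT x|lborel. f x) =
    (LINT x|density (distr lborel borel (\<lambda>x. t + c *\<^sub>R x)) (\<lambda>_. ennreal (\<bar>c\<bar> ^ DIM('a))). f x)"
    by (subst lborel_affine[OF c, of t]) (simp add: ennreal_power)
  also have "\<dots> = (\<bar>c\<bar> ^ DIM('a)) *\<^sub>R (LINT x|lborel. f (t + c *\<^sub>R x))"
    by (subst integral_density) (auto simp: integral_distr)
  finally show ?thesis .
qed

lemma lborel_integral_uminus_translate:
  fixes f :: "'a::euclidean_space \<Rightarrow> 'b::{banach, second_countable_topology}"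
  assumes f: "f \<in> borel_measurable borel"
  shows "(LINT x|lborel. f (t - x)) = (LINT x|lborel. f x)"
  using lborel_integral_affine[OF f, of "-1" t] by simp

lemma lborel_integral_translate:
  fixes f :: "'a::euclidean_space \<Rightarrow> 'b::{banach, second_countable_topology}"
  assumes f: "f \<in> borel_measurable borel"
  shows "(LINT x|lborel. f (t + x)) = (LINT x|lborel. f x)"
  using lborel_integral_affine[OF f, of 1 t] by simp

text \<open>Lebesgue measure is the image of the product of one-dimensional Lebesgue measures under
  the coordinate map; this reduces Gaussian integrals to dimension one.\<close>

lemma lborel_prod_Basis:
  fixes f :: "'a::euclidean_space \<Rightarrow> real \<Rightarrow> complex"
  assumes f: "\<And>b. b \<in> Basis \<Longrightarrow> integrable lborel (f b)"
  shows "integrable lborel (\<lambda>x::'a. \<Prod>b\<in>Basis. f b (x \<bullet> b))"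
    and "(LINT x|lborel. (\<Prod>b\<in>Basis. f b (x \<bullet> b))) = (\<Prod>b\<in>Basis. LINT t|lborel. f b t)"
proof -
  interpret product_sigma_finite "\<lambda>_::'a. lborel :: real measure" ..
  have m[measurable]: "f b \<in> borel_measurable borel" if "b \<in> Basis" for b using f[OF that] by auto
  have [measurable]: "(\<lambda>x::'a. \<Prod>b\<in>Basis. f b (x \<bullet> b)) \<in> borel_measurable borel"
    by (intro borel_measurable_prod measurable_compose[OF _ m]) auto
  have T[measurable]: "(\<lambda>g. \<Sum>b\<in>Basis. g b *\<^sub>R b) \<in> (\<Pi>\<^sub>M b\<in>Basis. lborel) \<rightarrow>\<^sub>M (borel :: 'a measure)"
    by (intro borel_measurable_sum borel_measurable_scaleR) auto
  have eq: "(\<Prod>b\<in>Basis. f b ((\<Sum>c\<in>Basis. g c *\<^sub>R c) \<bullet> b)) = (\<Prod>b\<in>Basis. f b (g b))" for g :: "'a \<Rightarrow> real"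
    by (intro prod.cong refl) (simp add: inner_sum_left inner_Basis if_distrib sum.If_cases cong: if_cong)
  show "integrable lborel (\<lambda>x::'a. \<Prod>b\<in>Basis. f b (x \<bullet> b))"
    unfolding lborel_eq[where 'a='a]
    by (subst integrable_distr_eq) (auto simp: eq intro!: product_integrable_prod f)
  show "(LINT x|lborel. (\<Prod>b\<in>Basis. f b (x \<bullet> b))) = (\<Prod>b\<in>Basis. LINT t|lborel. f b t)"
    unfolding lborel_eq[where 'a='a]
    by (subst integral_distr) (auto simp: eq intro!: product_integral_prod f)
qed

section \<open>The Gaussian and its transform\<close>

text \<open>With the factor \<open>pi\<close> the Gaussian has total mass 1 and is its own transform
  for characters with \<open>2 * pi\<close> in the exponent, so no normalising constants
  appear.\<close>

definition gauss :: "'a::euclidean_space \<Rightarrow> real" where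
  "gauss x = exp (- pi * (norm x)\<^sup>2)"

lemma continuous_on_gauss [continuous_intros]:
  "continuous_on S f \<Longrightarrow> continuous_on S (\<lambda>x. gauss (f x))"
  unfolding gauss_def by (intro continuous_intros)

lemma borel_measurable_gauss [measurable]: "gauss \<in> borel_measurable borel"
  by (intro borel_measurable_continuous_onI continuous_on_gauss continuous_on_id)

lemma borel_measurable_cis [measurable]: "cis \<in> borel_measurable borel"
  by (intro borel_measurable_continuous_onI continuous_on_cis continuous_on_id)

lemma gauss_nonneg [simp]: "0 \<le> gauss x" and gauss_le_1 [simp]: "gauss x \<le> 1"
  and gauss_0 [simp]: "gauss 0 = 1"
  by (auto simp: gauss_def)

text \<open>A rescaling of the characteristic function of the standard normal distribution.\<close>

lemma gaussian_real:
  fixes s :: real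
  shows "integrable lborel (\<lambda>t. complex_of_real (exp (- pi * t\<^sup>2)) * cis (2 * pi * (t * s)))"
    and "(LINT t|lborel. complex_of_real (exp (- pi * t\<^sup>2)) * cis (2 * pi * (t * s))) = exp (- pi * s\<^sup>2)"
proof -
  \<comment> \<open>The substitution \<open>x = c * t\<close> with \<open>c\<^sup>2 = 2 * pi\<close>
    turns the exponent \<open>- x\<^sup>2 / 2\<close> into \<open>- pi * t\<^sup>2\<close>; its
    Jacobian cancels the factor \<open>1 / c\<close> of the normal density.\<close>
  define c where "c = sqrt (2 * pi)"
  have c: "c > 0" "c * c = 2 * pi" "c\<^sup>2 = 2 * pi" by (auto simp: c_def)
  let ?h = "\<lambda>x. complex_of_real (std_normal_density x) * cis (c * s * x)"
  have h0: "integrable lborel std_normal_density" by (rule integrable_normal_density) simp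
  have h: "integrable lborel ?h"
    by (rule Bochner_Integration.integrable_bound[OF h0]) (auto simp: norm_mult)
  have "(LINT x|lborel. ?h x) = (LINT x|lborel. std_normal_density x *\<^sub>R iexp (c * s * x))"
    by (simp add: scaleR_conv_of_real cis_conv_exp)
  also have "\<dots> = char std_normal_distribution (c * s)"
    unfolding char_def by (subst integral_density) (auto simp: normal_density_nonneg)
  also have "\<dots> = exp (- pi * s\<^sup>2)"
    by (simp add: char_std_normal_distribution power_mult_distrib c)
  finally have i: "(LINT x|lborel. ?h x) = exp (- pi * s\<^sup>2)" .
  have eq: "?h (0 + c * t) = complex_of_real (1 / c) * (complex_of_real (exp (- pi * t\<^sup>2)) * cis (2 * pi * (t * s)))" for t
  proof -
    have e: "c * s * (c * t) = 2 * pi * (t * s)"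
    proof -
      have "c * s * (c * t) = (c * c) * (t * s)" by (simp only: mult_ac)
      then show ?thesis by (simp only: c(2))
    qed
    show ?thesis unfolding add_0 e
      by (simp add: std_normal_density_def c_def[symmetric] power_mult_distrib c(3))
  qed
  have h': "integrable lborel (\<lambda>t. ?h (0 + c * t))"
    using lborel_integrable_real_affine[OF h, of c 0] c by simp
  then show "integrable lborel (\<lambda>t. complex_of_real (exp (- pi * t\<^sup>2)) * cis (2 * pi * (t * s)))"
    using integrable_mult_right[OF h'[unfolded eq], of "complex_of_real c"] c by (simp add: mult.assoc[symmetric])
  have "(LINT x|lborel. ?h x) = \<bar>c\<bar> *\<^sub>R (LINT t|lborel. ?h (0 + c * t))"
    by (rule lborel_integral_real_affine) (use c in simp)
  also have "\<dots> = (LINT t|lborel. complex_of_real (exp (- pi * t\<^sup>2)) * cis (2 * pi * (t * s)))"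
    unfolding eq using c by (simp add: scaleR_conv_of_real)
  finally show "(LINT t|lborel. complex_of_real (exp (- pi * t\<^sup>2)) * cis (2 * pi * (t * s))) = exp (- pi * s\<^sup>2)"
    using i by simp
qed

lemma gauss_prod: "gauss x = (\<Prod>b\<in>Basis. exp (- pi * (x \<bullet> b)\<^sup>2))"
proof -
  have "(norm x)\<^sup>2 = (\<Sum>b\<in>Basis. (x \<bullet> b)\<^sup>2)"
    using euclidean_inner[of x x] unfolding power2_norm_eq_inner by (simp add: power2_eq_square)
  then have "gauss x = exp (\<Sum>b\<in>Basis. - pi * (x \<bullet> b)\<^sup>2)"
    by (simp add: gauss_def sum_distrib_left sum_negf)
  then show ?thesis by (simp only: exp_sum[OF finite_Basis])
qed

lemma cis_sum: "finite A \<Longrightarrow> cis (\<Sum>a\<in>A. f a) = (\<Prod>a\<in>A. cis (f a))"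
  by (induction A rule: finite_induct) (simp_all flip: cis_mult)

lemma gauss_fourier:
  fixes x :: "'a::euclidean_space"
  shows "integrable lborel (\<lambda>\<xi>::'a. complex_of_real (gauss \<xi>) * cis (2 * pi * (x \<bullet> \<xi>)))"
    and "(LINT \<xi>|lborel. complex_of_real (gauss \<xi>) * cis (2 * pi * (x \<bullet> \<xi>))) = gauss x"
proof -
  have eq: "complex_of_real (gauss \<xi>) * cis (2 * pi * (x \<bullet> \<xi>)) =
    (\<Prod>b\<in>Basis. complex_of_real (exp (- pi * (\<xi> \<bullet> b)\<^sup>2)) * cis (2 * pi * ((\<xi> \<bullet> b) * (x \<bullet> b))))" for \<xi>
  proof -
    have "2 * pi * (x \<bullet> \<xi>) = (\<Sum>b\<in>Basis. 2 * pi * ((\<xi> \<bullet> b) * (x \<bullet> b)))"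
      by (subst euclidean_inner) (simp add: sum_distrib_left mult_ac)
    then show ?thesis by (simp add: gauss_prod cis_sum prod.distrib)
  qed
  show "integrable lborel (\<lambda>\<xi>::'a. complex_of_real (gauss \<xi>) * cis (2 * pi * (x \<bullet> \<xi>)))"
    unfolding eq by (rule lborel_prod_Basis(1)[where f="\<lambda>b t. complex_of_real (exp (- pi * t\<^sup>2)) * cis (2 * pi * (t * (x \<bullet> b)))"])
      (rule gaussian_real)
  show "(LINT \<xi>|lborel. complex_of_real (gauss \<xi>) * cis (2 * pi * (x \<bullet> \<xi>))) = gauss x"
    unfolding eq
    by (subst lborel_prod_Basis(2)[where f="\<lambda>b t. complex_of_real (exp (- pi * t\<^sup>2)) * cis (2 * pi * (t * (x \<bullet> b)))"])
      (simp_all only: gaussian_real gauss_prod of_real_prod)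
qed

lemma integrable_gauss: "integrable lborel (gauss :: 'a::euclidean_space \<Rightarrow> real)"
proof -
  have "integrable lborel (\<lambda>\<xi>::'a. norm (complex_of_real (gauss \<xi>) * cis (2 * pi * (0 \<bullet> \<xi>))))"
    by (intro integrable_norm gauss_fourier)
  then show ?thesis by (simp add: norm_mult)
qed

lemma integral_gauss: "(LINT x|lborel. gauss (x :: 'a::euclidean_space)) = 1"
proof -
  have "complex_of_real (LINT x|lborel. gauss (x :: 'a)) = complex_of_real 1"
    using gauss_fourier(2)[of "0::'a"] by simp
  then show ?thesis using of_real_eq_iff by blast
qed

lemma integrable_gauss_scale:
  "\<epsilon> \<noteq> 0 \<Longrightarrow> integrable lborel (\<lambda>x::'a::euclidean_space. gauss (\<epsilon> *\<^sub>R x))"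
  using lborel_integrable_affine[OF integrable_gauss, of \<epsilon> 0] by simp

text \<open>Damping by \<open>gauss (\<epsilon> *\<^sub>R \<xi>)\<close> on the frequency side
  becomes the approximate identity of width \<open>\<epsilon>\<close> on the space side.\<close>

lemma gauss_fourier_scale:
  fixes z :: "'a::euclidean_space"
  assumes e: "\<epsilon> > 0"
  shows "(LINT \<xi>|lborel. complex_of_real (gauss (\<epsilon> *\<^sub>R \<xi>)) * cis (2 * pi * (z \<bullet> \<xi>)))
    = complex_of_real (inverse (\<epsilon> ^ DIM('a)) * gauss (z /\<^sub>R \<epsilon>))"
proof -
  let ?g = "\<lambda>\<xi>. complex_of_real (gauss \<xi>) * cis (2 * pi * ((z /\<^sub>R \<epsilon>) \<bullet> \<xi>))"
  have "(LINT \<xi>|lborel. ?g \<xi>) = (\<bar>\<epsilon>\<bar> ^ DIM('a)) *\<^sub>R (LINT \<xi>|lborel. ?g (0 + \<epsilon> *\<^sub>R \<xi>))"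
    by (rule lborel_integral_affine) (use e in auto)
  then have "gauss (z /\<^sub>R \<epsilon>) = (\<epsilon> ^ DIM('a)) *\<^sub>R
    (LINT \<xi>|lborel. complex_of_real (gauss (\<epsilon> *\<^sub>R \<xi>)) * cis (2 * pi * (z \<bullet> \<xi>)))"
    unfolding gauss_fourier(2) using e by (simp add: mult.assoc[symmetric])
  then show ?thesis using e by (simp add: scaleR_conv_of_real field_simps)
qed

section \<open>Gaussian averages of functions\<close>

lemma fourier_cis: "fourier u \<xi> = (LINT x|lborel. u x * cis (- 2 * pi * (x \<bullet> \<xi>)))"
  unfolding fourier_def cis_conv_exp by (simp add: mult_ac)

lemma borel_measurable_fourier [measurable]:
  assumes [measurable]: "u \<in> borel_measurable borel"
  shows "fourier u \<in> borel_measurable borel"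
  unfolding fourier_cis[abs_def] by measurable

lemma norm_fourier_le: "norm (fourier u \<xi>) \<le> (LINT x|lborel. norm (u x))"
  unfolding fourier_cis by (rule order_trans[OF integral_norm_bound]) (simp add: norm_mult)

text \<open>Convolution with the Gaussian of width \<open>\<epsilon>\<close>, after the substitution
  that moves \<open>\<epsilon>\<close> from the kernel into the argument of \<open>f\<close>. The
  weight stays fixed as \<open>\<epsilon>\<close> tends to 0, which suits dominated
  convergence.\<close>

definition smooth :: "real \<Rightarrow> ('a::euclidean_space \<Rightarrow> complex) \<Rightarrow> 'a \<Rightarrow> complex" where
  "smooth \<epsilon> f x = (LINT t|lborel. f (x + \<epsilon> *\<^sub>R t) * complex_of_real (gauss t))"

text \<open>Insert the integral for \<open>fourier w\<close> and integrate over the frequency first: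
  the damped character integrates to a Gaussian in \<open>x - z\<close>, and the substitution
  \<open>z = x + \<epsilon> t\<close> produces the average. The damping makes the double integrand
  integrable.\<close>

lemma smooth_fourier:
  fixes w :: "'a::euclidean_space \<Rightarrow> complex"
  assumes w: "integrable lborel w" and e: "\<epsilon> > 0"
  shows "smooth \<epsilon> w x = (LINT \<xi>|lborel. complex_of_real (gauss (\<epsilon> *\<^sub>R \<xi>)) * cis (2 * pi * (x \<bullet> \<xi>)) * fourier w \<xi>)"
proof -
  have [measurable]: "w \<in> borel_measurable borel" using w by auto
  let ?k = "\<lambda>\<xi> z. complex_of_real (gauss (\<epsilon> *\<^sub>R \<xi>)) * cis (2 * pi * ((x - z) \<bullet> \<xi>)) * w z"
  have k: "integrable (lborel \<Otimes>\<^sub>M lborel) (\<lambda>(\<xi>, z). ?k \<xi> z)"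
  proof (rule Bochner_Integration.integrable_bound)
    show "integrable (lborel \<Otimes>\<^sub>M lborel) (\<lambda>(\<xi>, z). complex_of_real (gauss (\<epsilon> *\<^sub>R (\<xi>::'a))) * w z)"
      using e w integrable_gauss_scale[of \<epsilon>] by (intro lborel_pair.integrable_prod_mult) auto
    show "AE p in lborel \<Otimes>\<^sub>M lborel. norm (case p of (\<xi>, z) \<Rightarrow> ?k \<xi> z)
        \<le> norm (case p of (\<xi>, z) \<Rightarrow> complex_of_real (gauss (\<epsilon> *\<^sub>R \<xi>)) * w z)"
      by (auto simp: norm_mult)
  qed measurable
  have "(LINT \<xi>|lborel. complex_of_real (gauss (\<epsilon> *\<^sub>R \<xi>)) * cis (2 * pi * (x \<bullet> \<xi>)) * fourier w \<xi>)
    = (LINT \<xi>|lborel. LINT z|lborel. ?k \<xi> z)"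
  proof (rule Bochner_Integration.integral_cong[OF refl])
    fix \<xi> :: 'a
    have "?k \<xi> z = complex_of_real (gauss (\<epsilon> *\<^sub>R \<xi>)) * cis (2 * pi * (x \<bullet> \<xi>)) * (w z * cis (- 2 * pi * (z \<bullet> \<xi>)))" for z
    proof -
      have "cis (2 * pi * ((x - z) \<bullet> \<xi>)) = cis (2 * pi * (x \<bullet> \<xi>)) * cis (- 2 * pi * (z \<bullet> \<xi>))"
        by (simp add: cis_mult inner_diff_left algebra_simps)
      then show ?thesis by simp
    qed
    then have "(LINT z|lborel. ?k \<xi> z) = (LINT z|lborel.
        complex_of_real (gauss (\<epsilon> *\<^sub>R \<xi>)) * cis (2 * pi * (x \<bullet> \<xi>)) * (w z * cis (- 2 * pi * (z \<bullet> \<xi>))))"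
      by presburger
    then show "complex_of_real (gauss (\<epsilon> *\<^sub>R \<xi>)) * cis (2 * pi * (x \<bullet> \<xi>)) * fourier w \<xi> = (LINT z|lborel. ?k \<xi> z)"
      by (simp add: fourier_cis)
  qed
  also have "\<dots> = (LINT z|lborel. LINT \<xi>|lborel. ?k \<xi> z)"
    by (rule lborel_pair.Fubini_integral[OF k, symmetric])
  also have "\<dots> = (LINT z|lborel. complex_of_real (inverse (\<epsilon> ^ DIM('a)) * gauss ((x - z) /\<^sub>R \<epsilon>)) * w z)"
    by (simp add: gauss_fourier_scale[OF e])
  also have "\<dots> = (\<bar>\<epsilon>\<bar> ^ DIM('a)) *\<^sub>R (LINT t|lborel. complex_of_real
      (inverse (\<epsilon> ^ DIM('a)) * gauss ((x - (x + \<epsilon> *\<^sub>R t)) /\<^sub>R \<epsilon>)) * w (x + \<epsilon> *\<^sub>R t))"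
    by (rule lborel_integral_affine) (use e in auto)
  also have "\<dots> = smooth \<epsilon> w x"
  proof -
    have g: "gauss ((x - (x + \<epsilon> *\<^sub>R t)) /\<^sub>R \<epsilon>) = gauss t" for t using e by (simp add: gauss_def)
    have h: "(\<lambda>t. complex_of_real (inverse (\<epsilon> ^ DIM('a)) * gauss t) * w (x + \<epsilon> *\<^sub>R t)) =
      (\<lambda>t. complex_of_real (inverse (\<epsilon> ^ DIM('a))) * (w (x + \<epsilon> *\<^sub>R t) * complex_of_real (gauss t)))"
      by (simp add: fun_eq_iff)
    show ?thesis using e unfolding g h smooth_def by (simp add: scaleR_conv_of_real)
  qed
  finally show ?thesis ..
qed

lemma smooth_tendsto:
  fixes f :: "'a::euclidean_space \<Rightarrow> complex"
  assumes [measurable]: "f \<in> borel_measurable borel" and cont: "isCont f x"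
    and C: "\<And>x. norm (f x) \<le> C" and e: "\<epsilon> \<longlonglongrightarrow> 0"
  shows "(\<lambda>n. smooth (\<epsilon> n) f x) \<longlonglongrightarrow> f x"
proof -
  have "(\<lambda>n. smooth (\<epsilon> n) f x) \<longlonglongrightarrow> (LINT t|lborel. f x * complex_of_real (gauss (t::'a)))"
    unfolding smooth_def
  proof (rule integral_dominated_convergence[where w="\<lambda>t. C * gauss t"])
    show "AE t in lborel. (\<lambda>n. f (x + \<epsilon> n *\<^sub>R t) * complex_of_real (gauss t)) \<longlonglongrightarrow> f x * complex_of_real (gauss t)"
    proof (intro AE_I2 tendsto_mult tendsto_const isCont_tendsto_compose[OF cont])
      fix t :: 'a
      have "(\<lambda>n. x + \<epsilon> n *\<^sub>R t) \<longlonglongrightarrow> x + 0 *\<^sub>R t" by (intro tendsto_intros e)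
      then show "(\<lambda>n. x + \<epsilon> n *\<^sub>R t) \<longlonglongrightarrow> x" by simp
    qed
    show "AE t in lborel. norm (f (x + \<epsilon> n *\<^sub>R t) * complex_of_real (gauss t)) \<le> C * gauss t" for n
      using C by (auto simp: norm_mult intro!: mult_right_mono)
    show "integrable lborel (\<lambda>t::'a. C * gauss t)" by (simp add: integrable_gauss)
  qed measurable
  also have "(LINT t|lborel. f x * complex_of_real (gauss (t::'a))) = f x"
    by (simp add: integral_gauss)
  finally show ?thesis .
qed

lemma norm_smooth_le:
  fixes f :: "'a::euclidean_space \<Rightarrow> complex"
  assumes [measurable]: "f \<in> borel_measurable borel" and C: "\<And>x. norm (f x) \<le> C"
  shows "norm (smooth \<epsilon> f x) \<le> C"
proof -
  have "norm (smooth \<epsilon> f x) \<le> (LINT t|lborel. C * gauss (t::'a))"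
    unfolding smooth_def
  proof (rule Bochner_Integration.integral_norm_bound_integral)
    show i: "integrable lborel (\<lambda>t::'a. C * gauss t)" by (simp add: integrable_gauss)
    show le: "norm (f (x + \<epsilon> *\<^sub>R t) * complex_of_real (gauss t)) \<le> C * gauss t" for t
      using C by (auto simp: norm_mult intro!: mult_right_mono)
    show "integrable lborel (\<lambda>t. f (x + \<epsilon> *\<^sub>R t) * complex_of_real (gauss t))"
      by (rule Bochner_Integration.integrable_bound[OF i]) (use le in \<open>auto intro: order_trans[OF _ abs_ge_self]\<close>)
  qed
  then show ?thesis by (simp add: integral_gauss)
qed

section \<open>Integrability and inversion from the regularised formula\<close>

definition inv_fourier :: "('a::euclidean_space \<Rightarrow> complex) \<Rightarrow> 'a \<Rightarrow> complex" where
  "inv_fourier v x = (LINT \<xi>|lborel. cis (2 * pi * (x \<bullet> \<xi>)) * v \<xi>)"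

text \<open>A weak form of ``\<open>v\<close> is the Fourier transform of \<open>f\<close>'': inversion after Gaussian regularisation.\<close>

definition gauss_pair :: "('a::euclidean_space \<Rightarrow> complex) \<Rightarrow> ('a \<Rightarrow> complex) \<Rightarrow> bool" where
  "gauss_pair f v \<longleftrightarrow> v \<in> borel_measurable borel \<and>
     (\<forall>\<epsilon>>0. integrable lborel (\<lambda>\<xi>. complex_of_real (gauss (\<epsilon> *\<^sub>R \<xi>)) * v \<xi>)) \<and>
     (\<forall>\<epsilon>>0. \<forall>x. smooth \<epsilon> f x =
        (LINT \<xi>|lborel. complex_of_real (gauss (\<epsilon> *\<^sub>R \<xi>)) * cis (2 * pi * (x \<bullet> \<xi>)) * v \<xi>))"

lemma gauss_scale_tendsto: "\<epsilon> \<longlonglongrightarrow> 0 \<Longrightarrow> (\<lambda>n. gauss (\<epsilon> n *\<^sub>R \<xi>)) \<longlonglongrightarrow> 1"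
proof -
  assume "\<epsilon> \<longlonglongrightarrow> 0"
  then have "(\<lambda>n. exp (- pi * (norm (\<epsilon> n *\<^sub>R \<xi>))\<^sup>2)) \<longlonglongrightarrow> exp (- pi * (norm (0 *\<^sub>R \<xi>))\<^sup>2)"
    by (intro tendsto_intros)
  then show ?thesis by (simp add: gauss_def)
qed

text \<open>At the origin the characters are 1, so for nonnegative \<open>v\<close> the damped
  integral of \<open>norm (v \<xi>)\<close> equals \<open>smooth \<epsilon> f 0\<close> and is at
  most \<open>C\<close>; Fatou's lemma removes the damping.\<close>

lemma gauss_pair_nonneg_integrable:
  fixes f :: "'a::euclidean_space \<Rightarrow> complex"
  assumes p: "gauss_pair f v" and [measurable]: "f \<in> borel_measurable borel"
    and C: "\<And>x. norm (f x) \<le> C" and nn: "AE \<xi> in lborel. v \<xi> \<in> \<real>\<^sub>\<ge>\<^sub>0"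
  shows "integrable lborel v"
proof -
  have [measurable]: "v \<in> borel_measurable borel" using p by (simp add: gauss_pair_def)
  define \<epsilon> where "\<epsilon> n = inverse (real (Suc n))" for n
  have e: "\<epsilon> n > 0" "\<epsilon> \<longlonglongrightarrow> 0" for n
    unfolding \<epsilon>_def using LIMSEQ_inverse_real_of_nat by auto
  have I: "(\<integral>\<^sup>+\<xi>. ennreal (gauss (\<epsilon> n *\<^sub>R \<xi>) * norm (v \<xi>)) \<partial>lborel) \<le> ennreal C" for n
  proof -
    have int: "integrable lborel (\<lambda>\<xi>. complex_of_real (gauss (\<epsilon> n *\<^sub>R \<xi>)) * v \<xi>)"
      using p e by (simp add: gauss_pair_def)
    then have "integrable lborel (\<lambda>\<xi>. norm (complex_of_real (gauss (\<epsilon> n *\<^sub>R \<xi>)) * v \<xi>))"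
      by (rule integrable_norm)
    then have int': "integrable lborel (\<lambda>\<xi>. gauss (\<epsilon> n *\<^sub>R \<xi>) * norm (v \<xi>))"
      by (simp add: norm_mult)
    have "complex_of_real (LINT \<xi>|lborel. gauss (\<epsilon> n *\<^sub>R \<xi>) * norm (v \<xi>)) =
       (LINT \<xi>|lborel. complex_of_real (gauss (\<epsilon> n *\<^sub>R \<xi>)) * v \<xi>)"
      unfolding integral_complex_of_real[symmetric]
      by (rule integral_cong_AE) (use nn in \<open>auto simp: nonneg_Reals_cmod_eq_Re complex_nonneg_Reals_iff complex_eq_iff\<close>)
    also have "\<dots> = smooth (\<epsilon> n) f 0"
      using p e by (simp add: gauss_pair_def)
    finally have "norm (complex_of_real (LINT \<xi>|lborel. gauss (\<epsilon> n *\<^sub>R \<xi>) * norm (v \<xi>))) \<le> C"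
      using norm_smooth_le[of f C] C by simp
    then have "(LINT \<xi>|lborel. gauss (\<epsilon> n *\<^sub>R \<xi>) * norm (v \<xi>)) \<le> C" by simp
    then show ?thesis
      by (subst nn_integral_eq_integral[OF int']) (auto intro!: ennreal_leI)
  qed
  have "(\<integral>\<^sup>+\<xi>. ennreal (norm (v \<xi>)) \<partial>lborel) =
      (\<integral>\<^sup>+\<xi>. liminf (\<lambda>n. ennreal (gauss (\<epsilon> n *\<^sub>R \<xi>) * norm (v \<xi>))) \<partial>lborel)"
  proof (rule nn_integral_cong)
    fix \<xi> :: 'a
    have "(\<lambda>n. ennreal (gauss (\<epsilon> n *\<^sub>R \<xi>) * norm (v \<xi>))) \<longlonglongrightarrow> ennreal (1 * norm (v \<xi>))"
      by (intro tendsto_ennrealI tendsto_mult tendsto_const gauss_scale_tendsto e)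
    from lim_imp_Liminf[OF _ this] show "ennreal (norm (v \<xi>)) = liminf (\<lambda>n. ennreal (gauss (\<epsilon> n *\<^sub>R \<xi>) * norm (v \<xi>)))"
      by simp
  qed
  also have "\<dots> \<le> liminf (\<lambda>n. \<integral>\<^sup>+\<xi>. ennreal (gauss (\<epsilon> n *\<^sub>R \<xi>) * norm (v \<xi>)) \<partial>lborel)"
    by (rule nn_integral_liminf) measurable
  also have "\<dots> \<le> ennreal C"
    using I by (intro Liminf_le) (auto intro: always_eventually)
  finally show ?thesis
    by (intro integrableI_bounded) (auto simp: le_less_trans)
qed

text \<open>Two limits of one sequence: the averages tend to \<open>f x\<close> by continuity at
  \<open>x\<close>, the damped integrals to \<open>inv_fourier v x\<close> under the majorant
  \<open>norm (v \<xi>)\<close>.\<close>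

lemma gauss_pair_inversion:
  fixes f :: "'a::euclidean_space \<Rightarrow> complex"
  assumes p: "gauss_pair f v" and [measurable]: "f \<in> borel_measurable borel"
    and cont: "isCont f x" and C: "\<And>x. norm (f x) \<le> C" and v: "integrable lborel v"
  shows "f x = inv_fourier v x"
proof (rule LIMSEQ_unique)
  have [measurable]: "v \<in> borel_measurable borel" using p by (simp add: gauss_pair_def)
  define \<epsilon> where "\<epsilon> n = inverse (real (Suc n))" for n
  have e: "\<epsilon> n > 0" "\<epsilon> \<longlonglongrightarrow> 0" for n
    unfolding \<epsilon>_def using LIMSEQ_inverse_real_of_nat by auto
  show "(\<lambda>n. smooth (\<epsilon> n) f x) \<longlonglongrightarrow> f x"
    by (rule smooth_tendsto[OF _ cont C e(2)]) measurable
  have "(\<lambda>n. LINT \<xi>|lborel. complex_of_real (gauss (\<epsilon> n *\<^sub>R \<xi>)) * cis (2 * pi * (x \<bullet> \<xi>)) * v \<xi>)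
    \<longlonglongrightarrow> (LINT \<xi>|lborel. cis (2 * pi * (x \<bullet> \<xi>)) * v \<xi>)"
  proof (rule integral_dominated_convergence[where w="\<lambda>\<xi>. norm (v \<xi>)"])
    have "(\<lambda>n. complex_of_real (gauss (\<epsilon> n *\<^sub>R \<xi>)) * cis (2 * pi * (x \<bullet> \<xi>)) * v \<xi>)
      \<longlonglongrightarrow> complex_of_real 1 * cis (2 * pi * (x \<bullet> \<xi>)) * v \<xi>" for \<xi>
      by (intro tendsto_mult tendsto_const tendsto_of_real gauss_scale_tendsto e)
    then show "AE \<xi> in lborel. (\<lambda>n. complex_of_real (gauss (\<epsilon> n *\<^sub>R \<xi>)) * cis (2 * pi * (x \<bullet> \<xi>)) * v \<xi>)
      \<longlonglongrightarrow> cis (2 * pi * (x \<bullet> \<xi>)) * v \<xi>" by simp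
    show "AE \<xi> in lborel. norm (complex_of_real (gauss (\<epsilon> n *\<^sub>R \<xi>)) * cis (2 * pi * (x \<bullet> \<xi>)) * v \<xi>) \<le> norm (v \<xi>)" for n
      by (auto simp: norm_mult intro!: mult_left_le_one_le)
  qed (use v in \<open>auto\<close>)
  then show "(\<lambda>n. smooth (\<epsilon> n) f x) \<longlonglongrightarrow> inv_fourier v x"
    using p e by (simp add: gauss_pair_def inv_fourier_def)
qed

lemma gauss_pair_fourier:
  fixes w :: "'a::euclidean_space \<Rightarrow> complex"
  assumes w: "integrable lborel w"
  shows "gauss_pair w (fourier w)"
proof -
  have [measurable]: "w \<in> borel_measurable borel" using w by auto
  have "integrable lborel (\<lambda>\<xi>. complex_of_real (gauss (\<epsilon> *\<^sub>R \<xi>)) * fourier w \<xi>)" if "\<epsilon> > 0" for \<epsilon>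
  proof (rule Bochner_Integration.integrable_bound)
    show "integrable lborel (\<lambda>\<xi>::'a. gauss (\<epsilon> *\<^sub>R \<xi>) * (LINT x|lborel. norm (w x)))"
      using that integrable_gauss_scale[of \<epsilon>, where 'a='a] by simp
    show "AE \<xi> in lborel. norm (complex_of_real (gauss (\<epsilon> *\<^sub>R \<xi>)) * fourier w \<xi>)
      \<le> norm (gauss (\<epsilon> *\<^sub>R \<xi>) * (LINT x|lborel. norm (w x)))"
      using norm_fourier_le[of w] by (auto simp: norm_mult abs_mult intro!: mult_left_mono order_trans[OF _ abs_ge_self])
  qed measurable
  then show ?thesis by (simp add: gauss_pair_def smooth_fourier[OF w])
qed


section \<open>From the L^2 relation to the regularised formula\<close>

lemma mult_integrable_of_squares:
  fixes f g :: "'a \<Rightarrow> complex"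
  assumes [measurable]: "f \<in> borel_measurable M" "g \<in> borel_measurable M"
    and "integrable M (\<lambda>x. (norm (f x))\<^sup>2)" "integrable M (\<lambda>x. (norm (g x))\<^sup>2)"
  shows "integrable M (\<lambda>x. f x * g x)"
proof (rule Bochner_Integration.integrable_bound)
  show "integrable M (\<lambda>x. (norm (f x))\<^sup>2 + (norm (g x))\<^sup>2)" using assms by simp
  show "AE x in M. norm (f x * g x) \<le> norm ((norm (f x))\<^sup>2 + (norm (g x))\<^sup>2)"
  proof (rule AE_I2)
    fix x
    have "2 * (norm (f x) * norm (g x)) \<le> (norm (f x))\<^sup>2 + (norm (g x))\<^sup>2"
      using sum_squares_bound[of "norm (f x)" "norm (g x)"] by simp
    moreover have "0 \<le> norm (f x) * norm (g x)" by simp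
    ultimately show "norm (f x * g x) \<le> norm ((norm (f x))\<^sup>2 + (norm (g x))\<^sup>2)"
      unfolding norm_mult real_norm_def by linarith
  qed
qed measurable

lemma integral_mult_squared_le:
  fixes f g :: "'a \<Rightarrow> complex"
  assumes [measurable]: "f \<in> borel_measurable M" "g \<in> borel_measurable M"
  shows "ennreal ((norm (LINT x|M. f x * g x))\<^sup>2)
    \<le> (\<integral>\<^sup>+x. ennreal ((norm (f x))\<^sup>2) \<partial>M) * (\<integral>\<^sup>+x. ennreal ((norm (g x))\<^sup>2) \<partial>M)"
proof -
  have "ennreal (norm (LINT x|M. f x * g x)) \<le> (\<integral>\<^sup>+x. ennreal (norm (f x)) * ennreal (norm (g x)) \<partial>M)"
  \<comment> \<open>A nonintegrable product has Bochner integral 0 by convention, and the bound is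
    then trivial.\<close>
  proof (cases "integrable M (\<lambda>x. f x * g x)")
    case True
    from integral_norm_bound_ennreal[OF this] show ?thesis
      by (simp add: norm_mult ennreal_mult)
  qed (simp add: not_integrable_integral_eq)
  then have "(ennreal (norm (LINT x|M. f x * g x)))\<^sup>2 \<le> (\<integral>\<^sup>+x. ennreal (norm (f x)) * ennreal (norm (g x)) \<partial>M)\<^sup>2"
    by (rule power_mono) simp
  also have "\<dots> \<le> (\<integral>\<^sup>+x. (ennreal (norm (f x)))\<^sup>2 \<partial>M) * (\<integral>\<^sup>+x. (ennreal (norm (g x)))\<^sup>2 \<partial>M)"
    by (rule Cauchy_Schwarz_nn_integral) measurable
  finally show ?thesis by (simp add: ennreal_power)
qed

text \<open>By Cauchy-Schwarz the difference of the integrals is at most the L^2 norm of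
  \<open>g\<close> times that of \<open>w k - u\<close>. The estimate runs in
  \<open>ennreal\<close>, where \<open>L2_tendsto\<close> is stated.\<close>

lemma L2_tendsto_integral:
  fixes w :: "nat \<Rightarrow> 'a::euclidean_space \<Rightarrow> complex"
  assumes lim: "L2_tendsto w u"
    and [measurable]: "\<And>k. w k \<in> borel_measurable borel" "u \<in> borel_measurable borel" "g \<in> borel_measurable borel"
    and g2: "integrable lborel (\<lambda>x. (norm (g x))\<^sup>2)"
    and wg: "\<And>k. integrable lborel (\<lambda>x. w k x * g x)" and ug: "integrable lborel (\<lambda>x. u x * g x)"
  shows "(\<lambda>k. LINT x|lborel. w k x * g x) \<longlonglongrightarrow> (LINT x|lborel. u x * g x)"
proof -
  let ?G = "\<integral>\<^sup>+x. ennreal ((norm (g x))\<^sup>2) \<partial>lborel"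
  let ?d = "\<lambda>k. (LINT x|lborel. w k x * g x) - (LINT x|lborel. u x * g x)"
  have G: "?G < top" using g2 by (simp add: nn_integral_eq_integral)
  have le: "ennreal ((norm (?d k))\<^sup>2) \<le> ?G * (\<integral>\<^sup>+x. ennreal ((norm (w k x - u x))\<^sup>2) \<partial>lborel)" for k
  proof -
    have "?d k = (LINT x|lborel. (w k x - u x) * g x)"
      using wg[of k] ug by (simp add: left_diff_distrib)
    then show ?thesis
      using integral_mult_squared_le[of g lborel "\<lambda>x. w k x - u x"] by (simp add: mult.commute)
  qed
  have "(\<lambda>k. ?G * (\<integral>\<^sup>+x. ennreal ((norm (w k x - u x))\<^sup>2) \<partial>lborel)) \<longlonglongrightarrow> ?G * 0"
    by (rule ennreal_tendsto_cmult[OF G lim[unfolded L2_tendsto_def]])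
  then have G0: "(\<lambda>k. ?G * (\<integral>\<^sup>+x. ennreal ((norm (w k x - u x))\<^sup>2) \<partial>lborel)) \<longlonglongrightarrow> 0"
    by (simp only: mult_zero_right)
  have "(\<lambda>k. ennreal ((norm (?d k))\<^sup>2)) \<longlonglongrightarrow> 0"
    by (rule tendsto_sandwich[OF _ _ tendsto_const G0]) (intro always_eventually allI le zero_le)+
  then have "(\<lambda>k. (norm (?d k))\<^sup>2) \<longlonglongrightarrow> 0"
    by (subst (asm) ennreal_tendsto_0_iff) auto
  then have "(\<lambda>k. sqrt ((norm (?d k))\<^sup>2)) \<longlonglongrightarrow> sqrt 0" by (rule tendsto_real_sqrt)
  then have "?d \<longlonglongrightarrow> 0" by (simp add: tendsto_norm_zero_iff)
  then show ?thesis by (simp add: LIM_zero_iff)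
qed

lemma integrable_gauss_sq: "integrable lborel (\<lambda>x::'a::euclidean_space. (gauss (x))\<^sup>2)"
  by (rule Bochner_Integration.integrable_bound[OF integrable_gauss])
    (auto simp: power2_eq_square abs_mult mult_left_le_one_le)

text \<open>For the integrable approximations \<open>w k\<close> the formula is known. Its sides are
  pairings with fixed square integrable functions, a Gaussian around \<open>x\<close> and a damped
  character, so L^2 convergence of \<open>w k\<close> and of their transforms carries it over to
  \<open>u\<close> and \<open>v\<close>.\<close>

lemma has_L2_fourier_gauss_pair:
  fixes u v :: "'a::euclidean_space \<Rightarrow> complex"
  assumes "has_L2_fourier u v"
  shows "gauss_pair u v"
proof -
  obtain w where w: "\<And>k. integrable lborel (w k)" "\<And>k. w k \<in> L2" "L2_tendsto w u"
      "L2_tendsto (\<lambda>k. fourier (w k)) v"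
    using assms by (auto simp: has_L2_fourier_def)
  have u: "integrable lborel (\<lambda>x. (norm (u x))\<^sup>2)" and [measurable]: "u \<in> borel_measurable borel"
    and v: "integrable lborel (\<lambda>x. (norm (v x))\<^sup>2)" and [measurable]: "v \<in> borel_measurable borel"
    using assms by (auto simp: has_L2_fourier_def L2_def)
  have w2: "integrable lborel (\<lambda>x. (norm (w k x))\<^sup>2)" and [measurable]: "w k \<in> borel_measurable borel" for k
    using w(2)[of k] by (auto simp: L2_def)
  have gs2: "integrable lborel (\<lambda>x::'a. (gauss (\<epsilon> *\<^sub>R x))\<^sup>2)" if "\<epsilon> > 0" for \<epsilon>
    using lborel_integrable_affine[OF integrable_gauss_sq, of \<epsilon> 0] that by simp
  have int_v: "integrable lborel (\<lambda>\<xi>. v \<xi> * (complex_of_real (gauss (\<epsilon> *\<^sub>R \<xi>)) * cis (2 * pi * (x \<bullet> \<xi>))))"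
    if "\<epsilon> > 0" for \<epsilon> x
    using v gs2[OF that] by (intro mult_integrable_of_squares) (auto simp: norm_mult)
  have eq: "smooth \<epsilon> u x = (LINT \<xi>|lborel. v \<xi> * (complex_of_real (gauss (\<epsilon> *\<^sub>R \<xi>)) * cis (2 * pi * (x \<bullet> \<xi>))))"
    if e: "\<epsilon> > 0" for \<epsilon> x
  proof (rule LIMSEQ_unique)
    \<comment> \<open>The weight of \<open>smooth\<close> in the variable
      \<open>z = x + \<epsilon> t\<close>, so that the average becomes a pairing with a function
      that does not depend on \<open>k\<close>.\<close>
    let ?g = "\<lambda>z. complex_of_real (inverse (\<epsilon> ^ DIM('a)) * gauss ((z - x) /\<^sub>R \<epsilon>))"
    have sm: "smooth \<epsilon> f x = (LINT z|lborel. f z * ?g z)" if [measurable]: "f \<in> borel_measurable borel" for f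
    proof -
      have "(LINT z|lborel. f z * ?g z) = (\<bar>\<epsilon>\<bar> ^ DIM('a)) *\<^sub>R (LINT t|lborel. f (x + \<epsilon> *\<^sub>R t) * ?g (x + \<epsilon> *\<^sub>R t))"
        by (rule lborel_integral_affine) (use e in auto)
      moreover have "(\<lambda>t. f (x + \<epsilon> *\<^sub>R t) * ?g (x + \<epsilon> *\<^sub>R t)) =
          (\<lambda>t. complex_of_real (inverse (\<epsilon> ^ DIM('a))) * (f (x + \<epsilon> *\<^sub>R t) * complex_of_real (gauss t)))"
        using e by (auto simp: fun_eq_iff)
      ultimately show ?thesis using e by (simp add: smooth_def scaleR_conv_of_real)
    qed
    have g2: "integrable lborel (\<lambda>z. (norm (?g z))\<^sup>2)"
    proof -
      have "integrable lborel (\<lambda>z::'a. (gauss ((- x /\<^sub>R \<epsilon>) + (1 / \<epsilon>) *\<^sub>R z))\<^sup>2)"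
        using lborel_integrable_affine[OF integrable_gauss_sq, of "1 / \<epsilon>" "- x /\<^sub>R \<epsilon>"] e by simp
      moreover have "(norm (?g z))\<^sup>2 = (inverse (\<epsilon> ^ DIM('a)))\<^sup>2 * (gauss ((- x /\<^sub>R \<epsilon>) + (1 / \<epsilon>) *\<^sub>R z))\<^sup>2" for z
        using e by (simp add: power_mult_distrib abs_mult scaleR_diff_right divide_inverse del: of_real_mult)
      ultimately show ?thesis by simp
    qed
    show "(\<lambda>k. smooth \<epsilon> (w k) x) \<longlonglongrightarrow> smooth \<epsilon> u x"
      by (simp only: sm \<open>u \<in> borel_measurable borel\<close> \<open>\<And>k. w k \<in> borel_measurable borel\<close>)
        (intro L2_tendsto_integral w(3) g2 mult_integrable_of_squares u w2; measurable)
    have "(\<lambda>k. LINT \<xi>|lborel. fourier (w k) \<xi> * (complex_of_real (gauss (\<epsilon> *\<^sub>R \<xi>)) * cis (2 * pi * (x \<bullet> \<xi>))))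
      \<longlonglongrightarrow> (LINT \<xi>|lborel. v \<xi> * (complex_of_real (gauss (\<epsilon> *\<^sub>R \<xi>)) * cis (2 * pi * (x \<bullet> \<xi>))))"
    proof (rule L2_tendsto_integral[OF w(4) _ _ _ _ _ int_v[OF e]])
      show "integrable lborel (\<lambda>\<xi>. (norm (complex_of_real (gauss (\<epsilon> *\<^sub>R \<xi>)) * cis (2 * pi * (x \<bullet> \<xi>))))\<^sup>2)"
        using gs2[OF e] by (simp add: norm_mult)
      show "integrable lborel (\<lambda>\<xi>. fourier (w k) \<xi> * (complex_of_real (gauss (\<epsilon> *\<^sub>R \<xi>)) * cis (2 * pi * (x \<bullet> \<xi>))))" for k
      proof (rule Bochner_Integration.integrable_bound)
        show "integrable lborel (\<lambda>\<xi>. complex_of_real (gauss (\<epsilon> *\<^sub>R \<xi>)) * fourier (w k) \<xi>)"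
          using gauss_pair_fourier[OF w(1)[of k]] e by (simp add: gauss_pair_def)
      qed (auto simp: norm_mult)
    qed measurable
    moreover have "smooth \<epsilon> (w k) x = (LINT \<xi>|lborel. fourier (w k) \<xi> * (complex_of_real (gauss (\<epsilon> *\<^sub>R \<xi>)) * cis (2 * pi * (x \<bullet> \<xi>))))" for k
      by (simp add: smooth_fourier[OF w(1) e] mult_ac)
    ultimately show "(\<lambda>k. smooth \<epsilon> (w k) x) \<longlonglongrightarrow> (LINT \<xi>|lborel. v \<xi> * (complex_of_real (gauss (\<epsilon> *\<^sub>R \<xi>)) * cis (2 * pi * (x \<bullet> \<xi>))))"
      by simp
  qed
  have "integrable lborel (\<lambda>\<xi>. complex_of_real (gauss (\<epsilon> *\<^sub>R \<xi>)) * v \<xi>)" if "\<epsilon> > 0" for \<epsilon>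
    using int_v[OF that, of 0] by (simp add: mult_ac)
  then show ?thesis
    unfolding gauss_pair_def by (auto simp: eq mult_ac)
qed

lemma pos_semidef_inversion:
  fixes \<rho> :: "'a::euclidean_space \<Rightarrow> real"
  assumes cont: "continuous_on UNIV \<rho>" and C: "\<And>x. \<bar>\<rho> x\<bar> \<le> C" and psd: "fun_pos_semidef \<rho>"
  obtains v where "integrable lborel v" "\<And>\<xi>. 0 \<le> v \<xi>"
    "\<And>x. complex_of_real (\<rho> x) = inv_fourier (\<lambda>\<xi>. complex_of_real (v \<xi>)) x"
proof -
  obtain v where v: "has_L2_fourier (\<lambda>x. complex_of_real (\<rho> x)) v" "AE \<xi> in lborel. v \<xi> \<in> \<real>\<^sub>\<ge>\<^sub>0"
    using psd by (auto simp: fun_pos_semidef_def)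
  have p: "gauss_pair (\<lambda>x. complex_of_real (\<rho> x)) v" by (rule has_L2_fourier_gauss_pair[OF v(1)])
  have [measurable]: "\<rho> \<in> borel_measurable borel" using cont by (rule borel_measurable_continuous_onI)
  have C': "norm (complex_of_real (\<rho> x)) \<le> C" for x using C by simp
  have int: "integrable lborel v"
    by (rule gauss_pair_nonneg_integrable[OF p _ C' v(2)]) measurable
  have [measurable]: "v \<in> borel_measurable borel" using int by auto
  show ?thesis
  proof (rule that)
    \<comment> \<open>The modulus replaces \<open>v\<close>: this changes it on a null set only and
      makes it real and nonnegative everywhere.\<close>
    show "integrable lborel (\<lambda>\<xi>. norm (v \<xi>))" by (rule integrable_norm[OF int])
    fix x
    have "isCont (\<lambda>x. complex_of_real (\<rho> x)) x"
      using cont by (intro continuous_intros) (simp add: continuous_on_eq_continuous_at)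
    then have "complex_of_real (\<rho> x) = inv_fourier v x"
      by (intro gauss_pair_inversion[OF p _ _ C' int]) measurable
    also have "\<dots> = inv_fourier (\<lambda>\<xi>. complex_of_real (norm (v \<xi>))) x"
      unfolding inv_fourier_def
      by (rule integral_cong_AE) (use v(2) in \<open>auto simp: nonneg_Reals_cmod_eq_Re complex_nonneg_Reals_iff complex_eq_iff\<close>)
    finally show "complex_of_real (\<rho> x) = inv_fourier (\<lambda>\<xi>. complex_of_real (norm (v \<xi>))) x" .
  qed simp
qed

section \<open>Symmetry of convolution square roots\<close>


definition cconv :: "('a::euclidean_space \<Rightarrow> complex) \<Rightarrow> ('a \<Rightarrow> complex) \<Rightarrow> 'a \<Rightarrow> complex" where
  "cconv f g x = (LINT y|lborel. f (x - y) * g y)"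

lemma cconv_integrable_pair:
  fixes f g :: "'a::euclidean_space \<Rightarrow> complex"
  assumes f: "integrable lborel f" and g: "integrable lborel g"
  shows "integrable (lborel \<Otimes>\<^sub>M lborel) (\<lambda>(y, x). f (x - y) * g y)"
proof -
  have [measurable]: "f \<in> borel_measurable borel" "g \<in> borel_measurable borel" using f g by auto
  have fy: "integrable lborel (\<lambda>x. f (x - y))" for y
    using lborel_integrable_affine[OF f, of 1 "- y"] by simp
  have nfy: "(LINT x|lborel. norm (f (x - y))) = (LINT x|lborel. norm (f x))" for y
    using lborel_integral_translate[of "\<lambda>x. norm (f x)" "- y"] by simp
  show ?thesis
  proof (rule lborel_pair.Fubini_integrable)
    show "integrable lborel (\<lambda>y. LINT x|lborel. norm (case (y, x) of (y, x) \<Rightarrow> f (x - y) * g y))"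
      using g nfy by (simp add: norm_mult)
    show "AE y in lborel. integrable lborel (\<lambda>x. case (y, x) of (y, x) \<Rightarrow> f (x - y) * g y)"
      using fy by simp
  qed measurable
qed

lemma cconv_fourier:
  fixes f g :: "'a::euclidean_space \<Rightarrow> complex"
  assumes f: "integrable lborel f" and g: "integrable lborel g"
  shows "integrable lborel (cconv f g)" "fourier (cconv f g) \<xi> = fourier f \<xi> * fourier g \<xi>"
proof -
  have [measurable]: "f \<in> borel_measurable borel" "g \<in> borel_measurable borel" using f g by auto
  note i = cconv_integrable_pair[OF f g]
  show "integrable lborel (cconv f g)"
    using lborel_pair.integrable_snd[OF i] by (simp add: cconv_def[abs_def])
  let ?k = "\<lambda>y x. f (x - y) * g y * cis (- 2 * pi * (x \<bullet> \<xi>))"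
  have k: "integrable (lborel \<Otimes>\<^sub>M lborel) (\<lambda>(y, x). ?k y x)"
    by (rule Bochner_Integration.integrable_bound[OF i]) (auto simp: norm_mult)
  have "fourier (cconv f g) \<xi> = (LINT x|lborel. LINT y|lborel. ?k y x)"
    by (simp add: fourier_cis cconv_def)
  also have "\<dots> = (LINT y|lborel. LINT x|lborel. ?k y x)"
    by (rule lborel_pair.Fubini_integral[OF k])
  also have "\<dots> = (LINT y|lborel. fourier f \<xi> * (g y * cis (- 2 * pi * (y \<bullet> \<xi>))))"
  proof (rule Bochner_Integration.integral_cong[OF refl])
    fix y :: 'a
    have "(LINT x|lborel. ?k y x) = (LINT x|lborel. ?k y (y + x))"
      by (rule lborel_integral_translate[symmetric]) measurable
    also have "\<dots> = (LINT x|lborel. (f x * cis (- 2 * pi * (x \<bullet> \<xi>))) * (g y * cis (- 2 * pi * (y \<bullet> \<xi>))))"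
    proof (rule Bochner_Integration.integral_cong[OF refl])
      fix x :: 'a
      have "cis (- 2 * pi * ((y + x) \<bullet> \<xi>)) = cis (- 2 * pi * (x \<bullet> \<xi>)) * cis (- 2 * pi * (y \<bullet> \<xi>))"
        by (simp add: cis_mult inner_add_left algebra_simps)
      then show "?k y (y + x) = (f x * cis (- 2 * pi * (x \<bullet> \<xi>))) * (g y * cis (- 2 * pi * (y \<bullet> \<xi>)))"
        by simp
    qed
    finally show "(LINT x|lborel. ?k y x) = fourier f \<xi> * (g y * cis (- 2 * pi * (y \<bullet> \<xi>)))"
      by (simp add: fourier_cis)
  qed
  also have "\<dots> = fourier f \<xi> * fourier g \<xi>" by (simp add: fourier_cis)
  finally show "fourier (cconv f g) \<xi> = fourier f \<xi> * fourier g \<xi>" .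
qed

lemma cconv_bound:
  fixes f g :: "'a::euclidean_space \<Rightarrow> complex"
  assumes [measurable]: "f \<in> borel_measurable borel" and C: "\<And>x. norm (f x) \<le> C" and g: "integrable lborel g"
  shows "norm (cconv f g x) \<le> C * (LINT y|lborel. norm (g y))"
proof -
  have [measurable]: "g \<in> borel_measurable borel" using g by auto
  have i: "integrable lborel (\<lambda>y. C * norm (g y))" using g by simp
  have le: "norm (f (x - y) * g y) \<le> C * norm (g y)" for y
    using C by (auto simp: norm_mult intro!: mult_right_mono)
  have "norm (cconv f g x) \<le> (LINT y|lborel. C * norm (g y))"
    unfolding cconv_def
    by (rule Bochner_Integration.integral_norm_bound_integral[OF _ i le],
        rule Bochner_Integration.integrable_bound[OF i])
      (use le in \<open>auto intro: order_trans[OF _ abs_ge_self]\<close>)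
  then show ?thesis by simp
qed

lemma cconv_isCont:
  fixes f g :: "'a::euclidean_space \<Rightarrow> complex"
  assumes cont: "continuous_on UNIV f" and C: "\<And>x. norm (f x) \<le> C" and g: "integrable lborel g"
  shows "isCont (cconv f g) x"
proof -
  have [measurable]: "f \<in> borel_measurable borel" using cont by (rule borel_measurable_continuous_onI)
  have [measurable]: "g \<in> borel_measurable borel" using g by auto
  show ?thesis
    unfolding continuous_at_sequentially comp_def
  proof (intro allI impI)
    fix X :: "nat \<Rightarrow> 'a" assume X: "X \<longlonglongrightarrow> x"
    show "(\<lambda>n. cconv f g (X n)) \<longlonglongrightarrow> cconv f g x"
      unfolding cconv_def
    proof (rule integral_dominated_convergence[where w="\<lambda>y. C * norm (g y)"])
      show "AE y in lborel. (\<lambda>n. f (X n - y) * g y) \<longlonglongrightarrow> f (x - y) * g y"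
        using cont X
        by (intro AE_I2 tendsto_mult tendsto_const isCont_tendsto_compose[where g=f] tendsto_diff)
          (auto simp: continuous_on_eq_continuous_at)
      show "AE y in lborel. norm (f (X n - y) * g y) \<le> C * norm (g y)" for n
        using C by (auto simp: norm_mult intro!: mult_right_mono)
      show "integrable lborel (\<lambda>y. C * norm (g y))" using g by simp
    qed measurable
  qed
qed

text \<open>The convolution is bounded and continuous, so both consequences of the regularised
  formula apply to it. Integrability of the product of transforms is the premise of the first and,
  for a nonnegative product, the conclusion of the second.\<close>

lemma cconv_inversion:
  fixes f g :: "'a::euclidean_space \<Rightarrow> complex"
  assumes f: "integrable lborel f" "continuous_on UNIV f" "\<And>x. norm (f x) \<le> C" and g: "integrable lborel g"
  shows "integrable lborel (\<lambda>\<xi>. fourier f \<xi> * fourier g \<xi>) \<Longrightarrow>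
      cconv f g x = inv_fourier (\<lambda>\<xi>. fourier f \<xi> * fourier g \<xi>) x"
    and "(\<And>\<xi>. fourier f \<xi> * fourier g \<xi> \<in> \<real>\<^sub>\<ge>\<^sub>0) \<Longrightarrow> integrable lborel (\<lambda>\<xi>. fourier f \<xi> * fourier g \<xi>)"
proof -
  have [measurable]: "f \<in> borel_measurable borel" "g \<in> borel_measurable borel" using f g by auto
  have p: "gauss_pair (cconv f g) (\<lambda>\<xi>. fourier f \<xi> * fourier g \<xi>)"
    using gauss_pair_fourier[OF cconv_fourier(1)[OF f(1) g]] by (simp add: cconv_fourier(2)[OF f(1) g, abs_def])
  have m: "cconv f g \<in> borel_measurable borel" using cconv_fourier(1)[OF f(1) g] by auto
  note b = cconv_bound[OF \<open>f \<in> borel_measurable borel\<close> f(3) g]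
  show "cconv f g x = inv_fourier (\<lambda>\<xi>. fourier f \<xi> * fourier g \<xi>) x"
    if "integrable lborel (\<lambda>\<xi>. fourier f \<xi> * fourier g \<xi>)"
    by (rule gauss_pair_inversion[OF p m cconv_isCont[OF f(2,3) g] b that])
  show "integrable lborel (\<lambda>\<xi>. fourier f \<xi> * fourier g \<xi>)"
    if "\<And>\<xi>. fourier f \<xi> * fourier g \<xi> \<in> \<real>\<^sub>\<ge>\<^sub>0"
    by (rule gauss_pair_nonneg_integrable[OF p m b]) (use that in simp)
qed

lemma fourier_reflect:
  fixes w :: "'a::euclidean_space \<Rightarrow> real"
  assumes [measurable]: "w \<in> borel_measurable borel"
  shows "fourier (\<lambda>x. complex_of_real (w (- x))) \<xi> = cnj (fourier (\<lambda>x. complex_of_real (w x)) \<xi>)"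
proof -
  have "fourier (\<lambda>x. complex_of_real (w (- x))) \<xi> =
      (LINT x|lborel. complex_of_real (w (- (0 - x))) * cis (- 2 * pi * ((0 - x) \<bullet> \<xi>)))"
    unfolding fourier_cis by (rule lborel_integral_uminus_translate[symmetric]) measurable
  also have "\<dots> = cnj (fourier (\<lambda>x. complex_of_real (w x)) \<xi>)"
    unfolding fourier_cis by (subst Bochner_Integration.integral_cnj[symmetric]) (simp add: cis_cnj)
  finally show ?thesis .
qed

text \<open>For the convolution of \<open>w\<close> with its reflection, the product of transforms
  is the squared modulus of the transform of \<open>w\<close>. It is nonnegative, hence integrable,
  and inversion at 0 is the asserted identity.\<close>

lemma plancherel:
  fixes w :: "'a::euclidean_space \<Rightarrow> real"
  assumes w: "integrable lborel w" "continuous_on UNIV w" and C: "\<And>x. \<bar>w x\<bar> \<le> C"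
  shows "integrable lborel (\<lambda>\<xi>. (norm (fourier (\<lambda>x. complex_of_real (w x)) \<xi>))\<^sup>2)"
    and "(LINT \<xi>|lborel. (norm (fourier (\<lambda>x. complex_of_real (w x)) \<xi>))\<^sup>2) = (LINT x|lborel. (w x)\<^sup>2)"
proof -
  have [measurable]: "w \<in> borel_measurable borel" using w by auto
  let ?w = "\<lambda>x. complex_of_real (w x)" and ?r = "\<lambda>x. complex_of_real (w (- x))"
  have i: "integrable lborel ?w" "integrable lborel ?r"
    using w(1) lborel_integrable_affine[OF w(1), of "-1" 0] by auto
  have c: "continuous_on UNIV ?w" by (intro continuous_intros w)
  have b: "norm (?w x) \<le> C" for x using C by simp
  have eq: "fourier ?w \<xi> * fourier ?r \<xi> = complex_of_real ((norm (fourier ?w \<xi>))\<^sup>2)" for \<xi>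
    by (simp only: fourier_reflect \<open>w \<in> borel_measurable borel\<close> complex_norm_square)
  have int: "integrable lborel (\<lambda>\<xi>. fourier ?w \<xi> * fourier ?r \<xi>)"
    by (rule cconv_inversion(2)[OF i(1) c b i(2)]) (simp only: eq, simp)
  then show "integrable lborel (\<lambda>\<xi>. (norm (fourier ?w \<xi>))\<^sup>2)"
    by (simp only: eq complex_of_real_integrable_eq)
  have "complex_of_real (LINT \<xi>|lborel. (norm (fourier ?w \<xi>))\<^sup>2) = inv_fourier (\<lambda>\<xi>. fourier ?w \<xi> * fourier ?r \<xi>) 0"
    unfolding inv_fourier_def eq by (simp flip: integral_complex_of_real)
  also have "\<dots> = cconv ?w ?r 0" by (rule cconv_inversion(1)[OF i(1) c b i(2) int, symmetric])
  also have "\<dots> = (LINT y|lborel. complex_of_real ((w (0 - y))\<^sup>2))"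
    by (simp add: cconv_def power2_eq_square)
  also have "\<dots> = (LINT y|lborel. complex_of_real ((w y)\<^sup>2))"
    by (rule lborel_integral_uminus_translate) measurable
  finally show "(LINT \<xi>|lborel. (norm (fourier ?w \<xi>))\<^sup>2) = (LINT x|lborel. (w x)\<^sup>2)"
    by (simp only: integral_complex_of_real of_real_eq_iff)
qed

section \<open>Injectivity of the inverse transform on L^1\<close>

text \<open>\<open>smooth \<epsilon> \<phi>\<close> is itself an inverse transform, and Fubini's
  theorem moves that transform onto \<open>d\<close>.\<close>

lemma inv_fourier_zero_imp_smooth_orthogonal:
  fixes d :: "'a::euclidean_space \<Rightarrow> complex"
  assumes d: "integrable lborel d" and z: "\<And>x. inv_fourier d x = 0"
    and \<phi>: "integrable lborel \<phi>" and e: "\<epsilon> > 0"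
  shows "(LINT \<zeta>|lborel. d \<zeta> * smooth \<epsilon> \<phi> \<zeta>) = 0"
proof -
  have [measurable]: "d \<in> borel_measurable borel" "\<phi> \<in> borel_measurable borel" using d \<phi> by auto
  let ?h = "\<lambda>x. complex_of_real (gauss (\<epsilon> *\<^sub>R x)) * fourier \<phi> x"
  have h: "integrable lborel ?h" using gauss_pair_fourier[OF \<phi>] e by (simp add: gauss_pair_def)
  let ?k = "\<lambda>\<zeta> x. d \<zeta> * ?h x * cis (2 * pi * (\<zeta> \<bullet> x))"
  have k: "integrable (lborel \<Otimes>\<^sub>M lborel) (\<lambda>(\<zeta>, x). ?k \<zeta> x)"
    by (rule Bochner_Integration.integrable_bound[OF lborel_pair.integrable_prod_mult[OF d h]])
      (auto simp: norm_mult)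
  have "(LINT \<zeta>|lborel. d \<zeta> * smooth \<epsilon> \<phi> \<zeta>) = (LINT \<zeta>|lborel. LINT x|lborel. ?k \<zeta> x)"
    by (simp add: smooth_fourier[OF \<phi> e] mult_ac flip: integral_mult_right_zero)
  also have "\<dots> = (LINT x|lborel. LINT \<zeta>|lborel. ?k \<zeta> x)"
    by (rule lborel_pair.Fubini_integral[OF k, symmetric])
  also have "\<dots> = (LINT x|lborel. ?h x * inv_fourier d x)"
    unfolding inv_fourier_def
    by (intro Bochner_Integration.integral_cong refl)
      (simp add: mult_ac inner_commute flip: integral_mult_right_zero)
  also have "\<dots> = 0" by (simp add: z)
  finally show ?thesis .
qed

lemma inv_fourier_zero_imp_orthogonal:
  fixes d :: "'a::euclidean_space \<Rightarrow> complex"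
  assumes d: "integrable lborel d" and z: "\<And>x. inv_fourier d x = 0"
    and \<phi>: "integrable lborel \<phi>" "continuous_on UNIV \<phi>" "\<And>x. norm (\<phi> x) \<le> C"
  shows "(LINT \<zeta>|lborel. d \<zeta> * \<phi> \<zeta>) = 0"
proof -
  have [measurable]: "d \<in> borel_measurable borel" "\<phi> \<in> borel_measurable borel" using d \<phi> by auto
  define \<epsilon> where "\<epsilon> n = inverse (real (Suc n))" for n
  have e: "\<epsilon> n > 0" "\<epsilon> \<longlonglongrightarrow> 0" for n
    unfolding \<epsilon>_def using LIMSEQ_inverse_real_of_nat by auto
  have [measurable]: "smooth \<epsilon> \<phi> \<in> borel_measurable borel" for \<epsilon>
    unfolding smooth_def[abs_def] by measurable
  have "(\<lambda>n. LINT \<zeta>|lborel. d \<zeta> * smooth (\<epsilon> n) \<phi> \<zeta>) \<longlonglongrightarrow> (LINT \<zeta>|lborel. d \<zeta> * \<phi> \<zeta>)"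
  proof (rule integral_dominated_convergence[where w="\<lambda>\<zeta>. norm (d \<zeta>) * C"])
    show "AE \<zeta> in lborel. (\<lambda>n. d \<zeta> * smooth (\<epsilon> n) \<phi> \<zeta>) \<longlonglongrightarrow> d \<zeta> * \<phi> \<zeta>"
      using \<phi>(2) by (intro AE_I2 tendsto_mult tendsto_const smooth_tendsto[OF _ _ \<phi>(3) e(2)])
        (auto simp: continuous_on_eq_continuous_at)
    show "AE \<zeta> in lborel. norm (d \<zeta> * smooth (\<epsilon> n) \<phi> \<zeta>) \<le> norm (d \<zeta>) * C" for n
      using norm_smooth_le[OF \<open>\<phi> \<in> borel_measurable borel\<close> \<phi>(3)]
      by (auto simp: norm_mult intro!: mult_left_mono)
    show "integrable lborel (\<lambda>\<zeta>. norm (d \<zeta>) * C)" using d by simp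
  qed measurable
  then show ?thesis
    by (simp add: inv_fourier_zero_imp_smooth_orthogonal[OF d z \<phi>(1) e(1)] LIMSEQ_const_iff)
qed


text \<open>Closed sets are stable under intersection and generate the Borel sets, so the vanishing
  spreads to all Borel sets. For complements, the integral over the whole space is 0 because that
  space is closed.\<close>

lemma AE_zero_of_closed_integrals:
  fixes d :: "'a::euclidean_space \<Rightarrow> real"
  assumes d: "integrable lborel d" and z: "\<And>C. closed C \<Longrightarrow> (LINT x:C|lborel. d x) = 0"
  shows "AE x in lborel. d x = 0"
proof -
  have si: "set_integrable lborel A d" if "A \<in> sets borel" for A
    unfolding set_integrable_def using that d by (intro integrable_mult_indicator) auto
  have "(LINT x:A|lborel. d x) = 0" if "A \<in> sets borel" for A
  proof -
    have "A \<in> sigma_sets UNIV {C. closed C}"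
      using that by (simp add: borel_eq_closed sets_measure_of)
    moreover have "Int_stable {C :: 'a set. closed C}" "{C :: 'a set. closed C} \<subseteq> Pow UNIV"
      by (auto simp: Int_stable_def)
    ultimately show ?thesis
    proof -
      assume A: "A \<in> sigma_sets UNIV {C. closed C}" and G: "Int_stable {C :: 'a set. closed C}"
        "{C :: 'a set. closed C} \<subseteq> Pow UNIV"
      from G A show ?thesis
      proof (induction rule: sigma_sets_induct_disjoint)
      case (compl A)
      have A: "A \<in> sets borel" using compl(1) by (simp add: borel_eq_closed sets_measure_of)
      have "(LINT x:A \<union> (UNIV - A)|lborel. d x) = (LINT x:A|lborel. d x) + (LINT x:(UNIV - A)|lborel. d x)"
        using A by (intro set_integral_Un si) auto
      then show ?case using compl(2) z[of UNIV] by simp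
    next
      case (union A)
      have A: "A i \<in> sets borel" for i using union(2) by (auto simp: borel_eq_closed sets_measure_of)
      have "(LINT x:(\<Union>i. A i)|lborel. d x) = (\<Sum>i. (LINT x:(A i)|lborel. d x))"
        using A union(1) by (intro lebesgue_integral_countable_add si) (auto simp: disjoint_family_on_def)
      then show ?case using union(3) by simp
      qed (use z in \<open>simp_all add: set_lebesgue_integral_def\<close>)
    qed
  qed
  then have "AE x in lborel. d x = (\<lambda>_. 0) x"
    by (intro density_unique_real d) (auto simp: set_lebesgue_integral_def)
  then show ?thesis by simp
qed

lemma inv_fourier_injective:
  fixes d :: "'a::euclidean_space \<Rightarrow> complex"
  assumes d: "integrable lborel d" and z: "\<And>x. inv_fourier d x = 0"
  shows "AE x in lborel. d x = 0"
proof -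
  have [measurable]: "d \<in> borel_measurable borel" using d by auto
  have cl: "(LINT x|lborel. indicator C x *\<^sub>R d x) = 0" if C: "closed C" for C :: "'a set"
  proof (cases "C = {}")
    case False
    \<comment> \<open>Continuous functions between 0 and 1 that tend to the indicator of
      \<open>C\<close>: the distance factor is 1 on \<open>C\<close> and eventually 0 off it, and
      the widening Gaussian makes them integrable.\<close>
    define \<phi> where "\<phi> n x = max 0 (1 - real n * infdist x C) * gauss (inverse (real (Suc n)) *\<^sub>R x)" for n x
    have \<phi>01: "0 \<le> \<phi> n x" "\<phi> n x \<le> 1" "\<phi> n x \<le> gauss (inverse (real (Suc n)) *\<^sub>R x)" for n x
    proof -
      have "max 0 (1 - real n * infdist x C) \<le> 1" by (simp add: infdist_nonneg)
      then show "0 \<le> \<phi> n x" "\<phi> n x \<le> 1" "\<phi> n x \<le> gauss (inverse (real (Suc n)) *\<^sub>R x)"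
        unfolding \<phi>_def by (auto intro!: mult_left_le_one_le mult_le_one)
    qed
    have \<phi>c: "continuous_on UNIV (\<phi> n)" for n
      unfolding \<phi>_def by (intro continuous_intros)
    then have [measurable]: "\<phi> n \<in> borel_measurable borel" for n
      by (rule borel_measurable_continuous_onI)
    have \<phi>i: "integrable lborel (\<phi> n)" for n
      by (rule Bochner_Integration.integrable_bound[OF integrable_gauss_scale[of "inverse (real (Suc n))"]])
        (use \<phi>01 in \<open>auto simp del: of_nat_Suc\<close>)
    have "(\<lambda>n. LINT x|lborel. d x * complex_of_real (\<phi> n x)) \<longlonglongrightarrow> (LINT x|lborel. indicator C x *\<^sub>R d x)"
    proof (rule integral_dominated_convergence[where w="\<lambda>x. norm (d x)"])
      show "AE x in lborel. norm (d x * complex_of_real (\<phi> n x)) \<le> norm (d x)" for n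
        using \<phi>01 by (auto simp: norm_mult intro!: mult_right_le_one_le)
      have "(\<lambda>n. \<phi> n x) \<longlonglongrightarrow> indicator C x" for x
      proof (cases "x \<in> C")
        case True
        then show ?thesis
          using gauss_scale_tendsto[OF LIMSEQ_inverse_real_of_nat] by (simp add: \<phi>_def)
      next
        case xC: False
        then have p: "infdist x C > 0"
          using C False by (simp add: infdist_pos_not_in_closed)
        obtain N :: nat where N: "1 < real N * infdist x C" using p reals_Archimedean3 by blast
        have "\<phi> n x = 0" if "n \<ge> N" for n
        proof -
          have "real N * infdist x C \<le> real n * infdist x C" using that p by simp
          then show ?thesis using N by (simp add: \<phi>_def)
        qed
        then have "(\<lambda>n. \<phi> n x) \<longlonglongrightarrow> 0"
          by (intro tendsto_eventually) (auto simp: eventually_sequentially)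
        then show ?thesis using xC by simp
      qed
      then have "(\<lambda>n. d x * complex_of_real (\<phi> n x)) \<longlonglongrightarrow> d x * complex_of_real (indicator C x)" for x
        by (intro tendsto_intros)
      then show "AE x in lborel. (\<lambda>n. d x * complex_of_real (\<phi> n x)) \<longlonglongrightarrow> indicator C x *\<^sub>R d x"
        by (simp add: scaleR_conv_of_real mult.commute)
      show "(\<lambda>x. indicator C x *\<^sub>R d x) \<in> borel_measurable lborel"
        using C by (intro borel_measurable_scaleR borel_measurable_indicator) auto
    qed (use d in auto)
    moreover have "(LINT x|lborel. d x * complex_of_real (\<phi> n x)) = 0" for n
      by (rule inv_fourier_zero_imp_orthogonal[OF d z, where C=1])
        (use \<phi>01 \<phi>i \<phi>c in \<open>auto intro!: continuous_intros\<close>)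
    ultimately show ?thesis by (simp add: LIMSEQ_const_iff)
  qed simp
  have si: "integrable lborel (\<lambda>x. indicator C x *\<^sub>R d x)" if "closed C" for C
    using that d by (intro integrable_mult_indicator) auto
  have "(LINT x:C|lborel. Re (d x)) = 0" "(LINT x:C|lborel. Im (d x)) = 0" if "closed C" for C
    using arg_cong[OF cl[OF that], of Re] arg_cong[OF cl[OF that], of Im] integral_Re[OF si[OF that]] integral_Im[OF si[OF that]]
    unfolding set_lebesgue_integral_def by simp_all
  then have "AE x in lborel. Re (d x) = 0" "AE x in lborel. Im (d x) = 0"
    using d by (auto intro!: AE_zero_of_closed_integrals integrable_Re integrable_Im)
  then show ?thesis by eventually_elim (simp add: complex_eq_iff)
qed

section \<open>The square of a transform as an L^1 limit\<close>

text \<open>Increments summable in L^1 give almost everywhere convergence of the whole sequence and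
  one integrable majorant \<open>G\<close>. The majorant permits further passages to the limit,
  under characters and under the modulus.\<close>

lemma L1_telescoping_limit:
  fixes q :: "nat \<Rightarrow> 'a \<Rightarrow> complex"
  assumes q: "\<And>n. integrable M (q n)"
    and sm: "summable (\<lambda>n. LINT x|M. norm (q (Suc n) x - q n x))"
  obtains s G where "integrable M s" "integrable M G"
    "AE x in M. (\<lambda>n. q n x) \<longlonglongrightarrow> s x" "\<And>n. AE x in M. norm (q n x) \<le> G x"
proof -
  have [measurable]: "q n \<in> borel_measurable M" for n using q by auto
  let ?f = "\<lambda>n x. q (Suc n) x - q n x"
  have f: "integrable M (?f n)" for n using q by simp
  have "(\<integral>\<^sup>+x. (\<Sum>n. ennreal (norm (?f n x))) \<partial>M) = (\<Sum>n. \<integral>\<^sup>+x. ennreal (norm (?f n x)) \<partial>M)"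
    by (rule nn_integral_suminf) measurable
  also have "\<dots> = (\<Sum>n. ennreal (LINT x|M. norm (?f n x)))"
    using f by (intro arg_cong[where f=suminf] ext nn_integral_eq_integral) auto
  also have "\<dots> = ennreal (\<Sum>n. LINT x|M. norm (?f n x))"
    by (rule suminf_ennreal2[OF _ sm]) simp
  finally have fin: "(\<integral>\<^sup>+x. (\<Sum>n. ennreal (norm (?f n x))) \<partial>M) < \<infinity>" by simp
  then have "AE x in M. (\<Sum>n. ennreal (norm (?f n x))) \<noteq> \<infinity>"
    by (intro nn_integral_PInf_AE) auto
  then have sumAE: "AE x in M. summable (\<lambda>n. norm (?f n x))"
    by eventually_elim (rule summable_suminf_not_top; simp)
  define G where "G x = norm (q 0 x) + (\<Sum>n. norm (?f n x))" for x
  define s where "s x = q 0 x + (\<Sum>n. ?f n x)" for x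
  have tel: "q n x = q 0 x + (\<Sum>k<n. ?f k x)" for n x
    by (induction n) auto
  have iS: "integrable M (\<lambda>x. \<Sum>n. ?f n x)" by (rule integrable_suminf[OF f sumAE sm])
  have iN: "integrable M (\<lambda>x. \<Sum>n. norm (?f n x))"
    by (rule integrable_suminf) (use f sumAE sm in auto)
  show ?thesis
  proof
    show "integrable M s" unfolding s_def using q iS by simp
    show "integrable M G" unfolding G_def using q iN by simp
    show "AE x in M. (\<lambda>n. q n x) \<longlonglongrightarrow> s x"
      using sumAE
    proof eventually_elim
      case (elim x)
      have "(\<lambda>n. \<Sum>k<n. ?f k x) \<longlonglongrightarrow> (\<Sum>n. ?f n x)"
        by (rule summable_LIMSEQ[OF summable_norm_cancel[OF elim]])
      then have "(\<lambda>n. q 0 x + (\<Sum>k<n. ?f k x)) \<longlonglongrightarrow> s x"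
        unfolding s_def by (intro tendsto_intros)
      then show ?case by (simp only: tel[symmetric])
    qed
    show "AE x in M. norm (q n x) \<le> G x" for n
      using sumAE
    proof eventually_elim
      case (elim x)
      have "norm (q n x) \<le> norm (q 0 x) + norm (\<Sum>k<n. ?f k x)"
        by (subst tel) (rule norm_triangle_ineq)
      also have "norm (\<Sum>k<n. ?f k x) \<le> (\<Sum>k<n. norm (?f k x))" by (rule norm_sum)
      also have "\<dots> \<le> (\<Sum>k. norm (?f k x))" by (rule sum_le_suminf[OF elim]) auto
      finally show ?case by (simp add: G_def)
    qed
  qed
qed

lemma fourier_add:
  assumes "integrable lborel f" "integrable lborel g"
  shows "fourier (\<lambda>x. f x + g x) \<xi> = fourier f \<xi> + fourier g \<xi>"
    and "fourier (\<lambda>x. f x - g x) \<xi> = fourier f \<xi> - fourier g \<xi>"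
proof -
  have "integrable lborel (\<lambda>x. f x * cis (- 2 * pi * (x \<bullet> \<xi>)))" if "integrable lborel f" for f
    by (rule Bochner_Integration.integrable_bound[OF that]) (use that in \<open>auto simp: norm_mult\<close>)
  note i = this[OF assms(1)] this[OF assms(2)]
  show "fourier (\<lambda>x. f x + g x) \<xi> = fourier f \<xi> + fourier g \<xi>"
    using Bochner_Integration.integral_add[OF i] by (simp add: fourier_cis distrib_right)
  show "fourier (\<lambda>x. f x - g x) \<xi> = fourier f \<xi> - fourier g \<xi>"
    using Bochner_Integration.integral_diff[OF i] by (simp add: fourier_cis left_diff_distrib)
qed

lemma continuous_AE_zero:
  fixes f :: "'a::euclidean_space \<Rightarrow> real"
  assumes c: "continuous_on UNIV f" and z: "AE x in lborel. f x = 0"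
  shows "f x = 0"
proof (rule ccontr)
  assume x: "f x \<noteq> 0"
  have o: "open {x. f x \<noteq> 0}" using c by (intro open_Collect_neq) (auto intro!: continuous_intros)
  have "{x. f x \<noteq> 0} \<in> null_sets lborel"
    using z o by (subst AE_iff_null_sets) auto
  then have "negligible {x. f x \<noteq> 0}"
    using null_sets_completionI by (simp add: negligible_iff_null_sets)
  then show False using open_not_negligible[OF o] x by auto
qed


lemma square_diff_integral_le:
  fixes f g h :: "'a \<Rightarrow> real"
  assumes [measurable]: "f \<in> borel_measurable M" "g \<in> borel_measurable M" "h \<in> borel_measurable M"
    and i: "integrable M (\<lambda>x. (f x - h x)\<^sup>2)" "integrable M (\<lambda>x. (g x - h x)\<^sup>2)"
  shows "integrable M (\<lambda>x. (f x - g x)\<^sup>2)"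
    and "(LINT x|M. (f x - g x)\<^sup>2) \<le> 2 * (LINT x|M. (f x - h x)\<^sup>2) + 2 * (LINT x|M. (g x - h x)\<^sup>2)"
proof -
  have le: "(f x - g x)\<^sup>2 \<le> 2 * (f x - h x)\<^sup>2 + 2 * (g x - h x)\<^sup>2" for x
    using sum_squares_bound[of "f x - h x" "h x - g x"] by (simp add: power2_eq_square algebra_simps)
  have i2: "integrable M (\<lambda>x. 2 * (f x - h x)\<^sup>2 + 2 * (g x - h x)\<^sup>2)" using i by simp
  show i3: "integrable M (\<lambda>x. (f x - g x)\<^sup>2)"
    by (rule Bochner_Integration.integrable_bound[OF i2]) (use le in \<open>auto intro: order_trans[OF _ abs_ge_self]\<close>)
  show "(LINT x|M. (f x - g x)\<^sup>2) \<le> 2 * (LINT x|M. (f x - h x)\<^sup>2) + 2 * (LINT x|M. (g x - h x)\<^sup>2)"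
    using integral_mono[OF i3 i2 le] i by simp
qed

text \<open>With \<open>p\<close> the transform of \<open>r\<close>, one has \<open>p\<^sup>2 = v \<ge> 0\<close>, so that \<open>\<integral>r\<^sup>2 = \<integral>\<bar>p\<bar>\<^sup>2 = \<integral>v = \<rho> 0 = \<integral>r (- y) r y\<close>,
  which is equality in Cauchy--Schwarz. As \<open>r\<close> need not be integrable, \<open>p\<^sup>2\<close> is obtained as an
  \<open>L\<^sup>1\<close> limit along Gaussian truncations of \<open>r\<close>.\<close>

lemma convolution_square_root_symmetric:
  fixes r \<rho> v :: "'a::euclidean_space \<Rightarrow> real"
  assumes cont: "continuous_on UNIV r" and C: "\<And>x. \<bar>r x\<bar> \<le> C" and r2: "integrable lborel (\<lambda>x. (r x)\<^sup>2)"
    and \<rho>: "\<And>x. \<rho> x = fun_conv r r x"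
    and v: "integrable lborel v" "\<And>\<xi>. 0 \<le> v \<xi>"
    and inv: "\<And>x. complex_of_real (\<rho> x) = inv_fourier (\<lambda>\<xi>. complex_of_real (v \<xi>)) x"
  shows "r (- x) = r x"
proof -
  have rm[measurable]: "r \<in> borel_measurable borel" using cont by (rule borel_measurable_continuous_onI)
  have [measurable]: "v \<in> borel_measurable borel" using v by auto
  \<comment> \<open>Cut-offs of growing width: the products \<open>w k\<close> with \<open>r\<close>
    are continuous, integrable and dominated by \<open>\<bar>r\<bar>\<close>.\<close>
  define g where "g k x = gauss (inverse (real (Suc k)) *\<^sub>R (x::'a))" for k x
  have g01: "0 \<le> g k x" "g k x \<le> 1" and gc: "continuous_on UNIV (g k)" for k x
    by (auto simp: g_def intro!: continuous_intros)
  have gi: "integrable lborel (g k)" for k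
    unfolding g_def by (rule integrable_gauss_scale) simp
  have glim: "(\<lambda>k. g k x) \<longlonglongrightarrow> 1" for x
    unfolding g_def by (rule gauss_scale_tendsto[OF LIMSEQ_inverse_real_of_nat])
  define w where "w k x = r x * g k x" for k x
  have wc: "continuous_on UNIV (w k)" for k
    unfolding w_def by (intro continuous_intros cont gc)
  then have [measurable]: "w k \<in> borel_measurable borel" for k by (rule borel_measurable_continuous_onI)
  have wr: "\<bar>w k x\<bar> \<le> \<bar>r x\<bar>" for k x
    using g01[of k x] by (simp add: w_def abs_mult mult_right_le_one_le)
  then have wC: "\<bar>w k x\<bar> \<le> C" for k x using C order_trans by blast
  have wlim: "(\<lambda>k. w k x) \<longlonglongrightarrow> r x" for x
    unfolding w_def using tendsto_mult[OF tendsto_const glim, of "r x" x] by simp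
  have C0: "0 \<le> C" using C[of 0] by linarith
  have wi: "integrable lborel (w k)" for k
  proof (rule Bochner_Integration.integrable_bound)
    show "integrable lborel (\<lambda>x. C * g k x)" using gi by simp
    show "AE x in lborel. norm (w k x) \<le> norm (C * g k x)"
      using C g01 C0 by (auto simp: w_def abs_mult intro!: mult_right_mono)
  qed measurable
  have wr2: "(w k x - r x)\<^sup>2 \<le> (r x)\<^sup>2" for k x
  proof -
    have "w k x - r x = r x * (g k x - 1)" by (simp add: w_def algebra_simps)
    moreover have "\<bar>g k x - 1\<bar> \<le> 1" using g01[of k x] by linarith
    ultimately have "\<bar>w k x - r x\<bar> \<le> \<bar>r x\<bar>" by (simp add: abs_mult mult_right_le_one_le)
    then show ?thesis by (simp add: abs_le_square_iff)
  qed
  have w2: "(w k x)\<^sup>2 \<le> (r x)\<^sup>2" for k x using wr by (simp add: abs_le_square_iff)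
  have wri: "integrable lborel (\<lambda>x. (w k x - r x)\<^sup>2)" for k
    by (rule Bochner_Integration.integrable_bound[OF r2]) (use wr2 in auto)
  have "(\<lambda>k. LINT x|lborel. (w k x - r x)\<^sup>2) \<longlonglongrightarrow> (LINT x|lborel. (\<lambda>_::'a. 0::real) x)"
  proof (rule integral_dominated_convergence[OF _ _ r2])
    show "AE x in lborel. (\<lambda>k. (w k x - r x)\<^sup>2) \<longlonglongrightarrow> 0"
    proof (rule AE_I2)
      fix x
      have "(\<lambda>k. (w k x - r x)\<^sup>2) \<longlonglongrightarrow> (r x - r x)\<^sup>2" by (intro tendsto_intros wlim)
      then show "(\<lambda>k. (w k x - r x)\<^sup>2) \<longlonglongrightarrow> 0" by simp
    qed
  qed (use wr2 in auto)
  then have \<delta>: "(\<lambda>k. LINT x|lborel. (w k x - r x)\<^sup>2) \<longlonglongrightarrow> 0" by simp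
  \<comment> \<open>The rate \<open>(1/4)^n\<close> for squared norms makes the L^2 distances of
    order \<open>(1/2)^n\<close>, hence the L^1 increments of \<open>q\<close> summable.\<close>
  have "\<exists>k\<ge>n. (LINT x|lborel. (w k x - r x)\<^sup>2) \<le> (1/4)^n" for n :: nat
  proof -
    have "\<forall>\<^sub>F k in sequentially. (LINT x|lborel. (w k x - r x)\<^sup>2) < (1/4)^n"
      by (rule order_tendstoD(2)[OF \<delta>]) simp
    then obtain N where N: "\<And>k. k \<ge> N \<Longrightarrow> (LINT x|lborel. (w k x - r x)\<^sup>2) < (1/4)^n"
      by (auto simp: eventually_sequentially)
    show ?thesis by (rule exI[of _ "max n N"]) (use N[of "max n N"] in auto)
  qed
  then obtain \<kappa> where \<kappa>: "\<And>n. \<kappa> n \<ge> n" "\<And>n. (LINT x|lborel. (w (\<kappa> n) x - r x)\<^sup>2) \<le> (1/4)^n"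
    by metis
  have \<kappa>lim: "filterlim \<kappa> sequentially sequentially"
    by (rule filterlim_at_top_mono[OF filterlim_ident]) (use \<kappa> in auto)
  have wlim': "(\<lambda>n. w (\<kappa> n) x) \<longlonglongrightarrow> r x" for x
    using filterlim_compose[OF wlim \<kappa>lim] .
  define W where "W n x = complex_of_real (w (\<kappa> n) x)" for n x
  have Wi: "integrable lborel (W n)" for n unfolding W_def using wi by simp
  define p where "p n = fourier (W n)" for n
  have [measurable]: "p n \<in> borel_measurable borel" for n
    unfolding p_def W_def by measurable
  define q where "q n \<xi> = p n \<xi> * p n \<xi>" for n \<xi>
  define R where "R = (LINT x|lborel. (r x)\<^sup>2)"
  have pl: "integrable lborel (\<lambda>\<xi>. (norm (p n \<xi>))\<^sup>2)"
      "(LINT \<xi>|lborel. (norm (p n \<xi>))\<^sup>2) = (LINT x|lborel. (w (\<kappa> n) x)\<^sup>2)" for n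
    using plancherel[OF wi wc wC] unfolding p_def W_def by auto
  have qi: "integrable lborel (q n)" for n
    unfolding q_def by (intro mult_integrable_of_squares pl) measurable
  \<comment> \<open>A difference of squares factors into \<open>p (Suc n) - p n\<close>, small in
    L^2, and \<open>p (Suc n) + p n\<close>, bounded in L^2; Plancherel's identity expresses both
    norms through the truncations of \<open>r\<close>.\<close>
  have qbound: "(LINT \<xi>|lborel. norm (q (Suc n) \<xi> - q n \<xi>)) \<le> (4 + 2 * R) * (1/2)^n" for n
  proof -
    let ?a = "w (\<kappa> (Suc n))" and ?b = "w (\<kappa> n)"
    have bd: "\<bar>?a x - ?b x\<bar> \<le> 2 * C" "\<bar>?a x + ?b x\<bar> \<le> 2 * C" for x
      using wC[of "\<kappa> (Suc n)" x] wC[of "\<kappa> n" x] by linarith+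
    have "fourier (\<lambda>x. complex_of_real (?a x - ?b x)) \<xi> = p (Suc n) \<xi> - p n \<xi>"
        "fourier (\<lambda>x. complex_of_real (?a x + ?b x)) \<xi> = p (Suc n) \<xi> + p n \<xi>" for \<xi>
      using fourier_add[OF Wi[of "Suc n"] Wi[of n], of \<xi>] by (simp_all add: p_def W_def)
    then have D: "integrable lborel (\<lambda>\<xi>. (norm (p (Suc n) \<xi> - p n \<xi>))\<^sup>2)"
        "(LINT \<xi>|lborel. (norm (p (Suc n) \<xi> - p n \<xi>))\<^sup>2) = (LINT x|lborel. (?a x - ?b x)\<^sup>2)"
      and S: "integrable lborel (\<lambda>\<xi>. (norm (p (Suc n) \<xi> + p n \<xi>))\<^sup>2)"
        "(LINT \<xi>|lborel. (norm (p (Suc n) \<xi> + p n \<xi>))\<^sup>2) = (LINT x|lborel. (?a x + ?b x)\<^sup>2)"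
      using plancherel[of "\<lambda>x. ?a x - ?b x" "2 * C"] plancherel[of "\<lambda>x. ?a x + ?b x" "2 * C"]
        wi wc bd by (simp_all add: continuous_on_diff continuous_on_add)
    have D4: "(LINT x|lborel. (?a x - ?b x)\<^sup>2) \<le> 4 * (1/4)^n"
    proof -
      have "(LINT x|lborel. (?a x - ?b x)\<^sup>2) \<le> 2 * (1/4)^(Suc n) + 2 * (1/4)^n"
        using square_diff_integral_le(2)[of ?a lborel ?b r, OF _ _ _ wri wri] \<kappa>(2)[of "Suc n"] \<kappa>(2)[of n] by simp
      also have "\<dots> \<le> 4 * (1/4)^n" by simp
      finally show ?thesis .
    qed
    have S4: "(LINT x|lborel. (?a x + ?b x)\<^sup>2) \<le> 4 * R"
    proof -
      have le: "(?a x + ?b x)\<^sup>2 \<le> 4 * (r x)\<^sup>2" for x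
      proof -
        have "\<bar>?a x + ?b x\<bar> \<le> \<bar>2 * r x\<bar>" using wr[of "\<kappa> (Suc n)" x] wr[of "\<kappa> n" x] by linarith
        then have "(?a x + ?b x)\<^sup>2 \<le> (2 * r x)\<^sup>2" by (simp only: abs_le_square_iff)
        then show ?thesis by (simp add: power_mult_distrib)
      qed
      have i4: "integrable lborel (\<lambda>x. 4 * (r x)\<^sup>2)" using r2 by simp
      have "integrable lborel (\<lambda>x. (?a x + ?b x)\<^sup>2)"
        by (rule Bochner_Integration.integrable_bound[OF i4]) (use le in auto)
      from integral_mono[OF this i4 le] show ?thesis by (simp add: R_def)
    qed
    \<comment> \<open>The weight in
      \<open>2 * ?u * ?t \<le> l * ?u\<^sup>2 + ?t\<^sup>2 / l\<close>: it balances a squared norm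
      of order \<open>1 / l\<^sup>2\<close> against a bounded one. The bounds \<open>D4\<close> and
      \<open>S4\<close> then contribute \<open>2 / l\<close> and \<open>2 * R / l\<close>.\<close>
    define l :: real where "l = 2 ^ n"
    have l: "l > 0" "(1/2)^n = 1 / l" "(1/4)^n = 1 / (l * l)"
      by (auto simp: l_def power_divide power_mult_distrib[symmetric])
    have le: "norm (q (Suc n) \<xi> - q n \<xi>) \<le>
        l / 2 * (norm (p (Suc n) \<xi> - p n \<xi>))\<^sup>2 + 1 / (2 * l) * (norm (p (Suc n) \<xi> + p n \<xi>))\<^sup>2" for \<xi>
    proof -
      let ?u = "norm (p (Suc n) \<xi> - p n \<xi>)" and ?t = "norm (p (Suc n) \<xi> + p n \<xi>)"
      have "q (Suc n) \<xi> - q n \<xi> = (p (Suc n) \<xi> - p n \<xi>) * (p (Suc n) \<xi> + p n \<xi>)"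
        by (simp add: q_def algebra_simps)
      then have n: "norm (q (Suc n) \<xi> - q n \<xi>) = ?u * ?t" by (simp add: norm_mult)
      have "2 * (l * ?u) * ?t \<le> (l * ?u)\<^sup>2 + ?t\<^sup>2" by (rule sum_squares_bound)
      then have "2 * l * (?u * ?t) \<le> 2 * l * (l / 2 * ?u\<^sup>2 + 1 / (2 * l) * ?t\<^sup>2)"
        using l(1) by (simp add: power_mult_distrib power2_eq_square algebra_simps)
      then show ?thesis using l(1) n by simp
    qed
    have "(LINT \<xi>|lborel. norm (q (Suc n) \<xi> - q n \<xi>)) \<le>
       (LINT \<xi>|lborel. l / 2 * (norm (p (Suc n) \<xi> - p n \<xi>))\<^sup>2 + 1 / (2 * l) * (norm (p (Suc n) \<xi> + p n \<xi>))\<^sup>2)"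
      using qi D(1) S(1) by (intro integral_mono le) auto
    also have "\<dots> = l / 2 * (LINT x|lborel. (?a x - ?b x)\<^sup>2) + 1 / (2 * l) * (LINT x|lborel. (?a x + ?b x)\<^sup>2)"
      using D S by simp
    also have "\<dots> \<le> l / 2 * (4 * (1/4)^n) + 1 / (2 * l) * (4 * R)"
      using l(1) D4 S4 by (intro add_mono mult_left_mono) auto
    also have "\<dots> = (2 + 2 * R) * (1/2)^n" unfolding l using l(1) by (simp add: field_simps)
    also have "\<dots> \<le> (4 + 2 * R) * (1/2)^n" by (intro mult_right_mono) auto
    finally show ?thesis .
  qed
  have sm: "summable (\<lambda>n. LINT \<xi>|lborel. norm (q (Suc n) \<xi> - q n \<xi>))"
  proof (rule summable_comparison_test')
    show "summable (\<lambda>n. (4 + 2 * R) * (1/2)^n)" by (intro summable_mult summable_geometric) simp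
    show "norm (LINT \<xi>|lborel. norm (q (Suc n) \<xi> - q n \<xi>)) \<le> (4 + 2 * R) * (1/2)^n" if "n \<ge> 0" for n
      using qbound[of n] by (simp add: integral_nonneg_AE)
  qed
  obtain s G where s: "integrable lborel s" and G: "integrable lborel G"
    and qs: "AE \<xi> in lborel. (\<lambda>n. q n \<xi>) \<longlonglongrightarrow> s \<xi>" and qG: "\<And>n. AE \<xi> in lborel. norm (q n \<xi>) \<le> G \<xi>"
    by (rule L1_telescoping_limit[OF qi sm]) iprover
  have [measurable]: "s \<in> borel_measurable borel" "G \<in> borel_measurable borel"
      "q n \<in> borel_measurable borel" for n using s G qi by auto
  \<comment> \<open>The inverse transform of \<open>q n\<close> is the self-convolution of the
    truncation, which tends to \<open>\<rho> x\<close> under the majorant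
    \<open>\<bar>r (x - y) * r y\<bar>\<close>.\<close>
  have invs: "inv_fourier s x = complex_of_real (\<rho> x)" for x
  proof (rule LIMSEQ_unique)
    show "(\<lambda>n. inv_fourier (q n) x) \<longlonglongrightarrow> inv_fourier s x"
      unfolding inv_fourier_def
    proof (rule integral_dominated_convergence[OF _ _ G])
      show "AE \<xi> in lborel. (\<lambda>n. cis (2 * pi * (x \<bullet> \<xi>)) * q n \<xi>) \<longlonglongrightarrow> cis (2 * pi * (x \<bullet> \<xi>)) * s \<xi>"
        using qs by eventually_elim (intro tendsto_intros)
      show "AE \<xi> in lborel. norm (cis (2 * pi * (x \<bullet> \<xi>)) * q n \<xi>) \<le> G \<xi>" for n
        using qG[of n] by eventually_elim (simp add: norm_mult)
    qed measurable
    have "inv_fourier (q n) x = cconv (W n) (W n) x" for n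
    proof -
      have "norm (W n x) \<le> C" "continuous_on UNIV (W n)" for x
        using wC wc by (auto simp: W_def intro!: continuous_intros)
      moreover have qf: "q n = (\<lambda>\<xi>. fourier (W n) \<xi> * fourier (W n) \<xi>)"
        by (simp add: q_def p_def fun_eq_iff)
      ultimately show ?thesis
        using cconv_inversion(1)[OF Wi _ _ Wi, of n C n x] qi[of n] unfolding qf by simp
    qed
    also have "cconv (W n) (W n) x = complex_of_real (LINT y|lborel. w (\<kappa> n) (x - y) * w (\<kappa> n) y)" for n
      by (simp add: cconv_def W_def flip: integral_complex_of_real)
    finally have e: "inv_fourier (q n) x = complex_of_real (LINT y|lborel. w (\<kappa> n) (x - y) * w (\<kappa> n) y)" for n .
    have "(\<lambda>n. LINT y|lborel. w (\<kappa> n) (x - y) * w (\<kappa> n) y) \<longlonglongrightarrow> (LINT y|lborel. r (x - y) * r y)"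
    proof (rule integral_dominated_convergence[where w="\<lambda>y. \<bar>r (x - y) * r y\<bar>"])
      have "integrable lborel (\<lambda>y. (norm (complex_of_real (r (x - y))))\<^sup>2)"
        using lborel_integrable_affine[OF r2, of "-1" x] by simp
      then have "integrable lborel (\<lambda>y. complex_of_real (r (x - y)) * complex_of_real (r y))"
        using r2 by (intro mult_integrable_of_squares) auto
      then show "integrable lborel (\<lambda>y. \<bar>r (x - y) * r y\<bar>)"
        using integrable_norm by (fastforce simp: norm_mult abs_mult)
      show "AE y in lborel. (\<lambda>n. w (\<kappa> n) (x - y) * w (\<kappa> n) y) \<longlonglongrightarrow> r (x - y) * r y"
        by (intro AE_I2 tendsto_mult wlim')
      show "AE y in lborel. norm (w (\<kappa> n) (x - y) * w (\<kappa> n) y) \<le> \<bar>r (x - y) * r y\<bar>" for n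
        using wr by (auto simp: abs_mult intro!: mult_mono)
    qed measurable
    then show "(\<lambda>n. inv_fourier (q n) x) \<longlonglongrightarrow> complex_of_real (\<rho> x)"
      unfolding e \<rho> fun_conv_def by (rule tendsto_of_real)
  qed
  have "AE \<xi> in lborel. s \<xi> - complex_of_real (v \<xi>) = 0"
  proof (rule inv_fourier_injective)
    have vi: "integrable lborel (\<lambda>\<xi>. complex_of_real (v \<xi>))" using v by simp
    have i: "integrable lborel (\<lambda>\<xi>. cis (2 * pi * (x \<bullet> \<xi>)) * f \<xi>)" if "integrable lborel f" for f x
      by (rule Bochner_Integration.integrable_bound[OF that]) (use that in \<open>auto simp: norm_mult\<close>)
    show "integrable lborel (\<lambda>\<xi>. s \<xi> - complex_of_real (v \<xi>))" using s vi by simp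
    show "inv_fourier (\<lambda>\<xi>. s \<xi> - complex_of_real (v \<xi>)) x = 0" for x
      using Bochner_Integration.integral_diff[OF i[OF s, of x] i[OF vi, of x]] invs[of x] inv[of x]
      by (simp add: inv_fourier_def right_diff_distrib)
  qed
  then have sv: "AE \<xi> in lborel. s \<xi> = complex_of_real (v \<xi>)" by eventually_elim simp
  \<comment> \<open>Plancherel's identity for the truncations passes to the limit. Since
    \<open>s\<close> agrees with the nonnegative \<open>v\<close>, the integral of its modulus is
    the inverse transform at 0.\<close>
  have R\<rho>: "R = \<rho> 0"
  proof (rule LIMSEQ_unique)
    show "(\<lambda>n. LINT x|lborel. (w (\<kappa> n) x)\<^sup>2) \<longlonglongrightarrow> R"
      unfolding R_def
      by (rule integral_dominated_convergence[OF _ _ r2]) (use w2 in \<open>auto intro!: tendsto_intros wlim'\<close>)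
    have "(\<lambda>n. LINT \<xi>|lborel. norm (q n \<xi>)) \<longlonglongrightarrow> (LINT \<xi>|lborel. norm (s \<xi>))"
    proof (rule integral_dominated_convergence[OF _ _ G])
      show "AE \<xi> in lborel. (\<lambda>n. norm (q n \<xi>)) \<longlonglongrightarrow> norm (s \<xi>)"
        using qs by eventually_elim (rule tendsto_norm)
    qed (use qG in auto)
    moreover have "(LINT \<xi>|lborel. norm (q n \<xi>)) = (LINT x|lborel. (w (\<kappa> n) x)\<^sup>2)" for n
      using pl(2)[of n] by (simp add: q_def norm_mult power2_eq_square)
    moreover have "(LINT \<xi>|lborel. norm (s \<xi>)) = (LINT \<xi>|lborel. v \<xi>)"
      by (rule integral_cong_AE) (use sv v in \<open>auto\<close>)
    moreover have "(LINT \<xi>|lborel. v \<xi>) = \<rho> 0"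
      using inv[of 0] by (simp add: inv_fourier_def)
    ultimately show "(\<lambda>n. LINT x|lborel. (w (\<kappa> n) x)\<^sup>2) \<longlonglongrightarrow> \<rho> 0" by simp
  qed
  have r2': "integrable lborel (\<lambda>y. (r (- y))\<^sup>2)" "(LINT y|lborel. (r (- y))\<^sup>2) = R"
    using lborel_integrable_affine[OF r2, of "-1" 0] lborel_integral_uminus_translate[of "\<lambda>x. (r x)\<^sup>2" 0]
    by (simp_all add: R_def)
  have rr: "integrable lborel (\<lambda>y. r (- y) * r y)"
  proof -
    have "integrable lborel (\<lambda>y. complex_of_real (r (- y)) * complex_of_real (r y))"
      using r2 r2' by (intro mult_integrable_of_squares) auto
    then show ?thesis by (simp only: of_real_mult[symmetric] complex_of_real_integrable_eq)
  qed
  have eq: "(r (- y) - r y)\<^sup>2 = (r (- y))\<^sup>2 + (r y)\<^sup>2 - 2 * (r (- y) * r y)" for y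
    by (simp add: power2_eq_square algebra_simps)
  have int: "integrable lborel (\<lambda>y. (r (- y) - r y)\<^sup>2)" unfolding eq using r2 r2' rr by simp
  \<comment> \<open>The cross term is the integral of \<open>r (- y) * r y\<close>, which is
    \<open>fun_conv r r 0\<close>, that is \<open>\<rho> 0\<close>.\<close>
  have "(LINT y|lborel. (r (- y) - r y)\<^sup>2) = 2 * R - 2 * \<rho> 0"
    unfolding eq using r2 r2' rr by (simp add: R_def \<rho> fun_conv_def)
  then have "(LINT y|lborel. (r (- y) - r y)\<^sup>2) = 0" using R\<rho> by simp
  then have "AE y in lborel. (r (- y) - r y)\<^sup>2 = 0"
    using integral_nonneg_eq_0_iff_AE[OF int] by simp
  then have "AE y in lborel. r (- y) - r y = 0" by eventually_elim simp
  then have "r (- x) - r x = 0"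
    by (intro continuous_AE_zero[of "\<lambda>y. r (- y) - r y"])
      (auto intro!: continuous_intros continuous_on_compose2[OF cont])
  then show ?thesis by simp
qed

section \<open>Convolution operators on measures\<close>


lemma C0_imp_continuous_on: "f \<in> C0 \<Omega> \<Longrightarrow> continuous_on \<Omega> f"
  unfolding C0_def Cc_def by (auto intro: uniform_limit_theorem[OF always_eventually] simp: trivial_limit_sequentially)

lemma C0_imp_vanishing:
  assumes "f \<in> C0 \<Omega>" "e > 0"
  shows "\<exists>K. compact K \<and> K \<subseteq> \<Omega> \<and> (\<forall>x\<in>\<Omega> - K. \<bar>f x\<bar> < e)"
proof -
  obtain g where g: "\<And>k::nat. g k \<in> Cc \<Omega>" "uniform_limit \<Omega> g f sequentially"
    using assms by (auto simp: C0_def)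
  have "\<forall>\<^sub>F k in sequentially. \<forall>x\<in>\<Omega>. dist (g k x) (f x) < e"
    using g(2) assms(2) by (rule uniform_limitD)
  then obtain k where k: "\<And>x. x \<in> \<Omega> \<Longrightarrow> dist (g k x) (f x) < e"
    by (auto simp: eventually_sequentially)
  obtain K where K: "compact K" "K \<subseteq> \<Omega>" "\<And>x. x \<in> \<Omega> - K \<Longrightarrow> g k x = 0"
    using g(1)[of k] by (auto simp: Cc_def)
  have "\<bar>f x\<bar> < e" if "x \<in> \<Omega> - K" for x
    using k[of x] K(3)[of x] that by (simp add: dist_real_def)
  then show ?thesis using K(1,2) by blast
qed

lemma C0_imp_bounded:
  assumes "f \<in> C0 \<Omega>"
  shows "\<exists>C. \<forall>x\<in>\<Omega>. \<bar>f x\<bar> \<le> C"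
proof -
  obtain K where K: "compact K" "K \<subseteq> \<Omega>" "\<And>x. x \<in> \<Omega> - K \<Longrightarrow> \<bar>f x\<bar> < 1"
    using C0_imp_vanishing[OF assms zero_less_one] by auto
  have "compact (f ` K)"
    by (rule compact_continuous_image[OF continuous_on_subset[OF C0_imp_continuous_on[OF assms] K(2)] K(1)])
  then obtain C where C: "\<forall>x\<in>K. \<bar>f x\<bar> \<le> C"
    by (auto dest!: compact_imp_bounded simp: bounded_iff)
  show ?thesis
  proof (intro exI ballI)
    fix x assume "x \<in> \<Omega>"
    then show "\<bar>f x\<bar> \<le> max C 1"
      using C K(3)[of x] by (cases "x \<in> K") auto
  qed
qed

lemma C0_imp_bdd_meas: "f \<in> C0 \<Omega> \<Longrightarrow> bdd_meas \<Omega> f"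
  unfolding bdd_meas_def
  by (auto intro: borel_measurable_continuous_on_restrict C0_imp_continuous_on C0_imp_bounded)

text \<open>Closedness of \<open>\<Omega>\<close> makes its intersection with a ball compact, so
  that cut-offs of \<open>f\<close> belong to \<open>Cc \<Omega>\<close>.\<close>

lemma C0I:
  fixes f :: "'a::euclidean_space \<Rightarrow> real"
  assumes cl: "closed \<Omega>" and f: "continuous_on \<Omega> f"
    and v: "\<And>e. e > 0 \<Longrightarrow> \<exists>R. \<forall>x\<in>\<Omega>. norm x > R \<longrightarrow> \<bar>f x\<bar> < e"
  shows "f \<in> C0 \<Omega>"
proof -
  \<comment> \<open>Equal to 1 on the ball of radius \<open>k\<close>, to 0 outside the ball of
    radius \<open>k + 1\<close>, and continuous.\<close>
  define c where "c k x = max 0 (min 1 (real k + 1 - norm x))" for k and x :: 'a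
  have c01: "0 \<le> c k x" "c k x \<le> 1" for k x by (auto simp: c_def)
  have Cc: "(\<lambda>x. c k x * f x) \<in> Cc \<Omega>" for k
  proof -
    have "continuous_on \<Omega> (\<lambda>x. c k x * f x)"
      unfolding c_def by (intro continuous_intros f)
    moreover have "compact (\<Omega> \<inter> cball 0 (real k + 1))" using cl by (intro closed_Int_compact) auto
    moreover have "c k x * f x = 0" if "x \<in> \<Omega> - (\<Omega> \<inter> cball 0 (real k + 1))" for x
      using that by (auto simp: c_def)
    ultimately show ?thesis unfolding Cc_def by blast
  qed
  have "uniform_limit \<Omega> (\<lambda>k x. c k x * f x) f sequentially"
  proof (rule uniform_limitI)
    fix e :: real assume "e > 0"
    then obtain R where R: "\<And>x. x \<in> \<Omega> \<Longrightarrow> norm x > R \<Longrightarrow> \<bar>f x\<bar> < e" using v by blast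
    obtain N :: nat where N: "R < real N" using reals_Archimedean2 by blast
    show "\<forall>\<^sub>F k in sequentially. \<forall>x\<in>\<Omega>. dist (c k x * f x) (f x) < e"
      unfolding eventually_sequentially
    proof (intro exI allI impI ballI)
      fix k x assume k: "N \<le> k" and x: "x \<in> \<Omega>"
      show "dist (c k x * f x) (f x) < e"
      proof (cases "norm x > R")
        case True
        have "c k x * f x - f x = - ((1 - c k x) * f x)" by (simp add: algebra_simps)
        then have "\<bar>c k x * f x - f x\<bar> = (1 - c k x) * \<bar>f x\<bar>"
          using c01[of k x] by (simp add: abs_mult)
        also have "\<dots> \<le> \<bar>f x\<bar>" using c01[of k x] by (intro mult_left_le_one_le) auto
        finally show ?thesis using R[OF x True] by (simp add: dist_real_def)
      next
        case False
        then have "c k x = 1" using N k by (simp add: c_def)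
        then show ?thesis using \<open>e > 0\<close> by simp
      qed
    qed
  qed
  then show ?thesis
    unfolding C0_def using Cc by (intro CollectI exI[of _ "\<lambda>k x. c k x * f x"]) auto
qed

lemma C0_compactI:
  fixes f :: "'a::euclidean_space \<Rightarrow> real"
  assumes "compact \<Omega>" "continuous_on \<Omega> f"
  shows "f \<in> C0 \<Omega>"
proof (rule C0I)
  obtain R where "\<And>x. x \<in> \<Omega> \<Longrightarrow> norm x \<le> R"
    using compact_imp_bounded[OF assms(1)] by (auto simp: bounded_iff)
  then show "\<exists>R. \<forall>x\<in>\<Omega>. norm x > R \<longrightarrow> \<bar>f x\<bar> < e" for e
    by (intro exI[of _ R]) (auto simp: not_less[symmetric])
qed (use assms in \<open>auto intro: compact_imp_closed\<close>)

lemma C0_UNIV_vanishing: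
  fixes f :: "'a::euclidean_space \<Rightarrow> real"
  assumes "f \<in> C0 UNIV" "e > 0"
  shows "\<exists>R. \<forall>x. norm x > R \<longrightarrow> \<bar>f x\<bar> < e"
proof -
  obtain K where K: "compact K" "\<And>x. x \<in> UNIV - K \<Longrightarrow> \<bar>f x\<bar> < e"
    using C0_imp_vanishing[OF assms] by auto
  obtain R where "\<And>x. x \<in> K \<Longrightarrow> norm x \<le> R"
    using compact_imp_bounded[OF K(1)] by (auto simp: bounded_iff)
  then have "\<bar>f x\<bar> < e" if "norm x > R" for x
    using K(2)[of x] that by (meson DiffI UNIV_I not_le)
  then show ?thesis by blast
qed

lemma C0_UNIV_uniformly_continuous:
  fixes f :: "'a::euclidean_space \<Rightarrow> real"
  assumes f: "f \<in> C0 UNIV" and e: "e > 0"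
  obtains d where "d > 0" "\<And>x y. dist x y < d \<Longrightarrow> \<bar>f x - f y\<bar> < e"
proof -
  obtain R where R: "\<And>x. norm x > R \<Longrightarrow> \<bar>f x\<bar> < e / 2"
    using C0_UNIV_vanishing[OF f half_gt_zero[OF e]] by auto
  \<comment> \<open>The margin 1 matches \<open>min d 1\<close> below: as soon as one of the two
    points has norm at most \<open>R\<close>, both lie in this ball. Otherwise both values are below
    \<open>e / 2\<close>.\<close>
  have "uniformly_continuous_on (cball 0 (R + 1)) f"
    by (rule compact_uniformly_continuous[OF continuous_on_subset[OF C0_imp_continuous_on[OF f]]]) auto
  then obtain d where d: "d > 0"
    "\<And>x y. x \<in> cball 0 (R + 1) \<Longrightarrow> y \<in> cball 0 (R + 1) \<Longrightarrow> dist y x < d \<Longrightarrow> dist (f y) (f x) < e"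
    using e unfolding uniformly_continuous_on_def by meson
  show ?thesis
  proof (rule that[of "min d 1"])
    fix x y :: 'a assume xy: "dist x y < min d 1"
    have "norm x \<le> norm y + dist x y" "norm y \<le> norm x + dist x y"
      using norm_triangle_ineq2[of x y] norm_triangle_ineq2[of y x] by (simp_all add: dist_norm norm_minus_commute)
    show "\<bar>f x - f y\<bar> < e"
    proof (cases "norm x \<le> R \<or> norm y \<le> R")
      case True
      then have "norm x \<le> R + 1" "norm y \<le> R + 1"
        using xy \<open>norm x \<le> norm y + dist x y\<close> \<open>norm y \<le> norm x + dist x y\<close> by auto
      then show ?thesis using d(2)[of y x] xy by (simp add: dist_real_def)
    next
      case False
      then show ?thesis using R[of x] R[of y] by linarith
    qed
  qed (use d in simp)
qed

section \<open>Convolution of a measure with a bounded continuous kernel\<close>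

lemma bdd_meas_continuous:
  "continuous_on UNIV f \<Longrightarrow> (\<And>x. \<bar>f x\<bar> \<le> C) \<Longrightarrow> bdd_meas \<Omega> f"
  by (rule bdd_measI[of _ _ C])
    (auto intro: borel_measurable_continuous_on_restrict continuous_on_subset[OF _ subset_UNIV])

lemma continuous_on_translate:
  fixes f :: "'a::euclidean_space \<Rightarrow> real"
  assumes "continuous_on UNIV f"
  shows "continuous_on UNIV (\<lambda>y. f (x - y))" "continuous_on UNIV (\<lambda>y. f (y - x))"
  using assms by (auto intro!: continuous_on_compose2[OF assms] continuous_intros)

context
  fixes \<Omega> :: "'a::euclidean_space set" and \<rho> :: "'a \<Rightarrow> real" and C :: real
  assumes cont: "continuous_on UNIV \<rho>" and bnd: "\<And>x. \<bar>\<rho> x\<bar> \<le> C"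
begin

lemma bdd_meas_translate: "bdd_meas \<Omega> (\<lambda>y. \<rho> (x - y))"
  by (rule bdd_meas_continuous[OF continuous_on_translate(1)[OF cont]]) (rule bnd)

text \<open>Only a pointwise limit of the translates is asked for. It is a translate again when
  \<open>X\<close> converges, which gives continuity, and 0 when \<open>X\<close> escapes to
  infinity and the kernel vanishes there, which gives decay.\<close>

lemma conv_measure_tendsto:
  assumes ca: "countably_additive_real \<Omega> \<mu>"
    and U: "\<And>y. (\<lambda>n. \<rho> (X n - y)) \<longlonglongrightarrow> u y" and u: "bdd_meas \<Omega> u"
  shows "(\<lambda>n. conv_measure \<Omega> \<rho> \<mu> (X n)) \<longlonglongrightarrow> dual_pairing \<Omega> u \<mu>"
  unfolding conv_measure_def
  by (rule dual_pairing_dominated_convergence[OF ca bdd_meas_translate u bnd U])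

lemma conv_measure_continuous:
  assumes ca: "countably_additive_real \<Omega> \<mu>"
  shows "continuous_on UNIV (conv_measure \<Omega> \<rho> \<mu>)"
proof -
  have "isCont (conv_measure \<Omega> \<rho> \<mu>) x" for x
    unfolding continuous_at_sequentially comp_def
  proof (intro allI impI)
    fix X :: "nat \<Rightarrow> 'a" assume X: "X \<longlonglongrightarrow> x"
    have "(\<lambda>n. \<rho> (X n - y)) \<longlonglongrightarrow> \<rho> (x - y)" for y
      using cont X by (intro isCont_tendsto_compose[where g=\<rho>] tendsto_intros)
        (auto simp: continuous_on_eq_continuous_at)
    from conv_measure_tendsto[OF ca this bdd_meas_translate]
    show "(\<lambda>n. conv_measure \<Omega> \<rho> \<mu> (X n)) \<longlonglongrightarrow> conv_measure \<Omega> \<rho> \<mu> x"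
      by (simp add: conv_measure_def[of \<Omega> \<rho> \<mu> x])
  qed
  then show ?thesis by (simp add: continuous_on_eq_continuous_at)
qed

lemma conv_measure_bound:
  assumes ca: "countably_additive_real \<Omega> \<mu>"
  shows "\<bar>conv_measure \<Omega> \<rho> \<mu> x\<bar> \<le> C * radon_norm \<Omega> \<mu>"
  unfolding conv_measure_def by (rule dual_pairing_abs_le[OF ca bdd_meas_translate bnd])

lemma bdd_meas_conv_measure:
  assumes ca: "countably_additive_real \<Omega> \<mu>"
  shows "bdd_meas \<Omega> (conv_measure \<Omega> \<rho> \<mu>)"
  by (rule bdd_meas_continuous[OF conv_measure_continuous[OF ca] conv_measure_bound[OF ca]])

lemma conv_measure_polar:
  assumes V: "polar_of \<Omega> \<mu> V \<sigma>"
  shows "conv_measure \<Omega> \<rho> \<mu> x = (LINT y|V. \<rho> (x - y) * \<sigma> y)"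
  unfolding conv_measure_def using V polar_of_integrable(1)[OF V bdd_meas_translate]
  unfolding polar_of_def by blast

lemma dual_pairing_conv_polar:
  assumes V: "polar_of \<Omega> \<mu> V \<sigma>" and W: "polar_of \<Omega> \<nu> W \<tau>" and ca: "countably_additive_real \<Omega> \<mu>"
  shows "dual_pairing \<Omega> (conv_measure \<Omega> \<rho> \<mu>) \<nu> = (LINT x|W. (LINT y|V. \<rho> (x - y) * \<sigma> y) * \<tau> x)"
proof -
  have "dual_pairing \<Omega> (conv_measure \<Omega> \<rho> \<mu>) \<nu> = (LINT x|W. conv_measure \<Omega> \<rho> \<mu> x * \<tau> x)"
    using W polar_of_integrable(1)[OF W bdd_meas_conv_measure[OF ca]] unfolding polar_of_def by blast
  then show ?thesis by (simp only: conv_measure_polar[OF V])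
qed

end

lemma conv_measure_C0:
  fixes \<rho> :: "'a::euclidean_space \<Rightarrow> real"
  assumes \<rho>: "\<rho> \<in> C0 UNIV" and ca: "countably_additive_real \<Omega> \<mu>" and cl: "closed \<Omega>"
  shows "conv_measure \<Omega> \<rho> \<mu> \<in> C0 \<Omega>"
proof (rule C0I[OF cl])
  obtain C where C: "\<And>x. \<bar>\<rho> x\<bar> \<le> C" using C0_imp_bounded[OF \<rho>] by auto
  note cont = C0_imp_continuous_on[OF \<rho>]
  show "continuous_on \<Omega> (conv_measure \<Omega> \<rho> \<mu>)"
    by (rule continuous_on_subset[OF conv_measure_continuous[OF cont C ca] subset_UNIV])
  fix e :: real assume e: "e > 0"
  show "\<exists>R. \<forall>x\<in>\<Omega>. norm x > R \<longrightarrow> \<bar>conv_measure \<Omega> \<rho> \<mu> x\<bar> < e"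
  proof (rule ccontr)
    assume "\<not> ?thesis"
    then have "\<forall>n::nat. \<exists>x. norm x > real n \<and> e \<le> \<bar>conv_measure \<Omega> \<rho> \<mu> x\<bar>"
      by (fastforce simp: not_less)
    then obtain X where X: "\<And>n::nat. norm (X n) > real n" "\<And>n. e \<le> \<bar>conv_measure \<Omega> \<rho> \<mu> (X n)\<bar>"
      by metis
    have "(\<lambda>n. \<rho> (X n - y)) \<longlonglongrightarrow> 0" for y
    proof (rule LIMSEQ_I)
      fix r :: real assume "r > 0"
      then obtain R where R: "\<And>x. norm x > R \<Longrightarrow> \<bar>\<rho> x\<bar> < r"
        using C0_UNIV_vanishing[OF \<rho>] by blast
      obtain N :: nat where N: "R + norm y < real N" using reals_Archimedean2 by blast
      have "norm (X n - y) > R" if "n \<ge> N" for n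
      proof -
        have "real N \<le> real n" using that by simp
        then show ?thesis using N X(1)[of n] norm_triangle_ineq2[of "X n" y] by linarith
      qed
      then show "\<exists>no. \<forall>n\<ge>no. norm (\<rho> (X n - y) - 0) < r" using R by auto
    qed
    moreover have "bdd_meas \<Omega> (\<lambda>_. 0)" by (rule bdd_measI[of _ _ 0]) auto
    ultimately have "(\<lambda>n. conv_measure \<Omega> \<rho> \<mu> (X n)) \<longlonglongrightarrow> dual_pairing \<Omega> (\<lambda>_. 0) \<mu>"
      by (intro conv_measure_tendsto[OF cont C ca])
    then have "(\<lambda>n. conv_measure \<Omega> \<rho> \<mu> (X n)) \<longlonglongrightarrow> 0" by (simp add: dual_pairing_def)
    then have "(\<lambda>n. \<bar>conv_measure \<Omega> \<rho> \<mu> (X n)\<bar>) \<longlonglongrightarrow> 0" by (rule tendsto_rabs_zero)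
    then have "e \<le> 0" by (rule LIMSEQ_le_const) (use X(2) in auto)
    then show False using e by simp
  qed
qed


section \<open>The energy on the frequency side, and self-adjointness\<close>

text \<open>Views points of \<open>V\<close> as elements of the Borel space, so that measurability
  of \<open>y \<bullet> \<xi>\<close> and \<open>\<rho> (x - y)\<close> on \<open>V\<close> follows
  by composition.\<close>

lemma polar_of_id_measurable:
  assumes "polar_of \<Omega> \<mu> V \<sigma>"
  shows "(\<lambda>x. x) \<in> V \<rightarrow>\<^sub>M borel"
proof -
  have "(\<lambda>x. x) \<in> restrict_space borel \<Omega> \<rightarrow>\<^sub>M borel"
    by (rule measurable_restrict_space1) simp
  moreover have "sets V = sets (restrict_space borel \<Omega>)" using assms by (simp add: polar_of_def)
  ultimately show ?thesis using measurable_cong_sets by blast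
qed

text \<open>The characters have modulus 1, so \<open>s y * u \<xi>\<close> controls the double
  integrand. The constant \<open>c\<close> is free because the energy uses \<open>- 2 * pi\<close>
  for its inner integral and \<open>2 * pi\<close> for the outer one.\<close>

lemma character_Fubini:
  fixes V :: "'a::euclidean_space measure"
  assumes fin: "finite_measure V" and idm: "(\<lambda>x. x) \<in> V \<rightarrow>\<^sub>M borel"
    and sm: "s \<in> borel_measurable V" and s1: "\<And>x. norm (s x) \<le> 1" and u: "integrable lborel u"
  shows "(LINT y|V. s y * (LINT \<xi>|lborel. cis (c * (y \<bullet> \<xi>)) * u \<xi>)) =
      (LINT \<xi>|lborel. u \<xi> * (LINT y|V. s y * cis (c * (y \<bullet> \<xi>))))"
proof -
  interpret V: finite_measure V by (rule fin)
  interpret P: pair_sigma_finite V "lborel :: 'a measure" ..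
  note [measurable] = idm sm
  have [measurable]: "u \<in> borel_measurable borel" using u by auto
  have si: "integrable V s" by (rule V.integrable_const_bound[of _ 1]) (use s1 in auto)
  let ?k = "\<lambda>y \<xi>. s y * u \<xi> * cis (c * (y \<bullet> \<xi>))"
  have k: "integrable (V \<Otimes>\<^sub>M lborel) (\<lambda>(y, \<xi>). ?k y \<xi>)"
    by (rule Bochner_Integration.integrable_bound[OF P.integrable_prod_mult[OF si u]]) (auto simp: norm_mult)
  have "(LINT y|V. s y * (LINT \<xi>|lborel. cis (c * (y \<bullet> \<xi>)) * u \<xi>)) = (LINT y|V. LINT \<xi>|lborel. ?k y \<xi>)"
    by (simp add: mult_ac flip: integral_mult_right_zero)
  also have "\<dots> = (LINT \<xi>|lborel. LINT y|V. ?k y \<xi>)"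
    by (rule P.Fubini_integral[OF k, symmetric])
  also have "\<dots> = (LINT \<xi>|lborel. u \<xi> * (LINT y|V. s y * cis (c * (y \<bullet> \<xi>))))"
    by (simp add: mult_ac flip: integral_mult_right_zero)
  finally show ?thesis .
qed

lemma energy_representation:
  fixes \<rho> v :: "'a::euclidean_space \<Rightarrow> real"
  assumes cont: "continuous_on UNIV \<rho>" and C: "\<And>x. \<bar>\<rho> x\<bar> \<le> C"
    and v: "integrable lborel v"
    and inv: "\<And>x. complex_of_real (\<rho> x) = inv_fourier (\<lambda>\<xi>. complex_of_real (v \<xi>)) x"
    and V: "polar_of \<Omega> \<mu> V \<sigma>" and ca: "countably_additive_real \<Omega> \<mu>"
  defines "m \<equiv> \<lambda>\<xi>. LINT y|V. complex_of_real (\<sigma> y) * cis (2 * pi * (y \<bullet> \<xi>))"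
  shows "integrable lborel (\<lambda>\<xi>. v \<xi> * (norm (m \<xi>))\<^sup>2)"
    and "dual_pairing \<Omega> (conv_measure \<Omega> \<rho> \<mu>) \<mu> = (LINT \<xi>|lborel. v \<xi> * (norm (m \<xi>))\<^sup>2)"
proof -
  have fin: "finite_measure V" and \<sigma>m: "\<sigma> \<in> borel_measurable V" and \<sigma>1: "\<And>x. \<bar>\<sigma> x\<bar> = 1"
    using V by (auto simp: polar_of_def)
  interpret V: finite_measure V by (rule fin)
  note idm = polar_of_id_measurable[OF V]
  have [measurable]: "v \<in> borel_measurable borel" using v by auto
  let ?s = "\<lambda>y. complex_of_real (\<sigma> y)" and ?v = "\<lambda>\<xi>. complex_of_real (v \<xi>)"
  have sm: "?s \<in> borel_measurable V" and s1: "norm (?s y) \<le> 1" for y using \<sigma>1 \<sigma>m by auto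
  have vi: "integrable lborel ?v" using v by simp
  have mm[measurable]: "m \<in> borel_measurable borel" 
  proof -
    note [measurable] = idm \<sigma>m
    show ?thesis unfolding m_def by measurable
  qed
  have "cnj \<in> borel_measurable borel"
    by (intro borel_measurable_continuous_onI continuous_intros)
  from measurable_compose[OF mm this]
  have [measurable]: "(\<lambda>\<xi>. cnj (m \<xi>)) \<in> borel_measurable borel" by simp
  \<comment> \<open>The characteristic function is bounded by the total variation; this makes
    \<open>v\<close> times it, and times its squared modulus, integrable.\<close>
  have mle: "norm (m \<xi>) \<le> measure V (space V)" for \<xi>
  proof -
    have "norm (m \<xi>) \<le> (LINT y|V. norm (?s y * cis (2 * pi * (y \<bullet> \<xi>))))"
      unfolding m_def by (rule integral_norm_bound)
    then show ?thesis by (simp add: norm_mult \<sigma>1)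
  qed
  have cnjm: "(LINT y|V. ?s y * cis (- 2 * pi * (y \<bullet> \<xi>))) = cnj (m \<xi>)" for \<xi>
    unfolding m_def by (subst Bochner_Integration.integral_cnj[symmetric]) (simp add: cis_cnj)
  \<comment> \<open>The convolution of \<open>\<rho>\<close> with \<open>\<mu>\<close> is the
    inverse transform of \<open>v\<close> times the conjugate of \<open>m\<close>.\<close>
  have h: "complex_of_real (LINT y|V. \<rho> (x - y) * \<sigma> y) =
      (LINT \<xi>|lborel. cis (2 * pi * (x \<bullet> \<xi>)) * (?v \<xi> * cnj (m \<xi>)))" for x
  proof -
    have u: "integrable lborel (\<lambda>\<xi>. cis (2 * pi * (x \<bullet> \<xi>)) * ?v \<xi>)"
      by (rule Bochner_Integration.integrable_bound[OF vi]) (auto simp: norm_mult)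
    have "complex_of_real (LINT y|V. \<rho> (x - y) * \<sigma> y) = (LINT y|V. ?s y * complex_of_real (\<rho> (x - y)))"
      by (simp add: mult.commute flip: integral_complex_of_real)
    also have "\<dots> = (LINT y|V. ?s y * (LINT \<xi>|lborel. cis (- 2 * pi * (y \<bullet> \<xi>)) * (cis (2 * pi * (x \<bullet> \<xi>)) * ?v \<xi>)))"
    proof (rule Bochner_Integration.integral_cong[OF refl])
      fix y :: 'a
      have "cis (2 * pi * ((x - y) \<bullet> \<xi>)) = cis (- 2 * pi * (y \<bullet> \<xi>)) * cis (2 * pi * (x \<bullet> \<xi>))" for \<xi>
        by (simp add: cis_mult inner_diff_left algebra_simps)
      then show "?s y * complex_of_real (\<rho> (x - y)) =
        ?s y * (LINT \<xi>|lborel. cis (- 2 * pi * (y \<bullet> \<xi>)) * (cis (2 * pi * (x \<bullet> \<xi>)) * ?v \<xi>))"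
        by (simp only: inv inv_fourier_def mult.assoc)
    qed
    also have "\<dots> = (LINT \<xi>|lborel. (cis (2 * pi * (x \<bullet> \<xi>)) * ?v \<xi>) * cnj (m \<xi>))"
      by (subst character_Fubini[OF fin idm sm s1 u]) (simp only: cnjm)
    finally show ?thesis by (simp add: mult.assoc)
  qed
  have vm: "integrable lborel (\<lambda>\<xi>. ?v \<xi> * cnj (m \<xi>))"
  proof (rule Bochner_Integration.integrable_bound)
    show "integrable lborel (\<lambda>\<xi>. measure V (space V) * v \<xi>)" using v by simp
    show "AE \<xi> in lborel. norm (?v \<xi> * cnj (m \<xi>)) \<le> norm (measure V (space V) * v \<xi>)"
      using mle by (auto simp: norm_mult abs_mult mult.commute intro!: mult_left_mono)
  qed measurable
  have eq: "?v \<xi> * cnj (m \<xi>) * m \<xi> = complex_of_real (v \<xi> * (norm (m \<xi>))\<^sup>2)" for \<xi>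
    by (simp only: of_real_mult complex_norm_square mult_ac)
  have "integrable lborel (\<lambda>\<xi>. ?v \<xi> * cnj (m \<xi>) * m \<xi>)"
  proof (rule Bochner_Integration.integrable_bound)
    show "integrable lborel (\<lambda>\<xi>. complex_of_real (measure V (space V)) * (?v \<xi> * cnj (m \<xi>)))" using vm by simp
    show "AE \<xi> in lborel. norm (?v \<xi> * cnj (m \<xi>) * m \<xi>) \<le> norm (complex_of_real (measure V (space V)) * (?v \<xi> * cnj (m \<xi>)))"
    proof (rule AE_I2)
      fix \<xi>
      have "norm (?v \<xi> * cnj (m \<xi>)) * norm (m \<xi>) \<le> norm (?v \<xi> * cnj (m \<xi>)) * measure V (space V)"
        by (rule mult_left_mono[OF mle]) simp
      then show "norm (?v \<xi> * cnj (m \<xi>) * m \<xi>) \<le> norm (complex_of_real (measure V (space V)) * (?v \<xi> * cnj (m \<xi>)))"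
        by (simp add: norm_mult mult_ac)
    qed
  qed measurable
  then show "integrable lborel (\<lambda>\<xi>. v \<xi> * (norm (m \<xi>))\<^sup>2)"
    by (simp only: eq complex_of_real_integrable_eq)
  have "complex_of_real (dual_pairing \<Omega> (conv_measure \<Omega> \<rho> \<mu>) \<mu>) =
      (LINT x|V. ?s x * complex_of_real (LINT y|V. \<rho> (x - y) * \<sigma> y))"
    unfolding dual_pairing_conv_polar[OF cont C V V ca]
    by (simp add: mult.commute flip: integral_complex_of_real)
  also have "\<dots> = (LINT \<xi>|lborel. (?v \<xi> * cnj (m \<xi>)) * m \<xi>)"
    unfolding h by (subst character_Fubini[OF fin idm sm s1 vm]) (simp only: m_def)
  also have "\<dots> = complex_of_real (LINT \<xi>|lborel. v \<xi> * (norm (m \<xi>))\<^sup>2)"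
    by (simp only: eq integral_complex_of_real)
  finally show "dual_pairing \<Omega> (conv_measure \<Omega> \<rho> \<mu>) \<mu> = (LINT \<xi>|lborel. v \<xi> * (norm (m \<xi>))\<^sup>2)"
    by (simp only: of_real_eq_iff)
qed

lemma self_adjoint_conv_measure:
  fixes \<rho> :: "'a::euclidean_space \<Rightarrow> real"
  assumes cont: "continuous_on UNIV \<rho>" and C: "\<And>x. \<bar>\<rho> x\<bar> \<le> C" and sym: "\<And>x. \<rho> (- x) = \<rho> x"
    and ca: "countably_additive_real \<Omega> \<mu>" "countably_additive_real \<Omega> \<nu>"
  shows "dual_pairing \<Omega> (conv_measure \<Omega> \<rho> \<mu>) \<nu> = dual_pairing \<Omega> (conv_measure \<Omega> \<rho> \<nu>) \<mu>"
proof -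
  obtain V \<sigma> where V: "polar_of \<Omega> \<mu> V \<sigma>" by (rule polar_decomposition[OF ca(1)])
  obtain W \<tau> where W: "polar_of \<Omega> \<nu> W \<tau>" by (rule polar_decomposition[OF ca(2)])
  have V': "finite_measure V" "\<sigma> \<in> borel_measurable V" "\<And>x. \<bar>\<sigma> x\<bar> = 1" using V by (auto simp: polar_of_def)
  have W': "finite_measure W" "\<tau> \<in> borel_measurable W" "\<And>x. \<bar>\<tau> x\<bar> = 1" using W by (auto simp: polar_of_def)
  interpret V: finite_measure V by (rule V')
  interpret W: finite_measure W by (rule W')
  interpret P: pair_sigma_finite V W ..
  interpret PF: finite_measure "V \<Otimes>\<^sub>M W"
    by (rule finite_measure_pair_measure) fact+
  note [measurable] = polar_of_id_measurable[OF V] polar_of_id_measurable[OF W] V'(2) W'(2)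
  have [measurable]: "\<rho> \<in> borel_measurable borel" using cont by (rule borel_measurable_continuous_onI)
  let ?k = "\<lambda>y x. \<rho> (x - y) * \<sigma> y * \<tau> x"
  have k: "integrable (V \<Otimes>\<^sub>M W) (\<lambda>(y, x). ?k y x)"
    by (rule PF.integrable_const_bound[of _ C]) (use C in \<open>auto simp: abs_mult V' W'\<close>)
  have "dual_pairing \<Omega> (conv_measure \<Omega> \<rho> \<mu>) \<nu> = (LINT x|W. LINT y|V. ?k y x)"
    by (simp add: dual_pairing_conv_polar[OF cont C V W ca(1)])
  also have "\<dots> = (LINT y|V. LINT x|W. ?k y x)"
    by (rule P.Fubini_integral[OF k])
  also have "\<dots> = (LINT y|V. (LINT x|W. \<rho> (y - x) * \<tau> x) * \<sigma> y)"
  proof -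
    have "\<rho> (x - y) = \<rho> (y - x)" for x y using sym[of "x - y"] by simp
    then show ?thesis by (simp add: mult_ac flip: integral_mult_left_zero)
  qed
  also have "\<dots> = dual_pairing \<Omega> (conv_measure \<Omega> \<rho> \<nu>) \<mu>"
    by (simp add: dual_pairing_conv_polar[OF cont C W V ca(2)])
  finally show ?thesis .
qed

section \<open>Strict positivity on discrete measures\<close>

text \<open>Moving in the direction of a frequency \<open>a\<close> of largest norm, the polynomial becomes an entire
  function of one variable; along the imaginary axis its term at \<open>a\<close> dominates, so it is not
  zero and has countably many zeros. Averaging over translates along \<open>a\<close> then gives the claim.\<close>

lemma trigonometric_polynomial_AE_nonzero:
  fixes F :: "'a::euclidean_space set" and \<beta> :: "'a \<Rightarrow> real"
  assumes F: "finite F" "F \<noteq> {}" and \<beta>: "\<And>x. x \<in> F \<Longrightarrow> \<beta> x \<noteq> 0"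
  shows "AE \<xi> in lborel. (\<Sum>x\<in>F. complex_of_real (\<beta> x) * cis (2 * pi * (x \<bullet> \<xi>))) \<noteq> 0"
proof -
  define P where "P \<xi> = (\<Sum>x\<in>F. complex_of_real (\<beta> x) * cis (2 * pi * (x \<bullet> \<xi>)))" for \<xi>
  have [measurable]: "P \<in> borel_measurable borel" unfolding P_def by measurable
  have "Max (norm ` F) \<in> norm ` F" using F by (intro Max_in) auto
  then obtain a where a: "a \<in> F" "norm a = Max (norm ` F)" by force
  have ale: "norm x \<le> norm a" if "x \<in> F" for x unfolding a(2) using F that by (intro Max_ge) auto
  \<comment> \<open>Expand the positive square of \<open>x - a\<close> and use that the norm of
    \<open>x\<close> is at most that of \<open>a\<close>: so \<open>a\<close> is the only maximiser
    of the inner product with \<open>a\<close>.\<close>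
  have inner_less: "x \<bullet> a < a \<bullet> a" if x: "x \<in> F" "x \<noteq> a" for x
  proof -
    have "0 < (x - a) \<bullet> (x - a)" using x by simp
    also have "\<dots> = x \<bullet> x + a \<bullet> a - 2 * (x \<bullet> a)" by (simp add: inner_diff_left inner_diff_right inner_commute)
    finally have "2 * (x \<bullet> a) < x \<bullet> x + a \<bullet> a" by simp
    moreover have "x \<bullet> x \<le> a \<bullet> a" using ale[OF x(1)] by (simp add: norm_le)
    ultimately show ?thesis by simp
  qed
  have zeros: "countable {t::real. P (\<xi> + t *\<^sub>R a) = 0}" for \<xi>
  proof -
    define d where "d x = complex_of_real (\<beta> x) * cis (2 * pi * (x \<bullet> \<xi>))" for x
    define h where "h z = (\<Sum>x\<in>F. d x * exp (2 * pi * (x \<bullet> a) * \<i> * z))" for z :: complex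
    have hP: "P (\<xi> + t *\<^sub>R a) = h (complex_of_real t)" for t
      unfolding P_def h_def
    proof (rule sum.cong[OF refl])
      fix x
      have "2 * pi * (x \<bullet> (\<xi> + t *\<^sub>R a)) = 2 * pi * (x \<bullet> \<xi>) + 2 * pi * (x \<bullet> a) * t"
        by (simp add: inner_add_right algebra_simps)
      then have "cis (2 * pi * (x \<bullet> (\<xi> + t *\<^sub>R a))) = cis (2 * pi * (x \<bullet> \<xi>)) * cis (2 * pi * (x \<bullet> a) * t)"
        by (simp add: cis_mult)
      also have "cis (2 * pi * (x \<bullet> a) * t) = exp (2 * pi * (x \<bullet> a) * \<i> * complex_of_real t)"
        by (simp add: cis_conv_exp mult_ac)
      finally show "complex_of_real (\<beta> x) * cis (2 * pi * (x \<bullet> (\<xi> + t *\<^sub>R a))) = d x * exp (2 * pi * (x \<bullet> a) * \<i> * complex_of_real t)"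
        by (simp add: d_def)
    qed
    have hol: "h holomorphic_on UNIV" unfolding h_def by (intro holomorphic_intros)
    have "\<exists>z. h z \<noteq> 0"
    proof (rule ccontr)
      assume "\<not> ?thesis"
      then have h0: "h z = 0" for z by auto
      \<comment> \<open>At \<open>z = - \<i> * n\<close> the term of \<open>x\<close> has growth
        \<open>exp (2 * pi * (x \<bullet> a) * n)\<close>. After division by the growth at
        \<open>a\<close>, only the term of \<open>a\<close> survives in the limit.\<close>
      have "(\<lambda>n. \<Sum>x\<in>F. d x * complex_of_real (exp (2 * pi * (x \<bullet> a - a \<bullet> a) * real n)))
        \<longlonglongrightarrow> (\<Sum>x\<in>F. d x * (if x = a then 1 else 0))"
      proof (intro tendsto_sum tendsto_mult tendsto_const)
        fix x assume x: "x \<in> F"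
        show "(\<lambda>n. complex_of_real (exp (2 * pi * (x \<bullet> a - a \<bullet> a) * real n))) \<longlonglongrightarrow> (if x = a then 1 else 0)"
        proof (cases "x = a")
          case False
          then have "2 * pi * (x \<bullet> a - a \<bullet> a) < 0" using inner_less[OF x] by (simp add: mult_less_0_iff)
          then have "filterlim (\<lambda>n. 2 * pi * (x \<bullet> a - a \<bullet> a) * real n) at_bot sequentially"
            by (intro filterlim_tendsto_neg_mult_at_bot[OF tendsto_const] filterlim_real_sequentially)
          then have "(\<lambda>n. exp (2 * pi * (x \<bullet> a - a \<bullet> a) * real n)) \<longlonglongrightarrow> 0"
            by (rule filterlim_compose[OF exp_at_bot])
          then show ?thesis using False tendsto_of_real[of _ 0] by fastforce
        qed simp
      qed
      moreover have "(\<Sum>x\<in>F. d x * complex_of_real (exp (2 * pi * (x \<bullet> a - a \<bullet> a) * real n))) = 0" for n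
      proof -
        have "(\<Sum>x\<in>F. d x * complex_of_real (exp (2 * pi * (x \<bullet> a - a \<bullet> a) * real n))) =
          (\<Sum>x\<in>F. d x * exp (2 * pi * (x \<bullet> a) * \<i> * (- \<i> * real n)) * exp (complex_of_real (- 2 * pi * (a \<bullet> a) * real n)))"
        proof (rule sum.cong[OF refl])
          fix x
          have "2 * pi * (x \<bullet> a - a \<bullet> a) * real n = 2 * pi * (x \<bullet> a) * real n + (- 2 * pi * (a \<bullet> a) * real n)"
            by (simp add: algebra_simps)
          then have "complex_of_real (exp (2 * pi * (x \<bullet> a - a \<bullet> a) * real n)) =
            exp (complex_of_real (2 * pi * (x \<bullet> a) * real n)) * exp (complex_of_real (- 2 * pi * (a \<bullet> a) * real n))"
            by (simp only: exp_add of_real_mult[of "exp _" "exp _"] exp_of_real)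
          moreover have "2 * pi * (x \<bullet> a) * \<i> * (- \<i> * real n) = complex_of_real (2 * pi * (x \<bullet> a) * real n)"
            by (simp add: algebra_simps)
          ultimately show "d x * complex_of_real (exp (2 * pi * (x \<bullet> a - a \<bullet> a) * real n)) =
            d x * exp (2 * pi * (x \<bullet> a) * \<i> * (- \<i> * real n)) * exp (complex_of_real (- 2 * pi * (a \<bullet> a) * real n))"
            by (simp only: mult.assoc)
        qed
        also have "\<dots> = h (- \<i> * real n) * exp (complex_of_real (- 2 * pi * (a \<bullet> a) * real n))"
          by (simp only: h_def sum_distrib_right)
        finally show ?thesis by (simp only: h0 mult_zero_left)
      qed
      ultimately have "(\<Sum>x\<in>F. d x * (if x = a then 1 else 0)) = 0" by (simp add: LIMSEQ_const_iff)
      then have "d a = 0" using F a by (simp add: if_distrib sum.delta cong: if_cong)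
      then show False using \<beta>[OF a(1)] by (simp add: d_def)
    qed
    then obtain z0 where z0: "h z0 \<noteq> 0" by blast
    have "countable {z\<in>UNIV. h z = 0}"
    \<comment> \<open>The constant case covers \<open>a = 0\<close>, that is \<open>F = {0}\<close>,
      where moving along \<open>a\<close> does nothing; there are then no zeros at all.\<close>
    proof (cases "h constant_on UNIV")
      case True
      then obtain c where "\<And>z. h z = c" unfolding constant_on_def by auto
      then have "h z \<noteq> 0" for z using z0 by simp
      then show ?thesis by simp
    next
      case False
      then show ?thesis by (intro holomorphic_countable_zeros hol) auto
    qed
    then have "countable (complex_of_real ` {t. P (\<xi> + t *\<^sub>R a) = 0})"
      by (rule countable_subset[rotated]) (auto simp: hP)
    then show ?thesis by (rule countable_image_inj_on) (simp add: inj_on_def)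
  qed
  define Z where "Z = {\<xi>. P \<xi> = 0}"
  have [measurable]: "Z \<in> sets borel" unfolding Z_def by measurable
  have tr: "(\<integral>\<^sup>+\<xi>. indicator Z (\<xi> + t *\<^sub>R a) \<partial>lborel) = emeasure lborel Z" for t :: real
  proof -
    have "(\<integral>\<^sup>+\<xi>. indicator Z \<xi> \<partial>lborel) = (\<integral>\<^sup>+\<xi>. indicator Z \<xi> \<partial>distr lborel borel ((+) (t *\<^sub>R a)))"
      by (simp only: lborel_distr_plus)
    also have "\<dots> = (\<integral>\<^sup>+\<xi>. indicator Z (t *\<^sub>R a + \<xi>) \<partial>lborel)" by (rule nn_integral_distr) measurable
    finally show ?thesis by (simp add: add.commute)
  qed
  \<comment> \<open>By translation invariance the measure of \<open>Z\<close> is an average over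
    \<open>t\<close> in the unit interval. After the exchange of integrals, for each
    \<open>\<xi>\<close> only a countable set of \<open>t\<close> contributes.\<close>
  have "emeasure lborel Z = (\<integral>\<^sup>+t. indicator {0..1::real} t * emeasure lborel Z \<partial>lborel)"
    by (simp add: nn_integral_multc)
  also have "\<dots> = (\<integral>\<^sup>+t. \<integral>\<^sup>+\<xi>. indicator {0..1::real} t * indicator Z (\<xi> + t *\<^sub>R a) \<partial>lborel \<partial>lborel)"
    by (simp add: nn_integral_cmult tr)
  also have "\<dots> = (\<integral>\<^sup>+\<xi>. \<integral>\<^sup>+t. indicator {0..1::real} t * indicator Z (\<xi> + t *\<^sub>R a) \<partial>lborel \<partial>lborel)"
    by (rule lborel_pair.Fubini') measurable
  also have "\<dots> = (\<integral>\<^sup>+\<xi>. (\<lambda>_::'a. 0) \<xi> \<partial>lborel)"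
  proof (rule nn_integral_cong)
    fix \<xi> :: 'a
    have "AE t in lborel. t \<notin> {t. P (\<xi> + t *\<^sub>R a) = 0}"
      by (rule AE_not_in) (rule countable_imp_null_set_lborel[OF zeros])
    then have "(\<integral>\<^sup>+t. indicator {0..1::real} t * indicator Z (\<xi> + t *\<^sub>R a) \<partial>lborel) = (\<integral>\<^sup>+t. (\<lambda>_::real. 0) t \<partial>lborel)"
      by (intro nn_integral_cong_AE) (auto simp: Z_def)
    then show "(\<integral>\<^sup>+t. indicator {0..1::real} t * indicator Z (\<xi> + t *\<^sub>R a) \<partial>lborel) = 0" by simp
  qed
  finally have "Z \<in> null_sets lborel" by (simp add: null_setsI)
  then have "AE \<xi> in lborel. \<xi> \<notin> Z" by (rule AE_not_in)
  then show ?thesis by (simp add: Z_def P_def)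
qed

lemma energy_discrete_pos:
  fixes \<rho> v :: "'a::euclidean_space \<Rightarrow> real"
  assumes cont: "continuous_on UNIV \<rho>" and C: "\<And>x. \<bar>\<rho> x\<bar> \<le> C"
    and v: "integrable lborel v" "\<And>\<xi>. 0 \<le> v \<xi>"
    and inv: "\<And>x. complex_of_real (\<rho> x) = inv_fourier (\<lambda>\<xi>. complex_of_real (v \<xi>)) x"
    and nz: "\<exists>x. \<rho> x \<noteq> 0" and \<mu>: "\<mu> \<in> discrete_measures \<Omega>" "\<mu> \<noteq> (\<lambda>A. 0)"
  shows "0 < dual_pairing \<Omega> (conv_measure \<Omega> \<rho> \<mu>) \<mu>"
proof -
  obtain N :: nat and \<alpha> x where x: "\<And>k. k < N \<Longrightarrow> x k \<in> \<Omega>"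
    and \<mu>_eq: "\<mu> = (\<lambda>A. \<Sum>k<N. \<alpha> k * dirac_measure \<Omega> (x k) A)"
    using \<mu>(1) unfolding discrete_measures_def by blast
  have ca: "countably_additive_real \<Omega> \<mu>" unfolding \<mu>_eq by (rule ca_discrete)
  obtain V \<sigma> where V: "polar_of \<Omega> \<mu> V \<sigma>" by (rule polar_decomposition[OF ca])
  define m where "m \<xi> = (LINT y|V. complex_of_real (\<sigma> y) * cis (2 * pi * (y \<bullet> \<xi>)))" for \<xi>
  note E = energy_representation[OF cont C v(1) inv V ca, folded m_def]
  \<comment> \<open>Coefficients of repeated points are merged, and points with total 0 are dropped;
    that \<open>\<mu>\<close> is not 0 means that some point is left.\<close>
  define \<beta> where "\<beta> y = (\<Sum>k | k < N \<and> x k = y. \<alpha> k)" for y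
  define F where "F = {y \<in> x ` {..<N}. \<beta> y \<noteq> 0}"
  have regroup: "(\<Sum>k<N. complex_of_real (\<alpha> k) * g (x k)) = (\<Sum>y\<in>F. complex_of_real (\<beta> y) * g y)"
    for g :: "'a \<Rightarrow> complex"
  proof -
    have "(\<Sum>k<N. complex_of_real (\<alpha> k) * g (x k)) =
        (\<Sum>y\<in>x ` {..<N}. \<Sum>k | k \<in> {..<N} \<and> x k = y. complex_of_real (\<alpha> k) * g (x k))"
      by (rule sum.image_gen) simp
    also have "\<dots> = (\<Sum>y\<in>x ` {..<N}. complex_of_real (\<beta> y) * g y)"
      by (rule sum.cong[OF refl]) (simp add: \<beta>_def sum_distrib_right)
    also have "\<dots> = (\<Sum>y\<in>F. complex_of_real (\<beta> y) * g y)"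
      unfolding F_def by (rule sum.mono_neutral_right) auto
    finally show ?thesis .
  qed
  have "F \<noteq> {}"
  proof
    assume "F = {}"
    then have "complex_of_real (\<mu> A) = 0" for A
      using regroup[of "\<lambda>y. complex_of_real (dirac_measure \<Omega> y A)"] by (simp add: \<mu>_eq)
    then show False using \<mu>(2) by auto
  qed
  \<comment> \<open>\<open>m\<close> is defined through the variation of \<open>\<mu>\<close>, but
    its real and imaginary parts are pairings with a cosine and a sine, which the discrete formula
    evaluates.\<close>
  have meq: "m \<xi> = (\<Sum>y\<in>F. complex_of_real (\<beta> y) * cis (2 * pi * (y \<bullet> \<xi>)))" for \<xi>
  proof -
    have b: "bdd_meas \<Omega> (\<lambda>y. cos (2 * pi * (y \<bullet> \<xi>)))" "bdd_meas \<Omega> (\<lambda>y. sin (2 * pi * (y \<bullet> \<xi>)))"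
      by (rule bdd_meas_continuous[of _ 1]; auto intro!: continuous_intros)+
    have int: "integrable V (\<lambda>y. complex_of_real (\<sigma> y) * cis (2 * pi * (y \<bullet> \<xi>)))"
    proof -
      interpret finite_measure V using V by (simp add: polar_of_def)
      have [measurable]: "\<sigma> \<in> borel_measurable V" using V by (simp add: polar_of_def)
      note [measurable] = polar_of_id_measurable[OF V]
      show ?thesis
        by (rule integrable_const_bound[of _ 1]) (use V in \<open>auto simp: norm_mult polar_of_def\<close>)
    qed
    have pol: "dual_pairing \<Omega> \<phi> \<mu> = (LINT y|V. \<phi> y * \<sigma> y)" if "bdd_meas \<Omega> \<phi>" for \<phi>
      using V polar_of_integrable(1)[OF V that] unfolding polar_of_def by blast
    have dis: "dual_pairing \<Omega> \<phi> \<mu> = (\<Sum>k<N. \<alpha> k * \<phi> (x k))" if "bdd_meas \<Omega> \<phi>" for \<phi>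
      unfolding \<mu>_eq using x that by (intro dual_pairing_discrete) auto
    have "Re (m \<xi>) = dual_pairing \<Omega> (\<lambda>y. cos (2 * pi * (y \<bullet> \<xi>))) \<mu>"
      "Im (m \<xi>) = dual_pairing \<Omega> (\<lambda>y. sin (2 * pi * (y \<bullet> \<xi>))) \<mu>"
      unfolding m_def pol[OF b(1)] pol[OF b(2)]
      using integral_Re[OF int] integral_Im[OF int] by (simp_all add: mult.commute)
    then have "m \<xi> = (\<Sum>k<N. complex_of_real (\<alpha> k) * cis (2 * pi * (x k \<bullet> \<xi>)))"
      by (simp add: complex_eq_iff dis[OF b(1)] dis[OF b(2)])
    then show ?thesis by (simp only: regroup[of "\<lambda>y. cis (2 * pi * (y \<bullet> \<xi>))"])
  qed
  have mAE: "AE \<xi> in lborel. m \<xi> \<noteq> 0"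
    unfolding meq by (rule trigonometric_polynomial_AE_nonzero) (use \<open>F \<noteq> {}\<close> in \<open>auto simp: F_def\<close>)
  have "0 \<le> (LINT \<xi>|lborel. v \<xi> * (norm (m \<xi>))\<^sup>2)" using v by (intro integral_nonneg_AE) auto
  \<comment> \<open>As \<open>m\<close> is nonzero almost everywhere, a zero integral would force
    \<open>v = 0\<close> almost everywhere, and inversion would then give
    \<open>\<rho> = 0\<close>.\<close>
  moreover have "(LINT \<xi>|lborel. v \<xi> * (norm (m \<xi>))\<^sup>2) \<noteq> 0"
  proof
    assume "(LINT \<xi>|lborel. v \<xi> * (norm (m \<xi>))\<^sup>2) = 0"
    then have "AE \<xi> in lborel. v \<xi> * (norm (m \<xi>))\<^sup>2 = 0"
      using integral_nonneg_eq_0_iff_AE[OF E(1)] v by simp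
    with mAE have v0: "AE \<xi> in lborel. v \<xi> = 0" by eventually_elim simp
    have [measurable]: "v \<in> borel_measurable borel" using v by auto
    have "inv_fourier (\<lambda>\<xi>. complex_of_real (v \<xi>)) z = (LINT \<xi>|lborel. (\<lambda>_::'a. 0) \<xi>)" for z
      unfolding inv_fourier_def by (rule integral_cong_AE) (use v0 in auto)
    then have "\<rho> z = 0" for z using inv[of z] by simp
    then show False using nz by simp
  qed
  ultimately show ?thesis using E(2) by simp
qed

section \<open>Weak-star convergence\<close>


text \<open>Banach-Steinhaus: the sets \<open>F n\<close> are closed and cover the space, so one of
  them contains a ball. Moving the ball to the origin by linearity costs the factor 2.\<close>

lemma uniform_boundedness:
  fixes f :: "nat \<Rightarrow> 'a::{real_normed_vector,complete_space} \<Rightarrow> real"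
  assumes lin: "\<And>k. bounded_linear (f k)" and ptw: "\<And>x. \<exists>C. \<forall>k. \<bar>f k x\<bar> \<le> C"
  shows "\<exists>C\<ge>0. \<forall>k x. \<bar>f k x\<bar> \<le> C * norm x"
proof -
  define F where "F n = {x. \<forall>k. \<bar>f k x\<bar> \<le> real n}" for n
  have cont: "continuous_on UNIV (f k)" for k
    using lin[of k] by (simp add: linear_continuous_on)
  have "F n = (\<Inter>k. {x. \<bar>f k x\<bar> \<le> real n})" for n by (auto simp: F_def)
  then have cl: "closed (F n)" for n
    by (auto intro!: closed_INT closed_Collect_le continuous_intros cont)
  have "\<exists>n. interior (F n) \<noteq> {}"
  proof (rule ccontr)
    assume "\<not> ?thesis"
    then have e: "\<And>n. interior (F n) = {}" by blast
    have "euclidean interior_of \<Union>(range F) = {}"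
    proof (rule Baire_category_alt)
      show "completely_metrizable_space (euclidean :: 'a topology) \<or>
          locally_compact_space (euclidean :: 'a topology) \<and> regular_space (euclidean :: 'a topology)"
        by (simp add: completely_metrizable_space_euclidean)
      show "closedin euclidean T \<and> euclidean interior_of T = {}" if "T \<in> range F" for T
        using that e cl by auto
    qed simp
    moreover have "\<Union>(range F) = UNIV"
    proof -
      have "x \<in> \<Union>(range F)" for x
      proof -
        obtain C where "\<forall>k. \<bar>f k x\<bar> \<le> C" using ptw by blast
        moreover obtain n :: nat where "C \<le> real n" using real_arch_simple by blast
        ultimately have "x \<in> F n" unfolding F_def by (auto intro: order_trans)
        then show ?thesis by blast
      qed
      then show ?thesis by blast
    qed
    ultimately show False by simp
  qed
  then obtain n x0 where "x0 \<in> interior (F n)" by blast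
  then obtain r where r: "r > 0" "cball x0 r \<subseteq> F n"
    by (meson mem_interior_cball)
  have small: "\<bar>f k y\<bar> \<le> 2 * real n" if "norm y \<le> r" for k y
  proof -
    have "x0 + y \<in> F n" "x0 \<in> F n" using r that by (auto simp: dist_norm intro!: subsetD[OF r(2)])
    moreover have "f k (x0 + y) = f k x0 + f k y" by (rule linear_add[OF bounded_linear.linear[OF lin]])
    ultimately show ?thesis unfolding F_def by (auto simp: abs_le_iff dest!: spec[of _ k])
  qed
  have "\<bar>f k x\<bar> \<le> (2 * real n / r) * norm x" for k x
  proof (cases "x = 0")
    case True
    then show ?thesis using linear_0[OF bounded_linear.linear[OF lin]] by simp
  next
    case False
    have "f k ((r / norm x) *\<^sub>R x) = (r / norm x) * f k x"
      using linear_scale[OF bounded_linear.linear[OF lin]] by simp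
    moreover have "\<bar>f k ((r / norm x) *\<^sub>R x)\<bar> \<le> 2 * real n" using False r by (intro small) simp
    ultimately have "(r / norm x) * \<bar>f k x\<bar> \<le> 2 * real n" using r False by (simp add: abs_mult)
    then show ?thesis using r False by (simp add: field_simps)
  qed
  then show ?thesis using r by (intro exI[of _ "2 * real n / r"]) auto
qed

lemma dual_pairing_cong:
  assumes "\<And>x. x \<in> \<Omega> \<Longrightarrow> \<phi> x = \<psi> x"
  shows "dual_pairing \<Omega> \<phi> \<mu> = dual_pairing \<Omega> \<psi> \<mu>"
proof -
  have sub: "borel_sets_on \<Omega> \<subseteq> Pow \<Omega>" using borel_sets_on_subset by blast
  show ?thesis
    unfolding dual_pairing_def
    by (intro arg_cong2[where f="(-)"] Bochner_Integration.integral_cong refl)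
      (auto simp: pos_part_measure_def neg_part_measure_def space_measure_of[OF sub] assms)
qed

lemma dual_pairing_diff:
  assumes "countably_additive_real \<Omega> \<mu>" "bdd_meas \<Omega> \<phi>" "bdd_meas \<Omega> \<psi>"
  shows "dual_pairing \<Omega> (\<lambda>x. \<phi> x - \<psi> x) \<mu> = dual_pairing \<Omega> \<phi> \<mu> - dual_pairing \<Omega> \<psi> \<mu>"
  using dual_pairing_add[OF assms(1,2) bdd_meas_mult[OF assms(3), of "-1"]]
    dual_pairing_mult[OF assms(1,3), of "-1"] by simp

text \<open>Uniform boundedness on the restrictions of globally continuous functions suffices here;
  this avoids the Riesz representation of the dual norm and the extension of functions from \<open>\<Omega>\<close>.\<close>

lemma weak_star_null_bounded:
  fixes \<Omega> :: "'a::euclidean_space set"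
  assumes ca: "\<And>k. countably_additive_real \<Omega> (\<nu> k)" and cp: "compact \<Omega>"
    and ws: "\<And>\<phi>. \<phi> \<in> C0 \<Omega> \<Longrightarrow> (\<lambda>k. dual_pairing \<Omega> \<phi> (\<nu> k)) \<longlonglongrightarrow> 0"
  shows "\<exists>C\<ge>0. \<forall>k \<phi> s. continuous_on UNIV \<phi> \<longrightarrow> 0 \<le> s \<longrightarrow> (\<forall>x\<in>\<Omega>. \<bar>\<phi> x\<bar> \<le> s) \<longrightarrow>
      \<bar>dual_pairing \<Omega> \<phi> (\<nu> k)\<bar> \<le> C * s"
proof -
  define T where "T k f = dual_pairing \<Omega> (apply_bcontfun f) (\<nu> k)" for k and f :: "'a \<Rightarrow>\<^sub>C real"
  have c: "continuous_on UNIV (apply_bcontfun f)" for f :: "'a \<Rightarrow>\<^sub>C real"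
    using apply_bcontfun[of f] by (simp add: bcontfun_def)
  have b: "bdd_meas \<Omega> (apply_bcontfun f)" for f :: "'a \<Rightarrow>\<^sub>C real"
    by (rule bdd_meas_continuous[OF c, of f "norm f"]) (use norm_bounded[of f] in simp)
  have "bounded_linear (T k)" for k
  proof (rule bounded_linear_intro)
    show "T k (f + g) = T k f + T k g" for f g
      unfolding T_def plus_bcontfun.rep_eq by (rule dual_pairing_add[OF ca b b])
    show "T k (r *\<^sub>R f) = r *\<^sub>R T k f" for r f
      unfolding T_def scaleR_bcontfun.rep_eq real_scaleR_def by (rule dual_pairing_mult[OF ca b])
    show "norm (T k f) \<le> norm f * radon_norm \<Omega> (\<nu> k)" for f
      unfolding T_def real_norm_def
      by (rule dual_pairing_abs_le[OF ca b]) (use norm_bounded[of f] in simp)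
  qed
  moreover have "\<exists>C. \<forall>k. \<bar>T k f\<bar> \<le> C" for f
  proof -
    have "apply_bcontfun f \<in> C0 \<Omega>"
      by (rule C0_compactI[OF cp continuous_on_subset[OF c subset_UNIV]])
    from ws[OF this] have "Bseq (\<lambda>k. T k f)"
      unfolding T_def by (intro convergent_imp_Bseq convergentI)
    then show ?thesis by (auto simp: Bseq_def)
  qed
  ultimately obtain C where C: "C \<ge> 0" "\<And>k f. \<bar>T k f\<bar> \<le> C * norm f"
    using uniform_boundedness[of T] by auto
  have "\<bar>dual_pairing \<Omega> \<phi> (\<nu> k)\<bar> \<le> C * s"
    if \<phi>: "continuous_on UNIV \<phi>" and s: "0 \<le> s" "\<forall>x\<in>\<Omega>. \<bar>\<phi> x\<bar> \<le> s" for k \<phi> s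
  proof -
    \<comment> \<open>Truncation at level \<open>s\<close> leaves \<open>\<phi>\<close> unchanged on
      \<open>\<Omega>\<close> and bounds it by \<open>s\<close> on the whole space, where the norm
      of the Banach space is taken.\<close>
    define \<psi> where "\<psi> x = max (- s) (min s (\<phi> x))" for x
    have \<psi>s: "\<bar>\<psi> x\<bar> \<le> s" for x using s(1) by (auto simp: \<psi>_def)
    have "continuous_on UNIV \<psi>" unfolding \<psi>_def by (intro continuous_intros \<phi>)
    then have "\<psi> \<in> bcontfun" using \<psi>s by (auto simp: bcontfun_def bounded_iff)
    then have ap: "apply_bcontfun (Bcontfun \<psi>) = \<psi>" by (rule Bcontfun_inverse)
    have "norm (Bcontfun \<psi>) \<le> s" by (rule norm_bound) (simp add: ap \<psi>s)
    moreover have "dual_pairing \<Omega> \<phi> (\<nu> k) = T k (Bcontfun \<psi>)"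
      unfolding T_def ap using s(2) by (intro dual_pairing_cong) (auto simp: \<psi>_def abs_le_iff)
    ultimately show ?thesis
      using C(2)[of k "Bcontfun \<psi>"] mult_left_mono[OF _ C(1)] by (metis order_trans)
  qed
  then show ?thesis using C(1) by blast
qed

text \<open>Boundedness of the measures enters as an estimate on continuous test functions, the form
  in which uniform boundedness supplies it. Uniform continuity of \<open>\<rho>\<close> then bounds
  the difference of two translates.\<close>

lemma conv_measure_equicontinuous:
  fixes \<rho> :: "'a::euclidean_space \<Rightarrow> real"
  assumes ca: "\<And>k. countably_additive_real \<Omega> (\<nu> k)" and \<rho>: "\<rho> \<in> C0 UNIV" and K: "K \<ge> 0"
    and B: "\<And>k \<phi> s. continuous_on UNIV \<phi> \<Longrightarrow> 0 \<le> s \<Longrightarrow> (\<And>x. x \<in> \<Omega> \<Longrightarrow> \<bar>\<phi> x\<bar> \<le> s) \<Longrightarrow>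
      \<bar>dual_pairing \<Omega> \<phi> (\<nu> k)\<bar> \<le> K * s"
    and e: "e > 0"
  shows "\<exists>d>0. \<forall>k x y. dist x y < d \<longrightarrow> \<bar>conv_measure \<Omega> \<rho> (\<nu> k) x - conv_measure \<Omega> \<rho> (\<nu> k) y\<bar> < e"
proof -
  note cont = C0_imp_continuous_on[OF \<rho>]
  obtain C where C: "\<And>x. \<bar>\<rho> x\<bar> \<le> C" using C0_imp_bounded[OF \<rho>] by auto
  \<comment> \<open>With \<open>K + 1\<close> in place of \<open>K\<close> the quotient makes sense
    for \<open>K = 0\<close>, and \<open>K * (e / (K + 1))\<close> is strictly below
    \<open>e\<close>.\<close>
  have "e / (K + 1) > 0" using e K by simp
  then obtain d where d: "d > 0" "\<And>x y. dist x y < d \<Longrightarrow> \<bar>\<rho> x - \<rho> y\<bar> < e / (K + 1)"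
    using C0_UNIV_uniformly_continuous[OF \<rho>] by metis
  have "\<bar>conv_measure \<Omega> \<rho> (\<nu> k) x - conv_measure \<Omega> \<rho> (\<nu> k) y\<bar> < e" if xy: "dist x y < d" for k x y
  proof -
    have "conv_measure \<Omega> \<rho> (\<nu> k) x - conv_measure \<Omega> \<rho> (\<nu> k) y = dual_pairing \<Omega> (\<lambda>z. \<rho> (x - z) - \<rho> (y - z)) (\<nu> k)"
      unfolding conv_measure_def
      by (rule dual_pairing_diff[OF ca bdd_meas_translate[OF cont C] bdd_meas_translate[OF cont C], symmetric])
    also have "\<bar>\<dots>\<bar> \<le> K * (e / (K + 1))"
    proof (rule B)
      show "continuous_on UNIV (\<lambda>z. \<rho> (x - z) - \<rho> (y - z))"
        by (intro continuous_on_diff continuous_on_translate(1)[OF cont])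
      show "\<bar>\<rho> (x - z) - \<rho> (y - z)\<bar> \<le> e / (K + 1)" for z
        using d(2)[of "x - z" "y - z"] xy by (simp add: dist_norm)
    qed (use e K in simp)
    also have "\<dots> < e" using e K by (simp add: field_simps)
    finally show ?thesis .
  qed
  then show ?thesis using d(1) by blast
qed

text \<open>A finite net of mesh \<open>d\<close> controls \<open>h k\<close> on
  \<open>\<Omega>\<close> up to \<open>e / 2\<close>, and on the net the convergence is
  uniform.\<close>

lemma equicontinuous_null_uniform:
  fixes h :: "nat \<Rightarrow> 'a::metric_space \<Rightarrow> real"
  assumes cp: "compact \<Omega>" and lim: "\<And>x. x \<in> \<Omega> \<Longrightarrow> (\<lambda>k. h k x) \<longlonglongrightarrow> 0"
    and eq: "\<And>e. e > 0 \<Longrightarrow> \<exists>d>0. \<forall>k x y. dist x y < d \<longrightarrow> \<bar>h k x - h k y\<bar> < e"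
    and e: "e > 0"
  shows "\<forall>\<^sub>F k in sequentially. \<forall>x\<in>\<Omega>. \<bar>h k x\<bar> < e"
proof -
  obtain d where d: "d > 0" "\<And>k x y. dist x y < d \<Longrightarrow> \<bar>h k x - h k y\<bar> < e / 2"
    using eq[of "e / 2"] e by auto
  obtain F where F: "finite F" "F \<subseteq> \<Omega>" "\<Omega> \<subseteq> (\<Union>x\<in>F. ball x d)"
  proof -
    have "\<exists>k. finite k \<and> k \<subseteq> \<Omega> \<and> \<Omega> \<subseteq> (\<Union>x\<in>k. ball x d)"
      by (rule compactE_image[OF cp, of \<Omega> "\<lambda>x. ball x d"]) (use d(1) in auto)
    then show ?thesis using that by blast
  qed
  have "\<forall>\<^sub>F k in sequentially. \<forall>x\<in>F. \<bar>h k x\<bar> < e / 2"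
    using F(1)
  proof (rule eventually_ball_finite)
    show "\<forall>x\<in>F. \<forall>\<^sub>F k in sequentially. \<bar>h k x\<bar> < e / 2"
    proof
      fix x assume "x \<in> F"
      then have "(\<lambda>k. \<bar>h k x\<bar>) \<longlonglongrightarrow> 0" using F(2) lim by (intro tendsto_rabs_zero) auto
      then show "\<forall>\<^sub>F k in sequentially. \<bar>h k x\<bar> < e / 2" by (rule order_tendstoD(2)) (use e in simp)
    qed
  qed
  then show ?thesis
  proof eventually_elim
    case (elim k)
    show ?case
    proof
      fix x assume "x \<in> \<Omega>"
      then obtain y where y: "y \<in> F" "dist y x < d" using F(3) by auto
      show "\<bar>h k x\<bar> < e" using bspec[OF elim y(1)] d(2)[OF y(2), of k] by linarith
    qed
  qed
qed

text \<open>Test function and measure both depend on \<open>k\<close>, so weak-* convergence cannot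
  be applied to the pairing itself. The bound on the measures is multiplied by the uniform smallness
  of the convolutions.\<close>

lemma weak_star_null_imp_energy_null:
  fixes \<Omega> :: "'a::euclidean_space set"
  assumes ca: "\<And>k. countably_additive_real \<Omega> (\<nu> k)" and cp: "compact \<Omega>" and \<rho>: "\<rho> \<in> C0 UNIV"
    and ws: "\<And>\<phi>. \<phi> \<in> C0 \<Omega> \<Longrightarrow> (\<lambda>k. dual_pairing \<Omega> \<phi> (\<nu> k)) \<longlonglongrightarrow> 0"
  shows "(\<lambda>k. dual_pairing \<Omega> (conv_measure \<Omega> \<rho> (\<nu> k)) (\<nu> k)) \<longlonglongrightarrow> 0"
proof -
  note cont = C0_imp_continuous_on[OF \<rho>]
  obtain C where C: "\<And>x. \<bar>\<rho> x\<bar> \<le> C" using C0_imp_bounded[OF \<rho>] by auto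
  obtain K where K: "K \<ge> 0" and B: "\<And>k \<phi> s. continuous_on UNIV \<phi> \<Longrightarrow> 0 \<le> s \<Longrightarrow>
      (\<And>x. x \<in> \<Omega> \<Longrightarrow> \<bar>\<phi> x\<bar> \<le> s) \<Longrightarrow> \<bar>dual_pairing \<Omega> \<phi> (\<nu> k)\<bar> \<le> K * s"
    using weak_star_null_bounded[OF ca cp ws] by auto
  have unif: "\<forall>\<^sub>F k in sequentially. \<forall>x\<in>\<Omega>. \<bar>conv_measure \<Omega> \<rho> (\<nu> k) x\<bar> < e" if "e > 0" for e
  proof (rule equicontinuous_null_uniform[OF cp _ _ that])
    show "(\<lambda>k. conv_measure \<Omega> \<rho> (\<nu> k) x) \<longlonglongrightarrow> 0" for x
      unfolding conv_measure_def
      by (intro ws C0_compactI[OF cp] continuous_on_subset[OF continuous_on_translate(1)[OF cont] subset_UNIV])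
    show "\<exists>d>0. \<forall>k x y. dist x y < d \<longrightarrow> \<bar>conv_measure \<Omega> \<rho> (\<nu> k) x - conv_measure \<Omega> \<rho> (\<nu> k) y\<bar> < e'"
      if "e' > 0" for e'
      by (rule conv_measure_equicontinuous[OF ca \<rho> K B that])
  qed
  show ?thesis
  proof (rule LIMSEQ_I)
    fix r :: real assume r: "r > 0"
    then have "r / (K + 1) > 0" using K by simp
    from unif[OF this] obtain N where N: "\<And>k x. k \<ge> N \<Longrightarrow> x \<in> \<Omega> \<Longrightarrow> \<bar>conv_measure \<Omega> \<rho> (\<nu> k) x\<bar> < r / (K + 1)"
      by (auto simp: eventually_sequentially)
    have "\<bar>dual_pairing \<Omega> (conv_measure \<Omega> \<rho> (\<nu> k)) (\<nu> k)\<bar> < r" if "k \<ge> N" for k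
    proof -
      have "\<bar>dual_pairing \<Omega> (conv_measure \<Omega> \<rho> (\<nu> k)) (\<nu> k)\<bar> \<le> K * (r / (K + 1))"
        by (rule B[OF conv_measure_continuous[OF cont C ca]]) (use N that r K in \<open>auto intro: less_imp_le\<close>)
      also have "\<dots> < r" using r K by (simp add: field_simps)
      finally show ?thesis .
    qed
    then show "\<exists>no. \<forall>k\<ge>no. norm (dual_pairing \<Omega> (conv_measure \<Omega> \<rho> (\<nu> k)) (\<nu> k) - 0) < r" by auto
  qed
qed


section \<open>The energy as a squared L^2 norm; from the seminorm to weak-* convergence\<close>

text \<open>The majorant \<open>(g w)\<^sup>2 + (r (y - w))\<^sup>2\<close> has an integral over
  \<open>w\<close> that does not depend on \<open>y\<close>, and \<open>V\<close> is finite. The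
  lemma serves with \<open>g\<close> a translate of \<open>r\<close> and with \<open>g\<close> the
  convolution of \<open>r\<close> with the measure.\<close>

lemma polar_convolution_Fubini:
  fixes r g :: "'a::euclidean_space \<Rightarrow> real"
  assumes cont: "continuous_on UNIV r" and r2: "integrable lborel (\<lambda>x. (r x)\<^sup>2)"
    and gm: "g \<in> borel_measurable borel" and g2: "integrable lborel (\<lambda>x. (g x)\<^sup>2)"
    and V: "polar_of \<Omega> \<nu> V \<sigma>"
  shows "(LINT y|V. (LINT w|lborel. g w * r (y - w)) * \<sigma> y) =
      (LINT w|lborel. g w * (LINT y|V. r (y - w) * \<sigma> y))"
proof -
  have V': "finite_measure V" "\<sigma> \<in> borel_measurable V" "\<And>x. \<bar>\<sigma> x\<bar> = 1" using V by (auto simp: polar_of_def)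
  interpret V: finite_measure V by (rule V')
  interpret P: pair_sigma_finite V "lborel :: 'a measure" ..
  note [measurable] = polar_of_id_measurable[OF V] V'(2) gm
  have rm[measurable]: "r \<in> borel_measurable borel" using cont by (rule borel_measurable_continuous_onI)
  have ry: "integrable lborel (\<lambda>w. (r (y - w))\<^sup>2)" "(LINT w|lborel. (r (y - w))\<^sup>2) = (LINT w|lborel. (r w)\<^sup>2)" for y
    using lborel_integrable_affine[OF r2, of "-1" y] lborel_integral_uminus_translate[of "\<lambda>x. (r x)\<^sup>2" y]
    by simp_all
  let ?k = "\<lambda>y w. g w * r (y - w) * \<sigma> y"
  let ?G = "(LINT w|lborel. (g w)\<^sup>2) + (LINT w|lborel. (r w)\<^sup>2)"
  have i2: "integrable lborel (\<lambda>w. (g w)\<^sup>2 + (r (y - w))\<^sup>2)" for y using g2 ry by simp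
  have le: "\<bar>?k y w\<bar> \<le> (g w)\<^sup>2 + (r (y - w))\<^sup>2" for y w
  proof -
    have "2 * (\<bar>g w\<bar> * \<bar>r (y - w)\<bar>) \<le> (g w)\<^sup>2 + (r (y - w))\<^sup>2"
      using sum_squares_bound[of "\<bar>g w\<bar>" "\<bar>r (y - w)\<bar>"] by simp
    moreover have "0 \<le> \<bar>g w\<bar> * \<bar>r (y - w)\<bar>" by simp
    ultimately show ?thesis by (simp only: abs_mult V'(3))
  qed
  have mk: "(\<lambda>w. ?k y w) \<in> borel_measurable lborel" for y
  proof -
    have "(\<lambda>w. r (y - w)) \<in> borel_measurable borel"
      by (intro borel_measurable_continuous_onI continuous_on_translate(1)[OF cont])
    then show ?thesis using gm by simp
  qed
  have ik: "integrable lborel (\<lambda>w. ?k y w)" for y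
    by (rule Bochner_Integration.integrable_bound[OF i2[of y] mk])
      (use le in \<open>auto intro: order_trans[OF _ abs_ge_self]\<close>)
  have k: "integrable (V \<Otimes>\<^sub>M lborel) (\<lambda>(y, w). ?k y w)"
  proof (rule P.Fubini_integrable)
    show mk2: "(\<lambda>(y, w). ?k y w) \<in> borel_measurable (V \<Otimes>\<^sub>M lborel)" by measurable
    have "(\<lambda>y. LINT w|lborel. norm (case (y, w) of (y, w) \<Rightarrow> ?k y w)) \<in> borel_measurable V"
      by (rule lborel.borel_measurable_lebesgue_integral) (use mk2 in measurable)
    then show "integrable V (\<lambda>y. LINT w|lborel. norm (case (y, w) of (y, w) \<Rightarrow> ?k y w))"
    proof (rule V.integrable_const_bound[of _ ?G, rotated], intro AE_I2)
      fix y
      have "(LINT w|lborel. norm (?k y w)) \<le> (LINT w|lborel. (g w)\<^sup>2 + (r (y - w))\<^sup>2)"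
        by (rule integral_mono[OF integrable_norm[OF ik] i2]) (use le in simp)
      also have "\<dots> = ?G" using g2 ry by simp
      finally show "norm (LINT w|lborel. norm (case (y, w) of (y, w) \<Rightarrow> ?k y w)) \<le> ?G" by simp
    qed
    show "AE y in V. integrable lborel (\<lambda>w. case (y, w) of (y, w) \<Rightarrow> ?k y w)" using ik by simp
  qed
  have "(LINT y|V. (LINT w|lborel. g w * r (y - w)) * \<sigma> y) = (LINT y|V. LINT w|lborel. ?k y w)"
    by simp
  also have "\<dots> = (LINT w|lborel. LINT y|V. ?k y w)"
    by (rule P.Fubini_integral[OF k, symmetric])
  also have "\<dots> = (LINT w|lborel. g w * (LINT y|V. r (y - w) * \<sigma> y))"
    by (simp add: mult.assoc)
  finally show ?thesis .
qed

text \<open>Cauchy-Schwarz on \<open>V\<close> bounds the square of the convolution by the total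
  mass times the integral of \<open>(r (w - y))\<^sup>2\<close> over \<open>V\<close>; Tonelli's
  theorem and translation invariance integrate this over \<open>w\<close>.\<close>

lemma conv_measure_square_integrable:
  fixes r :: "'a::euclidean_space \<Rightarrow> real"
  assumes cont: "continuous_on UNIV r" and C: "\<And>x. \<bar>r x\<bar> \<le> C" and r2: "integrable lborel (\<lambda>x. (r x)\<^sup>2)"
    and ca: "countably_additive_real \<Omega> \<nu>"
  shows "integrable lborel (\<lambda>w. (conv_measure \<Omega> r \<nu> w)\<^sup>2)"
proof -
  obtain V \<sigma> where V: "polar_of \<Omega> \<nu> V \<sigma>" by (rule polar_decomposition[OF ca])
  have V': "finite_measure V" "\<sigma> \<in> borel_measurable V" "\<And>x. \<bar>\<sigma> x\<bar> = 1" using V by (auto simp: polar_of_def)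
  interpret V: finite_measure V by (rule V')
  interpret P: pair_sigma_finite V "lborel :: 'a measure" ..
  have idm: "(\<lambda>x. x) \<in> V \<rightarrow>\<^sub>M borel" by (rule polar_of_id_measurable[OF V])
  have rm[measurable]: "r \<in> borel_measurable borel" using cont by (rule borel_measurable_continuous_onI)
  let ?H = "conv_measure \<Omega> r \<nu>"
  have Hm[measurable]: "?H \<in> borel_measurable borel"
    by (rule borel_measurable_continuous_onI[OF conv_measure_continuous[OF cont C ca]])
  have "ennreal ((?H w)\<^sup>2) \<le> emeasure V (space V) * (\<integral>\<^sup>+y. ennreal ((r (w - y))\<^sup>2) \<partial>V)" for w
  proof -
    have m: "(\<lambda>y. complex_of_real (\<sigma> y)) \<in> borel_measurable V" using V'(2) by simp
    have m2: "(\<lambda>y. complex_of_real (r (w - y))) \<in> borel_measurable V"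
      using measurable_compose[OF idm borel_measurable_continuous_onI[OF continuous_on_translate(1)[OF cont, of w]]]
      by simp
    have "?H w = (LINT y|V. \<sigma> y * r (w - y))"
      by (simp add: conv_measure_polar[OF cont C V] mult.commute)
    then have "complex_of_real (?H w) = (LINT y|V. complex_of_real (\<sigma> y) * complex_of_real (r (w - y)))"
      by (simp flip: integral_complex_of_real)
    then have "(norm (LINT y|V. complex_of_real (\<sigma> y) * complex_of_real (r (w - y))))\<^sup>2 = (?H w)\<^sup>2"
      by (metis norm_of_real power2_abs)
    then show ?thesis
      using integral_mult_squared_le[OF m m2] by (simp add: V'(3))
  qed
  then have "(\<integral>\<^sup>+w. ennreal ((?H w)\<^sup>2) \<partial>lborel)
    \<le> (\<integral>\<^sup>+w. emeasure V (space V) * (\<integral>\<^sup>+y. ennreal ((r (w - y))\<^sup>2) \<partial>V) \<partial>lborel)"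
    by (intro nn_integral_mono)
  also have "\<dots> = emeasure V (space V) * (\<integral>\<^sup>+w. \<integral>\<^sup>+y. ennreal ((r (w - y))\<^sup>2) \<partial>V \<partial>lborel)"
  proof (rule nn_integral_cmult)
    note [measurable] = idm
    show "(\<lambda>w. \<integral>\<^sup>+y. ennreal ((r (w - y))\<^sup>2) \<partial>V) \<in> borel_measurable lborel" by measurable
  qed
  also have "(\<integral>\<^sup>+w. \<integral>\<^sup>+y. ennreal ((r (w - y))\<^sup>2) \<partial>V \<partial>lborel) = (\<integral>\<^sup>+y. \<integral>\<^sup>+w. ennreal ((r (w - y))\<^sup>2) \<partial>lborel \<partial>V)"
  proof -
    note [measurable] = idm
    show ?thesis by (rule P.Fubini') measurable
  qed
  also have "\<dots> = (\<integral>\<^sup>+y. ennreal (LINT w|lborel. (r w)\<^sup>2) \<partial>V)"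
  proof (rule nn_integral_cong)
    fix y
    have "integrable lborel (\<lambda>w. (r (w - y))\<^sup>2)" "(LINT w|lborel. (r (w - y))\<^sup>2) = (LINT w|lborel. (r w)\<^sup>2)"
      using lborel_integrable_affine[OF r2, of 1 "- y"] lborel_integral_translate[of "\<lambda>x. (r x)\<^sup>2" "- y"]
      by simp_all
    then show "(\<integral>\<^sup>+w. ennreal ((r (w - y))\<^sup>2) \<partial>lborel) = ennreal (LINT w|lborel. (r w)\<^sup>2)"
      by (simp add: nn_integral_eq_integral)
  qed
  also have "\<dots> = ennreal (LINT w|lborel. (r w)\<^sup>2) * emeasure V (space V)" by simp
  finally have "(\<integral>\<^sup>+w. ennreal ((?H w)\<^sup>2) \<partial>lborel) < \<infinity>"
    by (rule le_less_trans) (simp add: less_top[symmetric] ennreal_mult_eq_top_iff V.emeasure_finite)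
  then show ?thesis by (intro integrableI_bounded) auto
qed

lemma energy_eq_square_integral:
  fixes r \<rho> :: "'a::euclidean_space \<Rightarrow> real"
  assumes cont: "continuous_on UNIV r" and C: "\<And>x. \<bar>r x\<bar> \<le> C" and r2: "integrable lborel (\<lambda>x. (r x)\<^sup>2)"
    and sym: "\<And>x. r (- x) = r x"
    and \<rho>: "\<And>x. \<rho> x = fun_conv r r x" and \<rho>c: "continuous_on UNIV \<rho>" and D: "\<And>x. \<bar>\<rho> x\<bar> \<le> D"
    and ca: "countably_additive_real \<Omega> \<nu>"
  shows "dual_pairing \<Omega> (conv_measure \<Omega> \<rho> \<nu>) \<nu> = (LINT w|lborel. (conv_measure \<Omega> r \<nu> w)\<^sup>2)"
proof -
  obtain V \<sigma> where V: "polar_of \<Omega> \<nu> V \<sigma>" by (rule polar_decomposition[OF ca])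
  have rm: "r \<in> borel_measurable borel" using cont by (rule borel_measurable_continuous_onI)
  have sym': "r (a - b) = r (b - a)" for a b using sym[of "a - b"] by simp
  let ?H = "conv_measure \<Omega> r \<nu>"
  have Hm: "?H \<in> borel_measurable borel"
    by (rule borel_measurable_continuous_onI[OF conv_measure_continuous[OF cont C ca]])
  have H: "?H w = (LINT y|V. r (y - w) * \<sigma> y)" for w
    unfolding conv_measure_polar[OF cont C V] by (subst sym') simp
  have xm: "(\<lambda>w. r (x - w)) \<in> borel_measurable borel" for x
    by (intro borel_measurable_continuous_onI continuous_on_translate(1)[OF cont])
  have x2: "integrable lborel (\<lambda>w. (r (x - w))\<^sup>2)" for x
    using lborel_integrable_affine[OF r2, of "-1" x] by simp
  \<comment> \<open>A shift by \<open>- y\<close> and the symmetry of \<open>r\<close> turn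
    \<open>\<rho> (x - y)\<close> into the L^2 inner product of the translates of \<open>r\<close>
    centred at \<open>x\<close> and \<open>y\<close>.\<close>
  have \<rho>': "\<rho> (x - y) = (LINT w|lborel. r (x - w) * r (y - w))" for x y
  proof -
    have m: "(\<lambda>z. r (x - y - z) * r z) \<in> borel_measurable borel"
      using rm xm[of "x - y"] by simp
    have "\<rho> (x - y) = (LINT w|lborel. r (x - y - (- y + w)) * r (- y + w))"
      unfolding \<rho> fun_conv_def by (rule lborel_integral_translate[OF m, symmetric])
    also have "\<dots> = (LINT w|lborel. r (x - w) * r (y - w))"
      by (rule Bochner_Integration.integral_cong[OF refl]) (use sym' in simp)
    finally show ?thesis .
  qed
  have h: "(LINT y|V. \<rho> (x - y) * \<sigma> y) = (LINT w|lborel. r (x - w) * ?H w)" for x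
    unfolding \<rho>' H by (rule polar_convolution_Fubini[OF cont r2 xm x2 V])
  have "dual_pairing \<Omega> (conv_measure \<Omega> \<rho> \<nu>) \<nu> = (LINT x|V. (LINT w|lborel. ?H w * r (x - w)) * \<sigma> x)"
    unfolding dual_pairing_conv_polar[OF \<rho>c D V V ca] h by (simp only: mult.commute[of "r _"])
  also have "\<dots> = (LINT w|lborel. ?H w * (LINT y|V. r (y - w) * \<sigma> y))"
    by (rule polar_convolution_Fubini[OF cont r2 Hm conv_measure_square_integrable[OF cont C r2 ca] V])
  also have "\<dots> = (LINT w|lborel. (?H w)\<^sup>2)" unfolding H[symmetric] by (simp only: power2_eq_square)
  finally show ?thesis .
qed

text \<open>If \<open>\<bar>h k y\<bar> \<ge> e\<close>, then
  \<open>\<bar>h k\<bar> \<ge> e / 2\<close> on the ball of radius \<open>d\<close> about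
  \<open>y\<close>, with \<open>d\<close> independent of \<open>k\<close>; the integral of the
  square is then at least \<open>(e / 2)\<^sup>2\<close> times the volume of that ball.\<close>

lemma equicontinuous_square_integral_null:
  fixes h :: "nat \<Rightarrow> 'a::euclidean_space \<Rightarrow> real"
  assumes eq: "\<And>e. e > 0 \<Longrightarrow> \<exists>d>0. \<forall>k x y. dist x y < d \<longrightarrow> \<bar>h k x - h k y\<bar> < e"
    and i: "\<And>k. integrable lborel (\<lambda>x. (h k x)\<^sup>2)"
    and lim: "(\<lambda>k. LINT x|lborel. (h k x)\<^sup>2) \<longlonglongrightarrow> 0"
  shows "(\<lambda>k. h k y) \<longlonglongrightarrow> 0"
proof (rule LIMSEQ_I)
  fix e :: real assume e: "e > 0"
  obtain d where d: "d > 0" "\<forall>k x y. dist x y < d \<longrightarrow> \<bar>h k x - h k y\<bar> < e / 2"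
    using eq[of "e / 2"] e by auto
  have fin: "emeasure lborel (ball y d) < \<infinity>" by (rule emeasure_bounded_finite) simp
  have pos: "measure lborel (ball y d) > 0" using d(1) by (rule content_ball_pos)
  then have "(e / 2)\<^sup>2 * measure lborel (ball y d) > 0" using e by simp
  from order_tendstoD(2)[OF lim this]
  obtain N where N: "\<And>k. k \<ge> N \<Longrightarrow> (LINT x|lborel. (h k x)\<^sup>2) < (e / 2)\<^sup>2 * measure lborel (ball y d)"
    by (auto simp: eventually_sequentially)
  have "\<bar>h k y\<bar> < e" if k: "k \<ge> N" for k
  proof (rule ccontr)
    assume "\<not> \<bar>h k y\<bar> < e"
    then have big: "e / 2 \<le> \<bar>h k x\<bar>" if "x \<in> ball y d" for x
    proof -
      have "\<bar>h k y - h k x\<bar> < e / 2" using d(2) that by auto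
      then show ?thesis using \<open>\<not> \<bar>h k y\<bar> < e\<close> by linarith
    qed
    have "(LINT x|lborel. (e / 2)\<^sup>2 * indicator (ball y d) x) \<le> (LINT x|lborel. (h k x)\<^sup>2)"
    proof (rule integral_mono)
      show "integrable lborel (\<lambda>x. (e / 2)\<^sup>2 * indicator (ball y d) x)"
        using fin by (intro integrable_mult_right integrable_real_indicator) auto
      show "(e / 2)\<^sup>2 * indicator (ball y d) x \<le> (h k x)\<^sup>2" for x
      proof (cases "x \<in> ball y d")
        case True
        have "(e / 2)\<^sup>2 \<le> \<bar>h k x\<bar>\<^sup>2" using big[OF True] e by (intro power_mono) auto
        then show ?thesis using True by simp
      qed simp
    qed (rule i)
    then show False using N[OF k] by simp
  qed
  then show "\<exists>no. \<forall>k\<ge>no. norm (h k y - 0) < e" by auto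
qed

lemma dual_pairing_sum:
  assumes ca: "countably_additive_real \<Omega> \<mu>" and F: "finite F" and b: "\<And>v. v \<in> F \<Longrightarrow> bdd_meas \<Omega> v"
  shows "bdd_meas \<Omega> (\<lambda>x. \<Sum>v\<in>F. c v * v x) \<and>
    dual_pairing \<Omega> (\<lambda>x. \<Sum>v\<in>F. c v * v x) \<mu> = (\<Sum>v\<in>F. c v * dual_pairing \<Omega> v \<mu>)"
  using F b
proof (induction F rule: finite_induct)
  case empty
  have "bdd_meas \<Omega> (\<lambda>_. 0)" by (rule bdd_measI[of _ _ 0]) auto
  then show ?case by (simp add: dual_pairing_def)
next
  case (insert v F)
  have 1: "bdd_meas \<Omega> (\<lambda>x. c v * v x)" using insert.prems by (intro bdd_meas_mult) simp
  have 2: "bdd_meas \<Omega> (\<lambda>x. \<Sum>v\<in>F. c v * v x)" using insert by simp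
  have "dual_pairing \<Omega> (\<lambda>x. c v * v x) \<mu> = c v * dual_pairing \<Omega> v \<mu>"
    using insert.prems by (intro dual_pairing_mult[OF ca]) simp
  then show ?case
    using insert.IH insert.prems insert.hyps bdd_meas_add[OF 1 2] dual_pairing_add[OF ca 1 2] by simp
qed

text \<open>Convergence on translates of \<open>r\<close> extends to their span by linearity and to
  \<open>C0 \<Omega>\<close> by density; the bound \<open>K\<close> makes the approximation error
  uniform in \<open>k\<close>.\<close>

lemma energy_null_imp_weak_star_null:
  fixes r \<rho> :: "'a::euclidean_space \<Rightarrow> real"
  assumes r: "r \<in> C0 UNIV" "integrable lborel (\<lambda>x. (r x)\<^sup>2)" "\<And>x. r (- x) = r x"
    and \<rho>: "\<And>x. \<rho> x = fun_conv r r x" "\<rho> \<in> C0 UNIV"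
    and fund: "fundamental_C0 \<Omega> (translates r \<Omega>)"
    and ca: "\<And>k. countably_additive_real \<Omega> (\<nu> k)" and K: "K \<ge> 0"
    and B: "\<And>k \<phi> s. bdd_meas \<Omega> \<phi> \<Longrightarrow> 0 \<le> s \<Longrightarrow> (\<And>x. x \<in> \<Omega> \<Longrightarrow> \<bar>\<phi> x\<bar> \<le> s) \<Longrightarrow>
      \<bar>dual_pairing \<Omega> \<phi> (\<nu> k)\<bar> \<le> K * s"
    and null: "(\<lambda>k. dual_pairing \<Omega> (conv_measure \<Omega> \<rho> (\<nu> k)) (\<nu> k)) \<longlonglongrightarrow> 0"
    and \<phi>: "\<phi> \<in> C0 \<Omega>"
  shows "(\<lambda>k. dual_pairing \<Omega> \<phi> (\<nu> k)) \<longlonglongrightarrow> 0"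
proof -
  note cont = C0_imp_continuous_on[OF r(1)]
  obtain C where C: "\<And>x. \<bar>r x\<bar> \<le> C" using C0_imp_bounded[OF r(1)] by auto
  obtain D where D: "\<And>x. \<bar>\<rho> x\<bar> \<le> D" using C0_imp_bounded[OF \<rho>(2)] by auto
  have B': "\<bar>dual_pairing \<Omega> \<phi> (\<nu> k)\<bar> \<le> K * s"
    if "continuous_on UNIV \<phi>" "0 \<le> s" "\<And>x. x \<in> \<Omega> \<Longrightarrow> \<bar>\<phi> x\<bar> \<le> s" for k \<phi> s
  proof (rule B[OF bdd_measI])
    show "\<phi> \<in> borel_measurable (restrict_space borel \<Omega>)"
      by (rule borel_measurable_continuous_on_restrict[OF continuous_on_subset[OF that(1) subset_UNIV]])
  qed (use that in auto)
  have conv0: "(\<lambda>k. conv_measure \<Omega> r (\<nu> k) y) \<longlonglongrightarrow> 0" for y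
  proof (rule equicontinuous_square_integral_null)
    show "\<exists>d>0. \<forall>k x y. dist x y < d \<longrightarrow> \<bar>conv_measure \<Omega> r (\<nu> k) x - conv_measure \<Omega> r (\<nu> k) y\<bar> < e"
      if "e > 0" for e
      by (rule conv_measure_equicontinuous[OF ca r(1) K B' that])
    show "integrable lborel (\<lambda>x. (conv_measure \<Omega> r (\<nu> k) x)\<^sup>2)" for k
      by (rule conv_measure_square_integrable[OF cont C r(2) ca])
    show "(\<lambda>k. LINT x|lborel. (conv_measure \<Omega> r (\<nu> k) x)\<^sup>2) \<longlonglongrightarrow> 0"
      using null unfolding energy_eq_square_integral[OF cont C r(2,3) \<rho>(1) C0_imp_continuous_on[OF \<rho>(2)] D ca] .
  qed
  have tr0: "(\<lambda>k. dual_pairing \<Omega> v (\<nu> k)) \<longlonglongrightarrow> 0" and trb: "bdd_meas \<Omega> v"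
    if v: "v \<in> translates r \<Omega>" for v
  proof -
    obtain y where y: "v = (\<lambda>x. r (x - y))" using v by (auto simp: translates_def)
    \<comment> \<open>\<open>translates\<close> consists of functions \<open>r (x - y)\<close>,
      while \<open>conv_measure\<close> at \<open>y\<close> integrates \<open>r (y - x)\<close>;
      symmetry identifies the two.\<close>
    have "r (x - y) = r (y - x)" for x using r(3)[of "x - y"] by simp
    then have v_eq: "v = (\<lambda>x. r (y - x))" unfolding y by (simp add: fun_eq_iff)
    show "bdd_meas \<Omega> v" unfolding v_eq by (rule bdd_meas_translate[OF cont C])
    show "(\<lambda>k. dual_pairing \<Omega> v (\<nu> k)) \<longlonglongrightarrow> 0"
      using conv0[of y] unfolding v_eq conv_measure_def .
  qed
  obtain g where g: "\<And>j::nat. g j \<in> fun_span (translates r \<Omega>)" "uniform_limit \<Omega> g \<phi> sequentially"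
    using fund \<phi> unfolding fundamental_C0_def by blast
  have \<phi>b: "bdd_meas \<Omega> \<phi>" by (rule C0_imp_bdd_meas[OF \<phi>])
  show ?thesis
  proof (rule LIMSEQ_I)
    fix e :: real assume e: "e > 0"
    \<comment> \<open>Chosen so that \<open>K * s < e / 2\<close> holds also for
      \<open>K = 0\<close>.\<close>
    define s where "s = e / (2 * (K + 1))"
    have s: "s > 0" "K * s < e / 2" using e K by (auto simp: s_def field_simps)
    have "\<forall>\<^sub>F j in sequentially. \<forall>x\<in>\<Omega>. dist (g j x) (\<phi> x) < s"
      using g(2) s(1) by (rule uniform_limitD)
    then obtain j where j: "\<forall>x\<in>\<Omega>. dist (g j x) (\<phi> x) < s"
      by (auto simp: eventually_sequentially)
    obtain F c where F: "finite F" "F \<subseteq> translates r \<Omega>" "g j = (\<lambda>x. \<Sum>v\<in>F. c v * v x)"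
      using g(1)[of j] by (auto simp: fun_span_def)
    have gs: "bdd_meas \<Omega> (g j)" "dual_pairing \<Omega> (g j) (\<nu> k) = (\<Sum>v\<in>F. c v * dual_pairing \<Omega> v (\<nu> k))" for k
      using dual_pairing_sum[OF ca[of k] F(1), of c] trb F(2) unfolding F(3) by blast+
    have "(\<lambda>k. dual_pairing \<Omega> (g j) (\<nu> k)) \<longlonglongrightarrow> (\<Sum>v\<in>F. c v * 0)"
      unfolding gs(2) using F(2) by (intro tendsto_sum tendsto_mult tendsto_const tr0) auto
    then have "(\<lambda>k. dual_pairing \<Omega> (g j) (\<nu> k)) \<longlonglongrightarrow> 0" by simp
    then obtain N where N: "\<And>k. k \<ge> N \<Longrightarrow> norm (dual_pairing \<Omega> (g j) (\<nu> k) - 0) < e / 2"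
      using LIMSEQ_D[of _ 0 "e / 2"] e by (metis half_gt_zero)
    have "\<bar>dual_pairing \<Omega> \<phi> (\<nu> k)\<bar> < e" if k: "k \<ge> N" for k
    proof -
      have "bdd_meas \<Omega> (\<lambda>x. \<phi> x - g j x)"
        using bdd_meas_add[OF \<phi>b bdd_meas_mult[OF gs(1), of "-1"]] by simp
      then have "\<bar>dual_pairing \<Omega> (\<lambda>x. \<phi> x - g j x) (\<nu> k)\<bar> \<le> K * s"
      proof (rule B)
        show "\<bar>\<phi> x - g j x\<bar> \<le> s" if "x \<in> \<Omega>" for x
          using bspec[OF j that] by (simp add: dist_real_def)
      qed (use s in simp)
      moreover have "dual_pairing \<Omega> (\<lambda>x. \<phi> x - g j x) (\<nu> k) = dual_pairing \<Omega> \<phi> (\<nu> k) - dual_pairing \<Omega> (g j) (\<nu> k)"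
        by (rule dual_pairing_diff[OF ca \<phi>b gs(1)])
      moreover have "\<bar>dual_pairing \<Omega> (g j) (\<nu> k)\<bar> < e / 2" using N[OF k] by simp
      ultimately show ?thesis using s(2) by linarith
    qed
    then show "\<exists>no. \<forall>k\<ge>no. norm (dual_pairing \<Omega> \<phi> (\<nu> k) - 0) < e" by auto
  qed
qed

theorem theorem2p4:
  fixes \<rho> :: "real ^ 'n \<Rightarrow> real"
    and \<Omega> :: "(real ^ 'n) set"
    and D :: "((real ^ 'n) set \<Rightarrow> real) \<Rightarrow> real ^ 'n \<Rightarrow> real"
  assumes "\<rho> \<in> C0 UNIV" and "\<rho> \<in> L2"
    and "\<exists>x. \<rho> x \<noteq> 0"
    and "fun_symmetric \<rho>"
    and "fun_pos_semidef \<rho>"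
    and "closed \<Omega>"
    and D_def: "D = conv_measure \<Omega> \<rho>"
  shows "bounded_operator \<Omega> D \<and>
    \<comment> \<open>(i)\<close>
    self_adjoint \<Omega> D \<and> op_pos_semidef \<Omega> D \<and>
    \<comment> \<open>(ii)\<close>
    (\<forall>\<mu>\<in>discrete_measures \<Omega>. \<mu> \<noteq> (\<lambda>A. 0) \<longrightarrow> dual_pairing \<Omega> (D \<mu>) \<mu> > 0) \<and>
    (compact \<Omega> \<longrightarrow>
      (\<forall>\<rho>h. \<rho>h \<in> L2 \<and> \<rho>h \<in> C0 UNIV \<and> \<rho> = fun_conv \<rho>h \<rho>h \<longrightarrow>
        (\<forall>\<mu>s \<mu>. (\<forall>k::nat. \<mu>s k \<in> radon_measures \<Omega>) \<and> \<mu> \<in> radon_measures \<Omega> \<longrightarrow>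
          \<comment> \<open>(iii)\<close>
          (weak_star_tendsto \<Omega> \<mu>s \<mu> \<longrightarrow>
             (\<lambda>k. op_seminorm \<Omega> D (\<lambda>A. \<mu>s k A - \<mu> A)) \<longlonglongrightarrow> 0) \<and>
          \<comment> \<open>(iv)\<close>
          (fundamental_C0 \<Omega> (translates \<rho>h \<Omega>) \<and>
           (\<lambda>k. op_seminorm \<Omega> D (\<lambda>A. \<mu>s k A - \<mu> A)) \<longlonglongrightarrow> 0 \<and>
           bdd_above (range (\<lambda>k. radon_norm \<Omega> (\<mu>s k))) \<longrightarrow>
             weak_star_tendsto \<Omega> \<mu>s \<mu>))))"
proof -
  have ca: "countably_additive_real \<Omega> \<mu>" if "\<mu> \<in> radon_measures \<Omega>" for \<mu>
    using that by (simp add: radon_measures_def)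
  note cont = C0_imp_continuous_on[OF assms(1)]
  obtain C where C: "\<And>x. \<bar>\<rho> x\<bar> \<le> C" using C0_imp_bounded[OF assms(1)] by auto
  have sym: "\<rho> (- x) = \<rho> x" for x using assms(4) by (simp add: fun_symmetric_def)
  obtain v where v: "integrable lborel v" "\<And>\<xi>. 0 \<le> v \<xi>"
    and inv: "\<And>x. complex_of_real (\<rho> x) = inv_fourier (\<lambda>\<xi>. complex_of_real (v \<xi>)) x"
    using pos_semidef_inversion[OF cont C assms(5)] by blast
  have energy_nonneg: "0 \<le> dual_pairing \<Omega> (D \<mu>) \<mu>" if \<mu>: "countably_additive_real \<Omega> \<mu>" for \<mu>
  proof -
    obtain V \<sigma> where V: "polar_of \<Omega> \<mu> V \<sigma>" by (rule polar_decomposition[OF \<mu>])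
    show ?thesis
      unfolding D_def energy_representation(2)[OF cont C v(1) inv V \<mu>]
      using v(2) by (intro integral_nonneg_AE) auto
  qed
  have "bounded_operator \<Omega> D"
    unfolding bounded_operator_def
  proof (intro conjI ballI allI exI)
    fix \<mu> assume "\<mu> \<in> radon_measures \<Omega>"
    note \<mu> = ca[OF this]
    show "D \<mu> \<in> C0 \<Omega>" unfolding D_def by (rule conv_measure_C0[OF assms(1) \<mu> assms(6)])
    fix x
    \<comment> \<open>A scalar multiple is the combination of \<open>\<mu>\<close> with itself whose
      second coefficient is 0.\<close>
    show "D (\<lambda>A. c * \<mu> A) x = c * D \<mu> x" for c
      using dual_pairing_lincomb[OF \<mu> \<mu> bdd_meas_translate[OF cont C, where x=x], where a=c and b=0]
      by (simp add: D_def conv_measure_def)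
    show "\<bar>D \<mu> x\<bar> \<le> C * radon_norm \<Omega> \<mu>"
      unfolding D_def by (rule conv_measure_bound[OF cont C \<mu>])
    fix \<nu> assume "\<nu> \<in> radon_measures \<Omega>"
    note \<nu> = ca[OF this]
    show "D (\<lambda>A. \<mu> A + \<nu> A) x = D \<mu> x + D \<nu> x"
      using dual_pairing_lincomb[OF \<mu> \<nu> bdd_meas_translate[OF cont C, where x=x], where a=1 and b=1]
      by (simp add: D_def conv_measure_def)
  qed
  moreover have "self_adjoint \<Omega> D"
    unfolding self_adjoint_def D_def
    by (intro ballI self_adjoint_conv_measure[OF cont C sym] ca)
  moreover have "op_pos_semidef \<Omega> D"
    unfolding op_pos_semidef_def by (intro ballI energy_nonneg ca)
  moreover have "\<forall>\<mu>\<in>discrete_measures \<Omega>. \<mu> \<noteq> (\<lambda>A. 0) \<longrightarrow> dual_pairing \<Omega> (D \<mu>) \<mu> > 0"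
    unfolding D_def using energy_discrete_pos[OF cont C v inv assms(3)] by blast
  moreover have "(weak_star_tendsto \<Omega> \<mu>s \<mu> \<longrightarrow>
        (\<lambda>k. op_seminorm \<Omega> D (\<lambda>A. \<mu>s k A - \<mu> A)) \<longlonglongrightarrow> 0) \<and>
      (fundamental_C0 \<Omega> (translates \<rho>h \<Omega>) \<and>
        (\<lambda>k. op_seminorm \<Omega> D (\<lambda>A. \<mu>s k A - \<mu> A)) \<longlonglongrightarrow> 0 \<and>
        bdd_above (range (\<lambda>k. radon_norm \<Omega> (\<mu>s k))) \<longrightarrow> weak_star_tendsto \<Omega> \<mu>s \<mu>)"
    if cp: "compact \<Omega>" and h: "\<rho>h \<in> L2" "\<rho>h \<in> C0 UNIV" "\<rho> = fun_conv \<rho>h \<rho>h"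
      and \<mu>s: "\<And>k. \<mu>s k \<in> radon_measures \<Omega>" and \<mu>: "\<mu> \<in> radon_measures \<Omega>" for \<rho>h \<mu>s \<mu>
  proof (intro conjI impI)
    \<comment> \<open>Both implications are statements about the differences; linearity of the
      pairing in the measure translates weak-* convergence to \<open>\<mu>\<close> into weak-*
      convergence of \<open>\<nu>\<close> to 0.\<close>
    define \<nu> where "\<nu> k = (\<lambda>A. \<mu>s k A - \<mu> A)" for k
    have \<nu>_eq: "\<nu> k = (\<lambda>A. 1 * \<mu>s k A + (-1) * \<mu> A)" for k by (simp add: \<nu>_def fun_eq_iff)
    have ca\<nu>: "countably_additive_real \<Omega> (\<nu> k)" for k
      unfolding \<nu>_eq by (rule ca_lincomb[OF ca[OF \<mu>s] ca[OF \<mu>]])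
    have pair: "dual_pairing \<Omega> \<phi> (\<nu> k) = dual_pairing \<Omega> \<phi> (\<mu>s k) - dual_pairing \<Omega> \<phi> \<mu>"
      if "bdd_meas \<Omega> \<phi>" for \<phi> k
      unfolding \<nu>_eq using dual_pairing_lincomb[OF ca[OF \<mu>s[of k]] ca[OF \<mu>] that, where a=1 and b="-1"] by simp
    {
      assume ws: "weak_star_tendsto \<Omega> \<mu>s \<mu>"
      have "(\<lambda>k. dual_pairing \<Omega> \<phi> (\<nu> k)) \<longlonglongrightarrow> 0" if \<phi>: "\<phi> \<in> C0 \<Omega>" for \<phi>
        using ws \<phi> unfolding pair[OF C0_imp_bdd_meas[OF \<phi>]] weak_star_tendsto_def
        by (intro LIM_zero) blast
      from weak_star_null_imp_energy_null[OF ca\<nu> cp assms(1) this]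
      have "(\<lambda>k. sqrt (dual_pairing \<Omega> (D (\<nu> k)) (\<nu> k))) \<longlonglongrightarrow> sqrt 0"
        unfolding D_def by (rule tendsto_real_sqrt)
      then show "(\<lambda>k. op_seminorm \<Omega> D (\<lambda>A. \<mu>s k A - \<mu> A)) \<longlonglongrightarrow> 0"
        by (simp add: op_seminorm_def \<nu>_def)
    next
      assume a: "fundamental_C0 \<Omega> (translates \<rho>h \<Omega>) \<and>
        (\<lambda>k. op_seminorm \<Omega> D (\<lambda>A. \<mu>s k A - \<mu> A)) \<longlonglongrightarrow> 0 \<and>
        bdd_above (range (\<lambda>k. radon_norm \<Omega> (\<mu>s k)))"
      then have fund: "fundamental_C0 \<Omega> (translates \<rho>h \<Omega>)" by simp
      \<comment> \<open>Squaring recovers the energy from the seminorm, because the energy is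
        nonnegative.\<close>
      have "(\<lambda>k. (sqrt (dual_pairing \<Omega> (D (\<nu> k)) (\<nu> k)))\<^sup>2) \<longlonglongrightarrow> 0\<^sup>2"
        using a by (intro tendsto_power) (simp add: op_seminorm_def \<nu>_def)
      then have "(\<lambda>k. dual_pairing \<Omega> (D (\<nu> k)) (\<nu> k)) \<longlonglongrightarrow> 0"
        by (simp only: real_sqrt_pow2[OF energy_nonneg[OF ca\<nu>]] zero_power2)
      then have null: "(\<lambda>k. dual_pairing \<Omega> (conv_measure \<Omega> \<rho> (\<nu> k)) (\<nu> k)) \<longlonglongrightarrow> 0"
        by (simp only: D_def)
      obtain M where M: "\<And>k. radon_norm \<Omega> (\<mu>s k) \<le> M" using a by (auto simp: bdd_above_def)
      \<comment> \<open>Read off from the bound on the pairing, applied to the zero function with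
        the constant 1.\<close>
      have norm_nonneg: "0 \<le> radon_norm \<Omega> \<kappa>" if "\<kappa> \<in> radon_measures \<Omega>" for \<kappa>
        using dual_pairing_abs_le[OF ca[OF that] bdd_meas_continuous[of "\<lambda>_. 0" 0], of 1]
        by simp
      \<comment> \<open>By the triangle inequality this bounds the pairings of all
        \<open>\<nu> k\<close> with test functions of modulus at most 1.\<close>
      define K where "K = M + radon_norm \<Omega> \<mu>"
      have K: "0 \<le> K" using norm_nonneg[OF \<mu>] norm_nonneg[OF \<mu>s] M[of 0] unfolding K_def by (meson add_nonneg_nonneg order_trans)
      have B: "\<bar>dual_pairing \<Omega> \<phi> (\<nu> k)\<bar> \<le> K * s"
        if \<phi>: "bdd_meas \<Omega> \<phi>" and s: "0 \<le> s" "\<And>x. x \<in> \<Omega> \<Longrightarrow> \<bar>\<phi> x\<bar> \<le> s" for k \<phi> s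
      proof -
        have "\<bar>dual_pairing \<Omega> \<phi> (\<mu>s k)\<bar> \<le> s * radon_norm \<Omega> (\<mu>s k)"
          by (rule dual_pairing_abs_le[OF ca[OF \<mu>s] \<phi> s(2)])
        also have "\<dots> \<le> s * M" by (rule mult_left_mono[OF M s(1)])
        finally have "\<bar>dual_pairing \<Omega> \<phi> (\<mu>s k)\<bar> \<le> s * M" .
        moreover have "\<bar>dual_pairing \<Omega> \<phi> \<mu>\<bar> \<le> s * radon_norm \<Omega> \<mu>"
          by (rule dual_pairing_abs_le[OF ca[OF \<mu>] \<phi> s(2)])
        moreover have "K * s = s * M + s * radon_norm \<Omega> \<mu>" by (simp add: K_def algebra_simps)
        ultimately show ?thesis unfolding pair[OF \<phi>] by linarith
      qed
      note hcont = C0_imp_continuous_on[OF h(2)]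
      obtain Ch where Ch: "\<And>x. \<bar>\<rho>h x\<bar> \<le> Ch" using C0_imp_bounded[OF h(2)] by auto
      have h2: "integrable lborel (\<lambda>x. (\<rho>h x)\<^sup>2)" using h(1) by (simp add: L2_def)
      have conv: "\<rho> x = fun_conv \<rho>h \<rho>h x" for x using h(3) by simp
      have hsym: "\<rho>h (- x) = \<rho>h x" for x
        by (rule convolution_square_root_symmetric[OF hcont Ch h2 conv v inv])
      show "weak_star_tendsto \<Omega> \<mu>s \<mu>"
        unfolding weak_star_tendsto_def
      proof
        fix \<phi> assume \<phi>: "\<phi> \<in> C0 \<Omega>"
        have "(\<lambda>k. dual_pairing \<Omega> \<phi> (\<nu> k)) \<longlonglongrightarrow> 0"
          by (rule energy_null_imp_weak_star_null[OF h(2) h2 hsym conv assms(1) fund ca\<nu> K B null \<phi>])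
        then show "(\<lambda>k. dual_pairing \<Omega> \<phi> (\<mu>s k)) \<longlonglongrightarrow> dual_pairing \<Omega> \<phi> \<mu>"
          unfolding pair[OF C0_imp_bdd_meas[OF \<phi>]] by (rule LIM_zero_cancel)
      qed
    }
  qed
  ultimately show ?thesis by blast
qed

end
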